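(* Let $X$ be a smooth subvariety of an abelian variety $A^n$ of dimension $n$. If the general fiber of the tangent map $f:\mathbb{P}(\Omega^1_X)\to\mathbb{P}^{n-1}$ is positive dimensional, then for every $m\ge0$ and every negative line bundle $L$ on $X$, $$H^0(X,S^m\Omega^1_X\otimes L)=0.$$
   Context: Varieties are over $\mathbb{C}$; $S^m$ is the $m$-th symmetric power. A line bundle is negative if its dual is ample. $\mathbb{P}(E)$ denotes the projective bundle of hyperplanes of $E$. The surjection $\Omega^1_{A^n}|_X\to\Omega^1_X$ induces an inclusion $j:\mathbb{P}(\Omega^1_X)\hookrightarrow\mathbb{P}(\Omega^1_{A^n}|_X)\subset\mathbb{P}(\Omega^1_{A^n})\simeq A^n\times\mathbb{P}^{n-1}$ (the cotangent bundle of $A^n$ being trivial). The tangent map of $X$ in $A^n$ is $f=p_2\circ j$, with $p_2$ the projection to $\mathbb{P}^{n-1}$. The general fiber of $f$ is the fiber over a general point of the image of $f$. *)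

theory Defs
  imports "HOL-Analysis.Analysis" "HOL-Algebra.Group" "HOL-Library.Function_Algebras"
begin

text \<open>Complex algebraic varieties are taken in the sense of Serre: a set of (closed) points with its
  Zariski topology and its sheaf of regular functions, locally isomorphic to affine algebraic sets.\<close>

section \<open>Topological notions\<close>

definition irreducible_space :: "'a topology \<Rightarrow> bool" where
  "irreducible_space T \<longleftrightarrow> topspace T \<noteq> {} \<and>
     (\<forall>F G. closedin T F \<and> closedin T G \<and> topspace T \<subseteq> F \<union> G \<longrightarrow>
            F = topspace T \<or> G = topspace T)"

definition krull_dim :: "'a topology \<Rightarrow> enat" where
  "krull_dim T = Sup {enat k | k.
     \<exists>Z. (\<forall>i\<le>k. closedin T (Z i) \<and> irreducible_space (subtopology T (Z i))) \<and>
         (\<forall>i<k. Z i \<subset> Z (Suc i))}"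

text \<open>The non-emptiness of the dense open set only matters for the empty space, which has no
  general point.\<close>

definition for_general_point :: "'a topology \<Rightarrow> ('a \<Rightarrow> bool) \<Rightarrow> bool" where
  "for_general_point T P \<longleftrightarrow>
     (\<exists>V. openin T V \<and> V \<noteq> {} \<and> T closure_of V = topspace T \<and> (\<forall>x\<in>V. P x))"


section \<open>Spaces with functions\<close>

text \<open>A member of \<open>reg X U\<close> represents a regular function on \<open>U\<close>; its values outside \<open>U\<close> are
  irrelevant. Only open \<open>U\<close> matter.\<close>

record 'a fspace =
  ztop :: "'a topology"
  reg :: "'a set \<Rightarrow> ('a \<Rightarrow> complex) set"

abbreviation points :: "('a, 'm) fspace_scheme \<Rightarrow> 'a set" where
  "points X \<equiv> topspace (ztop X)"

definition function_space :: "'a fspace \<Rightarrow> bool" where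
  "function_space X \<longleftrightarrow>
    (\<forall>U. openin (ztop X) U \<longrightarrow>
      (\<forall>c. (\<lambda>_. c) \<in> reg X U) \<and>
      (\<forall>f\<in>reg X U. \<forall>g\<in>reg X U. (\<lambda>x. f x + g x) \<in> reg X U \<and> (\<lambda>x. f x * g x) \<in> reg X U) \<and>
      (\<forall>V. openin (ztop X) V \<and> V \<subseteq> U \<longrightarrow> reg X U \<subseteq> reg X V) \<and>
      (\<forall>f. (\<forall>x\<in>U. \<exists>V. openin (ztop X) V \<and> x \<in> V \<and> V \<subseteq> U \<and>
                   (\<exists>g\<in>reg X V. \<forall>y\<in>V. f y = g y))
           \<longrightarrow> f \<in> reg X U))"

definition morphism :: "'a fspace \<Rightarrow> 'b fspace \<Rightarrow> ('a \<Rightarrow> 'b) \<Rightarrow> bool" where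
  "morphism X Y \<phi> \<longleftrightarrow> continuous_map (ztop X) (ztop Y) \<phi> \<and>
     (\<forall>V f. openin (ztop Y) V \<and> f \<in> reg Y V \<longrightarrow> f \<circ> \<phi> \<in> reg X {x \<in> points X. \<phi> x \<in> V})"

definition isomorphism :: "'a fspace \<Rightarrow> 'b fspace \<Rightarrow> ('a \<Rightarrow> 'b) \<Rightarrow> bool" where
  "isomorphism X Y \<phi> \<longleftrightarrow> morphism X Y \<phi> \<and>
     (\<exists>\<psi>. morphism Y X \<psi> \<and> (\<forall>x\<in>points X. \<psi> (\<phi> x) = x) \<and> (\<forall>y\<in>points Y. \<phi> (\<psi> y) = y))"

text \<open>The induced structure: the open subspace if \<open>S\<close> is open, the closed subspace with its reduced
  structure if \<open>S\<close> is closed.\<close>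

definition induced :: "'a fspace \<Rightarrow> 'a set \<Rightarrow> 'a fspace" where
  "induced X S = \<lparr> ztop = subtopology (ztop X) S,
     reg = (\<lambda>U. {f. \<forall>x\<in>U. \<exists>V. openin (ztop X) V \<and> x \<in> V \<and>
                      (\<exists>g\<in>reg X V. \<forall>y\<in>U \<inter> V. f y = g y)}) \<rparr>"

text \<open>The product variety: locally, its regular functions are quotients of finite sums
  \<open>\<Sum>k. f k x * g k y\<close>, and the non-vanishing loci of such sums form a base of its topology.\<close>

definition bireg :: "'a fspace \<Rightarrow> 'b fspace \<Rightarrow> 'a set \<Rightarrow> 'b set \<Rightarrow> ('a \<times> 'b \<Rightarrow> complex) set" where
  "bireg X Y U V = {h. \<exists>K f g. (\<forall>k<K::nat. f k \<in> reg X U \<and> g k \<in> reg Y V) \<and>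
                              h = (\<lambda>(x, y). \<Sum>k<K. f k x * g k y)}"

definition product_top :: "'a fspace \<Rightarrow> 'b fspace \<Rightarrow> ('a \<times> 'b) topology" where
  "product_top X Y = topology_generated_by
     {{z \<in> U \<times> V. h z \<noteq> 0} | U V h.
        openin (ztop X) U \<and> openin (ztop Y) V \<and> h \<in> bireg X Y U V}"

definition product :: "'a fspace \<Rightarrow> 'b fspace \<Rightarrow> ('a \<times> 'b) fspace" where
  "product X Y = \<lparr> ztop = product_top X Y,
     reg = (\<lambda>W. {f. \<forall>z\<in>W. \<exists>U V p q. openin (ztop X) U \<and> openin (ztop Y) V \<and>
                      p \<in> bireg X Y U V \<and> q \<in> bireg X Y U V \<and> z \<in> U \<times> V \<and> q z \<noteq> 0 \<and>
                      (\<forall>w\<in>W \<inter> U \<times> V. q w \<noteq> 0 \<longrightarrow> f w = p w / q w)}) \<rparr>"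


section \<open>Affine and projective space\<close>

text \<open>A vector of \<open>\<complex>\<^sup>N\<close> is a sequence supported on the indices below \<open>N\<close>.\<close>

definition cvec :: "nat \<Rightarrow> (nat \<Rightarrow> complex) set" where
  "cvec N = {v. \<forall>i\<ge>N. v i = 0}"

inductive_set poly_fun :: "nat \<Rightarrow> ((nat \<Rightarrow> complex) \<Rightarrow> complex) set" for N :: nat where
  const: "(\<lambda>_. c) \<in> poly_fun N"
| coord: "i < N \<Longrightarrow> (\<lambda>v. v i) \<in> poly_fun N"
| add: "p \<in> poly_fun N \<Longrightarrow> q \<in> poly_fun N \<Longrightarrow> (\<lambda>v. p v + q v) \<in> poly_fun N"
| mult: "p \<in> poly_fun N \<Longrightarrow> q \<in> poly_fun N \<Longrightarrow> (\<lambda>v. p v * q v) \<in> poly_fun N"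

definition affine_space :: "nat \<Rightarrow> (nat \<Rightarrow> complex) fspace" where
  "affine_space N =
    (let T = topology_generated_by {{v \<in> cvec N. p v \<noteq> 0} | p. p \<in> poly_fun N}
     in \<lparr> ztop = T,
          reg = (\<lambda>U. {f. \<forall>x\<in>U. \<exists>V p q. openin T V \<and> x \<in> V \<and> V \<subseteq> U \<and>
                           p \<in> poly_fun N \<and> q \<in> poly_fun N \<and>
                           (\<forall>v\<in>V. q v \<noteq> 0 \<and> f v = p v / q v)}) \<rparr>)"

text \<open>The line spanned by a vector, where vectors are complex-valued functions.\<close>

definition cline :: "('i \<Rightarrow> complex) \<Rightarrow> ('i \<Rightarrow> complex) set" where
  "cline v = {\<lambda>i. c * v i | c. True}"

definition homogeneous :: "nat \<Rightarrow> nat \<Rightarrow> ((nat \<Rightarrow> complex) \<Rightarrow> complex) set" where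
  "homogeneous N d = {p \<in> poly_fun N. \<forall>c v. p (\<lambda>i. c * v i) = c ^ d * p v}"

text \<open>The space of lines in \<open>\<complex>\<^sup>N\<close>; so \<open>N\<close> is the number of homogeneous coordinates and
  \<open>proj_space N\<close> is the projective space of dimension \<open>N - 1\<close> (empty for \<open>N = 0\<close>).\<close>

definition proj_space :: "nat \<Rightarrow> (nat \<Rightarrow> complex) set fspace" where
  "proj_space N =
    (let P = {cline v | v. v \<in> cvec N \<and> v \<noteq> (\<lambda>_. 0)};
         T = topology_generated_by
               {{l \<in> P. \<exists>v\<in>l. p v \<noteq> 0} | p d. p \<in> homogeneous N d}
     in \<lparr> ztop = T,
          reg = (\<lambda>U. {f. \<forall>x\<in>U. \<exists>V p q d. openin T V \<and> x \<in> V \<and> V \<subseteq> U \<and>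
                           p \<in> homogeneous N d \<and> q \<in> homogeneous N d \<and>
                           (\<forall>l\<in>V. \<forall>v\<in>l. v \<noteq> (\<lambda>_. 0) \<longrightarrow> q v \<noteq> 0 \<and> f l = p v / q v)}) \<rparr>)"


section \<open>Varieties and abelian varieties\<close>

definition affine_algebraic :: "'a fspace \<Rightarrow> bool" where
  "affine_algebraic X \<longleftrightarrow>
     (\<exists>N Z \<phi>. closedin (ztop (affine_space N)) Z \<and> isomorphism X (induced (affine_space N) Z) \<phi>)"

definition variety :: "'a fspace \<Rightarrow> bool" where
  "variety X \<longleftrightarrow> function_space X \<and> irreducible_space (ztop X) \<and>
     (\<exists>\<U>. finite \<U> \<and> \<Union>\<U> = points X \<and>
           (\<forall>U\<in>\<U>. openin (ztop X) U \<and> affine_algebraic (induced X U))) \<and>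
     closedin (ztop (product X X)) {(x, x) | x. x \<in> points X}"

text \<open>Properness over \<open>\<complex>\<close>. Letting \<open>Y\<close> range over varieties with points in one type of the
  cardinality of the continuum is no restriction: any variety has an isomorphic copy there.\<close>

definition complete_variety :: "'a fspace \<Rightarrow> bool" where
  "complete_variety X \<longleftrightarrow> variety X \<and>
     (\<forall>Y :: (nat \<Rightarrow> complex) fspace. variety Y \<longrightarrow>
        closed_map (ztop (product X Y)) (ztop Y) snd)"

definition abelian_variety :: "'a fspace \<Rightarrow> 'a monoid \<Rightarrow> bool" where
  "abelian_variety A G \<longleftrightarrow> complete_variety A \<and> group G \<and> carrier G = points A \<and>
     morphism (product A A) A (\<lambda>(x, y). x \<otimes>\<^bsub>G\<^esub> y) \<and> morphism A A (\<lambda>x. inv\<^bsub>G\<^esub> x)"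


section \<open>Tangent spaces\<close>

definition reg_at :: "'a fspace \<Rightarrow> 'a \<Rightarrow> ('a \<Rightarrow> complex) set" where
  "reg_at X x = {f. \<exists>U. openin (ztop X) U \<and> x \<in> U \<and> f \<in> reg X U}"

type_synonym 'a tvec = "('a \<Rightarrow> complex) \<Rightarrow> complex"

text \<open>The Zariski tangent space: \<open>\<complex>\<close>-linear point derivations of the local ring at \<open>x\<close>, whose
  elements are represented by functions regular near \<open>x\<close>; a derivation only depends on the germ,
  and is extended by 0 to all functions.\<close>

definition tangent_space :: "'a fspace \<Rightarrow> 'a \<Rightarrow> 'a tvec set" where
  "tangent_space X x = {D.
     (\<forall>f. f \<notin> reg_at X x \<longrightarrow> D f = 0) \<and>
     (\<forall>f\<in>reg_at X x. \<forall>g\<in>reg_at X x.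
        (\<forall>U. openin (ztop X) U \<and> x \<in> U \<and> (\<forall>y\<in>U. f y = g y) \<longrightarrow> D f = D g) \<and>
        D (\<lambda>y. f y + g y) = D f + D g \<and>
        D (\<lambda>y. f y * g y) = f x * D g + g x * D f) \<and>
     (\<forall>c. \<forall>f\<in>reg_at X x. D (\<lambda>y. c * f y) = c * D f)}"

definition differential :: "'a fspace \<Rightarrow> 'b fspace \<Rightarrow> ('a \<Rightarrow> 'b) \<Rightarrow> 'a \<Rightarrow> 'a tvec \<Rightarrow> 'b tvec" where
  "differential X Y \<phi> x D = (\<lambda>f. if f \<in> reg_at Y (\<phi> x) then D (f \<circ> \<phi>) else 0)"

definition smooth_variety :: "'a fspace \<Rightarrow> bool" where
  "smooth_variety X \<longleftrightarrow> variety X \<and>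
     (\<forall>x\<in>points X.
        enat (vector_space.dim (\<lambda>(c::complex) D f. c * D f) (tangent_space X x)) =
          krull_dim (ztop X))"


section \<open>Symmetric differentials and the projectivised cotangent bundle\<close>

text \<open>Sections of \<open>S\<^sup>m\<Omega>\<^sup>1\<close> over \<open>U\<close> for smooth \<open>X\<close>, where the fibre of \<open>S\<^sup>m\<Omega>\<^sup>1\<close> at \<open>x\<close>
  is the space of homogeneous polynomials of degree \<open>m\<close> on the tangent space at \<open>x\<close>: locally
  \<open>\<Sum>k. g k * df k 0 \<sqdot> \<dots> \<sqdot> df k (m - 1)\<close> with \<open>(df) y D = D f\<close>.\<close>

definition sym_forms :: "'a fspace \<Rightarrow> nat \<Rightarrow> 'a set \<Rightarrow> ('a \<Rightarrow> 'a tvec \<Rightarrow> complex) set" where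
  "sym_forms X m U = {s. \<forall>x\<in>U. \<exists>V K g f. openin (ztop X) V \<and> x \<in> V \<and> V \<subseteq> U \<and>
      (\<forall>k<K::nat. g k \<in> reg X V \<and> (\<forall>j<m. f k j \<in> reg X V)) \<and>
      (\<forall>y\<in>V. \<forall>D\<in>tangent_space X y. s y D = (\<Sum>k<K. g k y * (\<Prod>j<m. D (f k j))))}"

text \<open>A hyperplane in the fibre of \<open>\<Omega>\<^sup>1\<close> at \<open>x\<close> is given by the line of tangent vectors that it
  annihilates. The topology is that of Proj of the symmetric algebra of \<open>\<Omega>\<^sup>1\<close>.\<close>

definition PT_points :: "'a fspace \<Rightarrow> ('a \<times> 'a tvec set) set" where
  "PT_points X = {(x, cline D) | x D. x \<in> points X \<and> D \<in> tangent_space X x \<and> D \<noteq> (\<lambda>_. 0)}"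

definition PT_top :: "'a fspace \<Rightarrow> ('a \<times> 'a tvec set) topology" where
  "PT_top X = topology_generated_by
     {{(x, l) \<in> PT_points X. x \<in> U \<and> (\<exists>D\<in>l. s x D \<noteq> 0)} | U m s.
        openin (ztop X) U \<and> s \<in> sym_forms X m U}"

text \<open>An isomorphism of the cotangent bundle of \<open>A\<close> with the trivial bundle of rank \<open>n\<close>, given
  by a frame of global 1-forms.\<close>

definition cotangent_trivialization ::
    "'a fspace \<Rightarrow> nat \<Rightarrow> (nat \<Rightarrow> 'a \<Rightarrow> 'a tvec \<Rightarrow> complex) \<Rightarrow> bool" where
  "cotangent_trivialization A n \<omega> \<longleftrightarrow>
     (\<forall>i<n. \<omega> i \<in> sym_forms A 1 (points A)) \<and>
     (\<forall>x\<in>points A.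
        bij_betw (\<lambda>D i. if i < n then \<omega> i x D else 0) (tangent_space A x) (cvec n))"

definition PT_trivialization ::
    "nat \<Rightarrow> (nat \<Rightarrow> 'a \<Rightarrow> 'a tvec \<Rightarrow> complex) \<Rightarrow> 'a \<times> 'a tvec set \<Rightarrow> 'a \<times> (nat \<Rightarrow> complex) set" where
  "PT_trivialization n \<omega> = (\<lambda>(x, l). (x, (\<lambda>D i. if i < n then \<omega> i x D else 0) ` l))"

definition PT_inclusion :: "'a fspace \<Rightarrow> 'a set \<Rightarrow> 'a \<times> 'a tvec set \<Rightarrow> 'a \<times> 'a tvec set" where
  "PT_inclusion A X = (\<lambda>(x, l). (x, differential (induced A X) A id x ` l))"

definition tangent_map :: "'a fspace \<Rightarrow> 'a set \<Rightarrow> nat \<Rightarrow> (nat \<Rightarrow> 'a \<Rightarrow> 'a tvec \<Rightarrow> complex) \<Rightarrow>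
    'a \<times> 'a tvec set \<Rightarrow> (nat \<Rightarrow> complex) set" where
  "tangent_map A X n \<omega> = snd \<circ> (PT_trivialization n \<omega> \<circ> PT_inclusion A X)"


section \<open>Line bundles\<close>

text \<open>A line bundle is given by transition functions on a finite open cover; a section is a family
  of functions with \<open>t i = transition i j * t j\<close> on overlaps.\<close>

record 'a line_bundle =
  charts :: nat
  chart_dom :: "nat \<Rightarrow> 'a set"
  transition :: "nat \<Rightarrow> nat \<Rightarrow> 'a \<Rightarrow> complex"

definition is_line_bundle :: "'a fspace \<Rightarrow> 'a line_bundle \<Rightarrow> bool" where
  "is_line_bundle X L \<longleftrightarrow>
     (\<forall>i<charts L. openin (ztop X) (chart_dom L i)) \<and>
     (\<Union>i<charts L. chart_dom L i) = points X \<and>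
     (\<forall>i<charts L. \<forall>j<charts L. transition L i j \<in> reg X (chart_dom L i \<inter> chart_dom L j)) \<and>
     (\<forall>i<charts L. \<forall>x\<in>chart_dom L i. transition L i i x = 1) \<and>
     (\<forall>i<charts L. \<forall>j<charts L. \<forall>k<charts L. \<forall>x\<in>chart_dom L i \<inter> chart_dom L j \<inter> chart_dom L k.
        transition L i j x * transition L j k x = transition L i k x)"

definition lb_dual :: "'a line_bundle \<Rightarrow> 'a line_bundle" where
  "lb_dual L = L\<lparr>transition := \<lambda>i j x. inverse (transition L i j x)\<rparr>"

definition lb_power :: "'a line_bundle \<Rightarrow> nat \<Rightarrow> 'a line_bundle" where
  "lb_power L k = L\<lparr>transition := \<lambda>i j x. transition L i j x ^ k\<rparr>"

definition lb_sections :: "'a fspace \<Rightarrow> 'a line_bundle \<Rightarrow> (nat \<Rightarrow> 'a \<Rightarrow> complex) set" where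
  "lb_sections X L = {t.
     (\<forall>i<charts L. t i \<in> reg X (chart_dom L i)) \<and>
     (\<forall>i<charts L. \<forall>j<charts L. \<forall>x\<in>chart_dom L i \<inter> chart_dom L j. t i x = transition L i j x * t j x)}"

text \<open>For complete \<open>X\<close>: finitely many global sections, as homogeneous coordinates, define a closed
  embedding into a projective space.\<close>

definition very_ample :: "'a fspace \<Rightarrow> 'a line_bundle \<Rightarrow> bool" where
  "very_ample X L \<longleftrightarrow> (\<exists>N t \<phi>.
     (\<forall>a<N. t a \<in> lb_sections X L) \<and>
     (\<forall>i<charts L. \<forall>x\<in>chart_dom L i. \<phi> x = cline (\<lambda>a. if a < N then t a i x else 0)) \<and>
     closedin (ztop (proj_space N)) (\<phi> ` points X) \<and>
     isomorphism X (induced (proj_space N) (\<phi> ` points X)) \<phi>)"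

definition ample :: "'a fspace \<Rightarrow> 'a line_bundle \<Rightarrow> bool" where
  "ample X L \<longleftrightarrow> (\<exists>k>0. very_ample X (lb_power L k))"

definition negative :: "'a fspace \<Rightarrow> 'a line_bundle \<Rightarrow> bool" where
  "negative X L \<longleftrightarrow> ample X (lb_dual L)"

text \<open>Global sections of \<open>S\<^sup>m\<Omega>\<^sup>1 \<otimes> L\<close>, set to 0 where they carry no information, so that each
  section has exactly one representative.\<close>

definition H0_sym_forms :: "'a fspace \<Rightarrow> nat \<Rightarrow> 'a line_bundle \<Rightarrow>
    (nat \<Rightarrow> 'a \<Rightarrow> 'a tvec \<Rightarrow> complex) set" where
  "H0_sym_forms X m L = {\<sigma>.
     (\<forall>i<charts L. \<sigma> i \<in> sym_forms X m (chart_dom L i)) \<and>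
     (\<forall>i<charts L. \<forall>j<charts L. \<forall>x\<in>chart_dom L i \<inter> chart_dom L j. \<forall>D\<in>tangent_space X x.
        \<sigma> i x D = transition L i j x * \<sigma> j x D) \<and>
     (\<forall>i x D. \<not> (i < charts L \<and> x \<in> chart_dom L i \<and> D \<in> tangent_space X x) \<longrightarrow> \<sigma> i x D = 0)}"

end

theory Submission
  imports Defs "HOL-Computational_Algebra.Polynomial"
begin

text \<open>Trivialise the tangent bundle of \<open>A\<close>, so that \<open>w\<close> sends a tangent vector \<open>D\<close> of \<open>X\<close> to \<open>\<complex>\<^sup>n\<close>. Let \<open>\<sigma>\<close> be a
  non-zero section of \<open>S\<^sup>m\<Omega>\<^sup>1 \<otimes> L\<close> and let the sections \<open>t\<^sub>a\<close> of \<open>L\<^sup>-\<^sup>k\<close> embed \<open>X\<close> into a projective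
  space. The products \<open>g = \<sigma>\<^sup>k t\<^sub>a \<omega>\<^sub>i\<close> are functions on the tangent bundle of \<open>X\<close>. As \<open>X\<close> is
  complete, \<open>w\<close> is a proper map to an affine space, hence \<open>g\<close> is integral over \<open>\<complex>[w\<^sub>1, \<dots>, w\<^sub>n]\<close>, with
  homogeneous coefficients. The tangent bundle is irreducible, so the last coefficient can be taken
  not to vanish identically; where it does not vanish, neither does \<open>g\<close>, so that \<open>\<sigma>\<close> does not
  vanish at any point of the fibre of the tangent map. On such a fibre each \<open>g\<close> takes finitely many values,
  and they determine the projective coordinates \<open>t\<^sub>a\<close> of the point: the fibre is finite, for a non-empty
  open set of values of the tangent map. So the general fibre is not positive dimensional.\<close>

section \<open>Polynomial functions\<close>

text \<open>The tangent bundle, rather than its projectivisation, is the working space because there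
  all products become honest functions: raising \<open>\<sigma>\<close> to the power
  \<open>k\<close> makes its transition functions cancel those of \<open>t a\<close>. The extra
  factor given by an invariant form has two purposes. It makes the degree
  \<open>e = m * k + 1\<close> positive even for \<open>m = 0\<close>, so that the later
  coefficients of the equation vanish at the origin and their non-vanishing loci consist of lines;
  and on the vectors with fixed image \<open>v\<close> it is the constant \<open>v i\<close>, which
  can be divided out of the projective coordinates. Completeness is available only as closedness of
  projections, so the equation has to be extracted from a closed set that misses a point; passing to
  the part invariant under scaling of tangent vectors then makes its coefficients homogeneous.
  Smoothness is used as constancy of the dimension of the tangent spaces: it turns forms that are
  independent at one point into a local trivialisation, and so transfers irreducibility from the
  base to the bundle.\<close>

lemma poly_fun_uminus: "p \<in> poly_fun N \<Longrightarrow> (\<lambda>v. - p v) \<in> poly_fun N"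
  using poly_fun.mult[OF poly_fun.const[of "-1" N], of p] by simp

lemma poly_fun_diff: "p \<in> poly_fun N \<Longrightarrow> q \<in> poly_fun N \<Longrightarrow> (\<lambda>v. p v - q v) \<in> poly_fun N"
  using poly_fun.add[OF _ poly_fun_uminus, of p N q] by simp

text \<open>No membership in \<open>cvec N\<close> is asked for: a polynomial in the first
  \<open>n\<close> coordinates may be evaluated at vectors that carry a further coordinate, as
  happens with the extra variable \<open>u n\<close> below.\<close>

lemma poly_fun_local: "p \<in> poly_fun N \<Longrightarrow> (\<And>i. i < N \<Longrightarrow> u i = v i) \<Longrightarrow> p u = p v"
  by (induction rule: poly_fun.induct) auto

lemma poly_fun_line:
  assumes "p \<in> poly_fun N"
  obtains P where "\<And>s. poly P s = p (\<lambda>i. a i + s * b i)"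
proof -
  from assms have "\<exists>P. \<forall>s. poly P s = p (\<lambda>i. a i + s * b i)"
  proof (induction rule: poly_fun.induct)
    case (const c)
    show ?case by (rule exI[of _ "[:c:]"]) simp
  next
    case (coord i)
    show ?case by (rule exI[of _ "[:a i, b i:]"]) simp
  next
    case (add p q)
    then obtain P Q where "\<forall>s. poly P s = p (\<lambda>i. a i + s * b i)" "\<forall>s. poly Q s = q (\<lambda>i. a i + s * b i)"
      by blast
    then show ?case by (intro exI[of _ "P + Q"]) simp
  next
    case (mult p q)
    then obtain P Q where "\<forall>s. poly P s = p (\<lambda>i. a i + s * b i)" "\<forall>s. poly Q s = q (\<lambda>i. a i + s * b i)"
      by blast
    then show ?case by (intro exI[of _ "P * Q"]) simp
  qed
  then show thesis using that by blast
qed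

text \<open>On the line through \<open>a\<close> and \<open>b\<close> both functions are polynomials
  in one variable, non-zero at 0 and at 1 respectively, and a product of non-zero polynomials over
  an infinite field has a non-zero value. This is the source of irreducibility both for affine space
  and for the fibres of the tangent bundle.\<close>

lemma poly_fun_common_nonzero_on_line:
  assumes "p \<in> poly_fun N" "q \<in> poly_fun M" "p a \<noteq> 0" "q b \<noteq> 0"
  obtains s :: complex where "p (\<lambda>i. a i + s * (b i - a i)) \<noteq> 0" "q (\<lambda>i. a i + s * (b i - a i)) \<noteq> 0"
proof -
  obtain P where P: "\<And>s. poly P s = p (\<lambda>i. a i + s * (b i - a i))"
    using poly_fun_line[OF assms(1), of a "\<lambda>i. b i - a i"] by blast
  obtain Q where Q: "\<And>s. poly Q s = q (\<lambda>i. a i + s * (b i - a i))"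
    using poly_fun_line[OF assms(2), of a "\<lambda>i. b i - a i"] by blast
  have "poly P 0 \<noteq> 0" "poly Q 1 \<noteq> 0" using P[of 0] Q[of 1] assms by auto
  then have "P * Q \<noteq> 0" by auto
  then have "\<exists>s. poly (P * Q) s \<noteq> 0" using poly_all_0_iff_0 by blast
  then show thesis using that P Q by (metis poly_mult mult_zero_left mult_zero_right)
qed

section \<open>Homogeneous polynomials and expansions in an extra variable\<close>

lemma homogeneousD: "p \<in> homogeneous N d \<Longrightarrow> p (\<lambda>i. c * v i) = c ^ d * p v"
  by (simp add: homogeneous_def)

lemma homogeneous_poly_fun: "p \<in> homogeneous N d \<Longrightarrow> p \<in> poly_fun N"
  by (simp add: homogeneous_def)

lemma homogeneous_at_zero:
  assumes "p \<in> homogeneous N d" "d > 0"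
  shows "p (\<lambda>_. 0) = 0"
  using homogeneousD[OF assms(1), of 0 "\<lambda>_. 0"] assms(2) by (simp add: power_0_left)

lemma homogeneous_degree_zero:
  assumes "p \<in> homogeneous N 0"
  shows "p v = p (\<lambda>_. 0)"
  using homogeneousD[OF assms, of 0 v] by simp

lemma homogeneous_sum:
  assumes "finite I" "\<And>i. i \<in> I \<Longrightarrow> p i \<in> homogeneous N d"
  shows "(\<lambda>v. \<Sum>i\<in>I. p i v) \<in> homogeneous N d"
  using assms
proof (induction I rule: finite_induct)
  case empty
  then show ?case by (auto simp: homogeneous_def poly_fun.const)
next
  case (insert i I)
  then have "p i \<in> homogeneous N d" "(\<lambda>v. \<Sum>i\<in>I. p i v) \<in> homogeneous N d" by auto
  then have "(\<lambda>v. p i v + (\<Sum>i\<in>I. p i v)) \<in> homogeneous N d"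
    unfolding homogeneous_def by (auto intro: poly_fun.add simp: algebra_simps)
  then show ?case using insert by simp
qed

text \<open>A polynomial in \<open>n + 1\<close> variables is stored as a list of terms that are
  homogeneous separately in the first \<open>n\<close> variables and in \<open>u n\<close>. The
  degree \<open>l\<close> is carried as a label, tied to \<open>H\<close> by the side condition
  \<open>H \<in> homogeneous n l\<close>. Repeated bidegrees are allowed, so that addition is
  concatenation.\<close>

definition bihom_eval :: "nat \<Rightarrow> (nat \<times> nat \<times> ((nat \<Rightarrow> complex) \<Rightarrow> complex)) list \<Rightarrow> (nat \<Rightarrow> complex) \<Rightarrow> complex" where
  "bihom_eval n xs u = (\<Sum>(j, l, H)\<leftarrow>xs. u n ^ j * H u)"

lemma bihom_eval_mult_exists:
  assumes "\<forall>(j, l, H)\<in>set xs. H \<in> homogeneous n l" "\<forall>(j, l, H)\<in>set ys. H \<in> homogeneous n l"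
  shows "\<exists>zs. (\<forall>(j, l, H)\<in>set zs. H \<in> homogeneous n l) \<and>
              (\<forall>u. bihom_eval n zs u = bihom_eval n xs u * bihom_eval n ys u)"
  using assms(1)
proof (induction xs)
  case Nil
  show ?case by (rule exI[of _ "[]"]) (simp add: bihom_eval_def)
next
  case (Cons x xs)
  obtain j l H where x: "x = (j, l, H)" by (cases x)
  have H: "H \<in> homogeneous n l" using Cons.prems x by auto
  obtain zs where zs: "\<forall>(j, l, H)\<in>set zs. H \<in> homogeneous n l"
      "\<And>u. bihom_eval n zs u = bihom_eval n xs u * bihom_eval n ys u"
    using Cons by auto
  define ws where "ws = map (\<lambda>(j', l', H'). (j + j', l + l', \<lambda>u. H u * H' u)) ys"
  have "\<forall>(j, l, H)\<in>set ws. H \<in> homogeneous n l"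
    using assms(2) H unfolding ws_def homogeneous_def
    by (fastforce intro: poly_fun.mult simp: power_add algebra_simps)
  moreover have "bihom_eval n ws u = u n ^ j * H u * bihom_eval n ys u" for u
    unfolding ws_def bihom_eval_def
    by (induction ys) (auto simp: algebra_simps power_add)
  ultimately show ?case using zs x
    by (intro exI[of _ "ws @ zs"]) (auto simp: bihom_eval_def algebra_simps)
qed

lemma poly_fun_bihom:
  assumes "h \<in> poly_fun (Suc n)"
  obtains xs where "\<forall>(j, l, H)\<in>set xs. H \<in> homogeneous n l" "\<And>u. h u = bihom_eval n xs u"
proof -
  from assms have "\<exists>xs. (\<forall>(j, l, H)\<in>set xs. H \<in> homogeneous n l) \<and> (\<forall>u. h u = bihom_eval n xs u)"
  proof (induction rule: poly_fun.induct)
    case (const c)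
    show ?case
      by (rule exI[of _ "[(0, 0, \<lambda>_. c)]"]) (simp add: bihom_eval_def homogeneous_def poly_fun.const)
  next
    case (coord i)
    show ?case
    proof (cases "i = n")
      case True
      then show ?thesis
        by (intro exI[of _ "[(1, 0, \<lambda>_. 1)]"]) (simp add: bihom_eval_def homogeneous_def poly_fun.const)
    next
      case False
      then show ?thesis using coord
        by (intro exI[of _ "[(0, 1, \<lambda>v. v i)]"]) (simp add: bihom_eval_def homogeneous_def poly_fun.coord)
    qed
  next
    case (add p q)
    then obtain xs ys where "\<forall>(j, l, H)\<in>set xs. H \<in> homogeneous n l" "\<forall>u. p u = bihom_eval n xs u"
        "\<forall>(j, l, H)\<in>set ys. H \<in> homogeneous n l" "\<forall>u. q u = bihom_eval n ys u" by blast
    then show ?case by (intro exI[of _ "xs @ ys"]) (auto simp: bihom_eval_def)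
  next
    case (mult p q)
    then obtain xs ys where xs: "\<forall>(j, l, H)\<in>set xs. H \<in> homogeneous n l" "\<forall>u. p u = bihom_eval n xs u"
      and ys: "\<forall>(j, l, H)\<in>set ys. H \<in> homogeneous n l" "\<forall>u. q u = bihom_eval n ys u" by blast
    show ?case using bihom_eval_mult_exists[OF xs(1) ys(1)] xs(2) ys(2) by auto
  qed
  then show thesis using that by blast
qed

text \<open>The coefficients \<open>c j\<close> make up the part of \<open>h\<close> that is invariant under the action
  \<open>s \<cdot> (u, t) = (s u, t / s ^ d)\<close>. The origin is a fixed point, so \<open>h 0 \<noteq> 0\<close> survives in \<open>c 0\<close>.\<close>

lemma invariant_part:
  assumes h: "h \<in> poly_fun (Suc n)" "h (\<lambda>_. 0) \<noteq> 0"
  obtains J c where "\<And>j. c j \<in> homogeneous n (d * j)" "\<And>v. c 0 v \<noteq> 0"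
    "\<And>u t. (\<And>s. s \<noteq> 0 \<Longrightarrow> h (\<lambda>i. if i < n then s * u i else if i = n then t / s ^ d else 0) = 0) \<Longrightarrow>
       (\<Sum>j\<le>J. c j u * t ^ j) = 0"
proof -
  obtain xs where xs: "\<forall>(j, l, H)\<in>set xs. H \<in> homogeneous n l" "\<And>u. h u = bihom_eval n xs u"
    using poly_fun_bihom[OF h(1)] by blast
  define R where "R = length xs"
  define jj where "jj r = fst (xs ! r)" for r
  define ll where "ll r = fst (snd (xs ! r))" for r
  define HH where "HH r = snd (snd (xs ! r))" for r
  have hom: "HH r \<in> homogeneous n (ll r)" if "r < R" for r
    using xs(1) nth_mem[of r xs] that unfolding R_def HH_def ll_def by fastforce
  have hsum: "h u = (\<Sum>r<R. u n ^ jj r * HH r u)" for u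
    unfolding xs(2) bihom_eval_def R_def jj_def HH_def
    by (subst sum_list_sum_nth) (simp add: case_prod_beta atLeast0LessThan)
  \<comment> \<open>Any common bound of the exponents \<open>jj r\<close> would serve as
    \<open>J\<close>.\<close>
  define J where "J = (\<Sum>r<R. jj r)"
  have J: "jj r \<le> J" if "r < R" for r
    unfolding J_def using that by (intro member_le_sum) auto
  \<comment> \<open>Under the action a term with label \<open>(j, l)\<close> is multiplied by
    \<open>s\<close> to the power \<open>l - d * j\<close>; \<open>I j\<close> singles out the
    invariant ones of degree \<open>j\<close> in \<open>u n\<close>.\<close>
  define I where "I j = {r. r < R \<and> jj r = j \<and> ll r = d * j}" for j
  define c where "c j u = (\<Sum>r\<in>I j. HH r u)" for j u
  have finI: "finite (I j)" for j unfolding I_def by simp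
  have c: "c j \<in> homogeneous n (d * j)" for j
    unfolding c_def using homogeneous_sum[OF finI[of j], of HH n "d * j"] hom
    by (simp add: I_def) (metis (mono_tags, lifting))
  \<comment> \<open>At the origin a term survives only if both its degrees are 0 (with
    \<open>0 ^ 0 = 1\<close>), and this is membership in \<open>I 0\<close>.\<close>
  have "c 0 (\<lambda>_. 0) = h (\<lambda>_. 0)"
  proof -
    have "h (\<lambda>_. 0) = (\<Sum>r<R. if r \<in> I 0 then HH r (\<lambda>_. 0) else 0)"
      unfolding hsum
    proof (rule sum.cong)
      fix r assume r: "r \<in> {..<R}"
      show "(0::complex) ^ jj r * HH r (\<lambda>_. 0) = (if r \<in> I 0 then HH r (\<lambda>_. 0) else 0)"
        using r homogeneous_at_zero[OF hom, of r] by (auto simp: I_def)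
    qed simp
    also have "\<dots> = c 0 (\<lambda>_. 0)"
      unfolding c_def by (subst sum.inter_restrict[symmetric]) (auto simp: I_def intro: sum.cong)
    finally show ?thesis by simp
  qed
  then have c0: "c 0 v \<noteq> 0" for v
    using homogeneous_degree_zero[of "c 0" n v] c[of 0] h(2) by simp
  have main: "(\<Sum>j\<le>J. c j u * t ^ j) = 0"
    if z: "\<And>s. s \<noteq> 0 \<Longrightarrow> h (\<lambda>i. if i < n then s * u i else if i = n then t / s ^ d else 0) = 0" for u t
  proof -
    \<comment> \<open>\<open>P\<close> is \<open>h\<close> along the orbit of \<open>(u, t)\<close>,
      multiplied by \<open>s ^ (d * J)\<close> to clear denominators, as a polynomial in
      \<open>s\<close>. It vanishes at all non-zero \<open>s\<close>, so it is zero, and its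
      coefficient at \<open>d * J\<close> is the invariant part. The subtraction
      \<open>J - jj r\<close> is exact because \<open>jj r \<le> J\<close>.\<close>
    define P where "P = (\<Sum>r<R. monom (t ^ jj r * HH r u) (ll r + d * (J - jj r)))"
    have "poly P s = 0" if s: "s \<noteq> 0" for s
    proof -
      let ?v = "\<lambda>i. if i < n then s * u i else if i = n then t / s ^ d else 0"
      have "poly P s = (\<Sum>r<R. s ^ (d * J) * (?v n ^ jj r * HH r ?v))"
        unfolding P_def poly_sum
      proof (rule sum.cong)
        fix r assume r: "r \<in> {..<R}"
        have "HH r ?v = HH r (\<lambda>i. s * u i)"
          using poly_fun_local[OF homogeneous_poly_fun[OF hom], of r ?v "\<lambda>i. s * u i"] r by auto
        also have "\<dots> = s ^ ll r * HH r u" using homogeneousD[OF hom] r by simp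
        finally have H: "HH r ?v = s ^ ll r * HH r u" .
        have "s ^ (d * J) = s ^ (d * (J - jj r)) * (s ^ d) ^ jj r"
          using J[of r] r by (simp add: power_mult[symmetric] power_add[symmetric] add_mult_distrib2[symmetric])
        then show "poly (monom (t ^ jj r * HH r u) (ll r + d * (J - jj r))) s
            = s ^ (d * J) * (?v n ^ jj r * HH r ?v)"
          unfolding H poly_monom using s by (simp add: field_simps power_add power_divide)
      qed simp
      also have "\<dots> = s ^ (d * J) * h ?v" by (simp add: hsum sum_distrib_left)
      finally show ?thesis using z[OF s] by simp
    qed
    then have "UNIV - {0} \<subseteq> {s. poly P s = 0}" by auto
    moreover have "infinite (UNIV - {0::complex})" using infinite_UNIV_char_0 by simp
    ultimately have "P = 0" using poly_roots_finite[of P] infinite_super by blast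
    then have "0 = coeff P (d * J)" by simp
    also have "\<dots> = (\<Sum>r<R. if ll r = d * jj r then t ^ jj r * HH r u else 0)"
      unfolding P_def coeff_sum coeff_monom
    proof (rule sum.cong)
      fix r assume "r \<in> {..<R}"
      then have "d * J = d * (J - jj r) + d * jj r" using J[of r] by (simp add: add_mult_distrib2[symmetric])
      then have "ll r + d * (J - jj r) = d * J \<longleftrightarrow> ll r = d * jj r" by linarith
      then show "(if ll r + d * (J - jj r) = d * J then t ^ jj r * HH r u else 0) =
          (if ll r = d * jj r then t ^ jj r * HH r u else 0)" by simp
    qed simp
    also have "\<dots> = (\<Sum>j\<le>J. \<Sum>r\<in>{r \<in> {..<R}. jj r = j}. if ll r = d * jj r then t ^ jj r * HH r u else 0)"
      by (rule sum.group[symmetric]) (use J in auto)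
    also have "\<dots> = (\<Sum>j\<le>J. c j u * t ^ j)"
    proof (rule sum.cong)
      fix j
      show "(\<Sum>r\<in>{r \<in> {..<R}. jj r = j}. if ll r = d * jj r then t ^ jj r * HH r u else 0) = c j u * t ^ j"
        unfolding c_def sum_distrib_right
        by (subst sum.inter_filter[symmetric]) (auto simp: I_def intro!: sum.cong)
    qed simp
    finally show ?thesis by simp
  qed
  show thesis using that[of c J] c c0 main by blast
qed

section \<open>Affine space\<close>

lemma ztop_affine_space:
  "ztop (affine_space N) = topology_generated_by {{v \<in> cvec N. p v \<noteq> 0} | p. p \<in> poly_fun N}"
  by (simp add: affine_space_def Let_def)

lemma reg_affine_space:
  "f \<in> reg (affine_space N) U \<longleftrightarrow>
    (\<forall>x\<in>U. \<exists>V p q. openin (ztop (affine_space N)) V \<and> x \<in> V \<and> V \<subseteq> U \<and>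
       p \<in> poly_fun N \<and> q \<in> poly_fun N \<and> (\<forall>v\<in>V. q v \<noteq> 0 \<and> f v = p v / q v))"
  by (simp add: affine_space_def Let_def)

lemma reg_affineE:
  assumes "f \<in> reg (affine_space N) U" "x \<in> U"
  obtains V p q where "openin (ztop (affine_space N)) V" "x \<in> V" "V \<subseteq> U"
    "p \<in> poly_fun N" "q \<in> poly_fun N" "\<forall>v\<in>V. q v \<noteq> 0 \<and> f v = p v / q v"
proof -
  have "\<forall>x\<in>U. \<exists>V p q. openin (ztop (affine_space N)) V \<and> x \<in> V \<and> V \<subseteq> U \<and>
       p \<in> poly_fun N \<and> q \<in> poly_fun N \<and> (\<forall>v\<in>V. q v \<noteq> 0 \<and> f v = p v / q v)"
    using assms(1) by (simp only: reg_affine_space)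
  from bspec[OF this assms(2)] show thesis using that by auto
qed

lemma points_affine_space [simp]: "points (affine_space N) = cvec N"
proof -
  have "cvec N \<in> {{v \<in> cvec N. p v \<noteq> 0} | p. p \<in> poly_fun N}"
    using poly_fun.const[of 1 N] by (intro CollectI exI[of _ "\<lambda>_. 1"]) auto
  then show ?thesis unfolding ztop_affine_space topology_generated_by_topspace by auto
qed

lemma openin_affine_nonzero:
  "p \<in> poly_fun N \<Longrightarrow> openin (ztop (affine_space N)) {v \<in> cvec N. p v \<noteq> 0}"
  unfolding ztop_affine_space by (rule topology_generated_by_Basis) auto

text \<open>The non-vanishing locus of a product is the intersection of the two loci, so the
  generating family of the topology is already a base.\<close>

lemma affine_open_basis:
  assumes "openin (ztop (affine_space N)) U" "x \<in> U"
  obtains p where "p \<in> poly_fun N" "p x \<noteq> 0" "{v \<in> cvec N. p v \<noteq> 0} \<subseteq> U"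
proof -
  have "generate_topology_on {{v \<in> cvec N. p v \<noteq> 0} | p. p \<in> poly_fun N} U"
    using assms(1) unfolding ztop_affine_space openin_topology_generated_by_iff .
  then have "\<forall>x\<in>U. \<exists>p\<in>poly_fun N. p x \<noteq> 0 \<and> {v \<in> cvec N. p v \<noteq> 0} \<subseteq> U"
  proof (induction rule: generate_topology_on.induct)
    case (Int a b)
    show ?case
    proof
      fix x assume "x \<in> a \<inter> b"
      then obtain p q where "p \<in> poly_fun N" "p x \<noteq> 0" "{v \<in> cvec N. p v \<noteq> 0} \<subseteq> a"
        "q \<in> poly_fun N" "q x \<noteq> 0" "{v \<in> cvec N. q v \<noteq> 0} \<subseteq> b" using Int by blast
      then show "\<exists>p\<in>poly_fun N. p x \<noteq> 0 \<and> {v \<in> cvec N. p v \<noteq> 0} \<subseteq> a \<inter> b"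
        by (intro bexI[of _ "\<lambda>v. p v * q v"]) (auto intro: poly_fun.mult)
    qed
  next
    case (UN K)
    show ?case
    proof
      fix x assume "x \<in> \<Union>K"
      then obtain k where k: "k \<in> K" "x \<in> k" by blast
      from bspec[OF UN.IH[OF k(1)] k(2)]
      obtain p where "p \<in> poly_fun N" "p x \<noteq> 0" "{v \<in> cvec N. p v \<noteq> 0} \<subseteq> k" by auto
      then show "\<exists>p\<in>poly_fun N. p x \<noteq> 0 \<and> {v \<in> cvec N. p v \<noteq> 0} \<subseteq> \<Union>K"
        using k(1) by (intro bexI[of _ p] conjI) auto
    qed
  next
    case Empty
    show ?case by simp
  next
    case (Basis s)
    then show ?case by auto
  qed
  then show thesis using assms(2) that by blast
qed

lemma function_space_affine: "function_space (affine_space N)" (is "function_space ?A")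
  unfolding function_space_def
proof (intro allI impI conjI)
  fix U c assume U: "openin (ztop ?A) U"
  show "(\<lambda>_. c) \<in> reg ?A U" unfolding reg_affine_space
    by - (intro ballI, rule exI[of _ U], rule exI[of _ "\<lambda>_. c"], rule exI[of _ "\<lambda>_. 1"], (auto simp: U poly_fun.const))
next
  fix U assume U: "openin (ztop ?A) U"
  show "\<forall>f\<in>reg ?A U. \<forall>g\<in>reg ?A U.
      (\<lambda>x. f x + g x) \<in> reg ?A U \<and> (\<lambda>x. f x * g x) \<in> reg ?A U"
  proof (intro ballI conjI)
    fix f g assume f: "f \<in> reg ?A U" and g: "g \<in> reg ?A U"
    have *: "\<exists>V p q p' q'. openin (ztop ?A) V \<and> x \<in> V \<and> V \<subseteq> U \<and>
       p \<in> poly_fun N \<and> q \<in> poly_fun N \<and> p' \<in> poly_fun N \<and> q' \<in> poly_fun N \<and>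
       (\<forall>v\<in>V. q v \<noteq> 0 \<and> f v = p v / q v \<and> q' v \<noteq> 0 \<and> g v = p' v / q' v)" if "x \<in> U" for x
    proof -
      obtain V p q where 1: "openin (ztop ?A) V" "x \<in> V" "V \<subseteq> U"
         "p \<in> poly_fun N" "q \<in> poly_fun N" "\<forall>v\<in>V. q v \<noteq> 0 \<and> f v = p v / q v"
        using f \<open>x \<in> U\<close> by (rule reg_affineE)
      obtain V' p' q' where 2: "openin (ztop ?A) V'" "x \<in> V'" "V' \<subseteq> U"
         "p' \<in> poly_fun N" "q' \<in> poly_fun N" "\<forall>v\<in>V'. q' v \<noteq> 0 \<and> g v = p' v / q' v"
        using g \<open>x \<in> U\<close> by (rule reg_affineE)
      show ?thesis using 1 2
        by - (rule exI[of _ "V \<inter> V'"], rule exI[of _ p], rule exI[of _ q], rule exI[of _ p'], rule exI[of _ q'], auto)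
    qed
    show "(\<lambda>x. f x + g x) \<in> reg ?A U" unfolding reg_affine_space
    proof
      fix x assume "x \<in> U"
      from *[OF this] obtain V p q p' q' where "openin (ztop ?A) V" "x \<in> V" "V \<subseteq> U"
       "p \<in> poly_fun N" "q \<in> poly_fun N" "p' \<in> poly_fun N" "q' \<in> poly_fun N"
       "\<forall>v\<in>V. q v \<noteq> 0 \<and> f v = p v / q v \<and> q' v \<noteq> 0 \<and> g v = p' v / q' v" by blast
      then show "\<exists>V p q. openin (ztop ?A) V \<and> x \<in> V \<and> V \<subseteq> U \<and>
           p \<in> poly_fun N \<and> q \<in> poly_fun N \<and> (\<forall>v\<in>V. q v \<noteq> 0 \<and> f v + g v = p v / q v)"
        by - (rule exI[of _ V], rule exI[of _ "\<lambda>v. p v * q' v + p' v * q v"], rule exI[of _ "\<lambda>v. q v * q' v"], (intro conjI poly_fun.add poly_fun.mult)?, (auto simp: add_frac_eq))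
    qed
    show "(\<lambda>x. f x * g x) \<in> reg ?A U" unfolding reg_affine_space
    proof
      fix x assume "x \<in> U"
      from *[OF this] obtain V p q p' q' where "openin (ztop ?A) V" "x \<in> V" "V \<subseteq> U"
       "p \<in> poly_fun N" "q \<in> poly_fun N" "p' \<in> poly_fun N" "q' \<in> poly_fun N"
       "\<forall>v\<in>V. q v \<noteq> 0 \<and> f v = p v / q v \<and> q' v \<noteq> 0 \<and> g v = p' v / q' v" by blast
      then show "\<exists>V p q. openin (ztop ?A) V \<and> x \<in> V \<and> V \<subseteq> U \<and>
           p \<in> poly_fun N \<and> q \<in> poly_fun N \<and> (\<forall>v\<in>V. q v \<noteq> 0 \<and> f v * g v = p v / q v)"
        by - (rule exI[of _ V], rule exI[of _ "\<lambda>v. p v * p' v"], rule exI[of _ "\<lambda>v. q v * q' v"], (intro conjI poly_fun.mult)?, auto)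
    qed
  qed
next
  fix U V assume U: "openin (ztop ?A) U" and V: "openin (ztop ?A) V \<and> V \<subseteq> U"
  show "reg ?A U \<subseteq> reg ?A V"
  proof
    fix f assume f: "f \<in> reg ?A U"
    show "f \<in> reg ?A V" unfolding reg_affine_space
    proof
      fix x assume x: "x \<in> V"
      have "x \<in> U" using V x by blast
      with f obtain V' p q where "openin (ztop ?A) V'" "x \<in> V'" "V' \<subseteq> U"
         "p \<in> poly_fun N" "q \<in> poly_fun N" "\<forall>v\<in>V'. q v \<noteq> 0 \<and> f v = p v / q v"
        by (rule reg_affineE)
      then show "\<exists>V' p q. openin (ztop ?A) V' \<and> x \<in> V' \<and> V' \<subseteq> V \<and>
           p \<in> poly_fun N \<and> q \<in> poly_fun N \<and> (\<forall>v\<in>V'. q v \<noteq> 0 \<and> f v = p v / q v)"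
        using V x by - (rule exI[of _ "V' \<inter> V"], rule exI[of _ p], rule exI[of _ q], auto)
    qed
  qed
next
  fix U f assume U: "openin (ztop ?A) U"
    and f: "\<forall>x\<in>U. \<exists>V. openin (ztop ?A) V \<and> x \<in> V \<and> V \<subseteq> U \<and>
      (\<exists>g\<in>reg ?A V. \<forall>y\<in>V. f y = g y)"
  show "f \<in> reg ?A U" unfolding reg_affine_space
  proof
    fix x assume "x \<in> U"
    then obtain V g where V: "openin (ztop ?A) V" "x \<in> V" "V \<subseteq> U"
      "g \<in> reg ?A V" "\<forall>y\<in>V. f y = g y" using f by blast
    from V(4,2) obtain V' p q where "openin (ztop ?A) V'" "x \<in> V'" "V' \<subseteq> V"
         "p \<in> poly_fun N" "q \<in> poly_fun N" "\<forall>v\<in>V'. q v \<noteq> 0 \<and> g v = p v / q v"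
      by (rule reg_affineE)
    then show "\<exists>V' p q. openin (ztop ?A) V' \<and> x \<in> V' \<and> V' \<subseteq> U \<and>
           p \<in> poly_fun N \<and> q \<in> poly_fun N \<and> (\<forall>v\<in>V'. q v \<noteq> 0 \<and> f v = p v / q v)"
      using V by - (rule exI[of _ V'], rule exI[of _ p], rule exI[of _ q], auto)
  qed
qed

lemma cvec_line: "a \<in> cvec N \<Longrightarrow> b \<in> cvec N \<Longrightarrow> (\<lambda>i. a i + s * (b i - a i)) \<in> cvec N"
  by (auto simp: cvec_def)

lemma zero_in_cvec: "(\<lambda>_. 0) \<in> cvec N"
  by (simp add: cvec_def)

lemma affine_opens_meet:
  assumes "openin (ztop (affine_space N)) U" "openin (ztop (affine_space N)) V" "U \<noteq> {}" "V \<noteq> {}"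
  shows "U \<inter> V \<noteq> {}"
proof -
  obtain a b where ab: "a \<in> U" "b \<in> V" using assms by blast
  obtain p where p: "p \<in> poly_fun N" "p a \<noteq> 0" "{v \<in> cvec N. p v \<noteq> 0} \<subseteq> U"
    using affine_open_basis[OF assms(1) ab(1)] by blast
  obtain q where q: "q \<in> poly_fun N" "q b \<noteq> 0" "{v \<in> cvec N. q v \<noteq> 0} \<subseteq> V"
    using affine_open_basis[OF assms(2) ab(2)] by blast
  have "a \<in> cvec N" "b \<in> cvec N"
    using ab openin_subset[OF assms(1)] openin_subset[OF assms(2)] by auto
  moreover obtain s where "p (\<lambda>i. a i + s * (b i - a i)) \<noteq> 0" "q (\<lambda>i. a i + s * (b i - a i)) \<noteq> 0"
    using poly_fun_common_nonzero_on_line[OF p(1) q(1) p(2) q(2)] by blast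
  ultimately show ?thesis using p(3) q(3) cvec_line by blast
qed

lemma irreducible_space_opens_meet:
  assumes "irreducible_space T" "openin T U" "openin T V" "U \<noteq> {}" "V \<noteq> {}"
  shows "U \<inter> V \<noteq> {}"
proof
  assume "U \<inter> V = {}"
  then have "topspace T \<subseteq> (topspace T - U) \<union> (topspace T - V)" by blast
  moreover have "closedin T (topspace T - U)" "closedin T (topspace T - V)"
    using assms by auto
  ultimately have "topspace T - U = topspace T \<or> topspace T - V = topspace T"
    using assms(1) unfolding irreducible_space_def by blast
  then show False using assms openin_subset by blast
qed

lemma irreducible_affine_space: "irreducible_space (ztop (affine_space N))"
  unfolding irreducible_space_def
proof (intro conjI allI impI)
  show "points (affine_space N) \<noteq> {}" using zero_in_cvec by auto
  fix F G
  assume FG: "closedin (ztop (affine_space N)) F \<and> closedin (ztop (affine_space N)) G \<and>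
    points (affine_space N) \<subseteq> F \<union> G"
  let ?U = "points (affine_space N) - F" and ?V = "points (affine_space N) - G"
  have "openin (ztop (affine_space N)) ?U" "openin (ztop (affine_space N)) ?V" "?U \<inter> ?V = {}"
    using FG openin_diff[OF openin_topspace] by blast+
  then have "?U = {} \<or> ?V = {}" using affine_opens_meet by metis
  then show "F = points (affine_space N) \<or> G = points (affine_space N)"
    using FG closedin_subset by blast
qed

section \<open>Products\<close>

lemma function_space_const: "function_space X \<Longrightarrow> openin (ztop X) U \<Longrightarrow> (\<lambda>_. c) \<in> reg X U"
  by (simp add: function_space_def)

lemma function_space_add:
  "function_space X \<Longrightarrow> openin (ztop X) U \<Longrightarrow> f \<in> reg X U \<Longrightarrow> g \<in> reg X U \<Longrightarrow> (\<lambda>x. f x + g x) \<in> reg X U"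
  by (simp add: function_space_def)

lemma function_space_mult:
  "function_space X \<Longrightarrow> openin (ztop X) U \<Longrightarrow> f \<in> reg X U \<Longrightarrow> g \<in> reg X U \<Longrightarrow> (\<lambda>x. f x * g x) \<in> reg X U"
  by (simp add: function_space_def)

lemma function_space_restrict:
  "function_space X \<Longrightarrow> openin (ztop X) U \<Longrightarrow> openin (ztop X) V \<Longrightarrow> V \<subseteq> U \<Longrightarrow> f \<in> reg X U \<Longrightarrow> f \<in> reg X V"
  unfolding function_space_def by blast

lemma function_space_glue:
  assumes "function_space X" "openin (ztop X) U"
    "\<And>x. x \<in> U \<Longrightarrow> \<exists>V g. openin (ztop X) V \<and> x \<in> V \<and> V \<subseteq> U \<and> g \<in> reg X V \<and> (\<forall>y\<in>V. f y = g y)"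
  shows "f \<in> reg X U"
proof -
  have "\<forall>x\<in>U. \<exists>V. openin (ztop X) V \<and> x \<in> V \<and> V \<subseteq> U \<and> (\<exists>g\<in>reg X V. \<forall>y\<in>V. f y = g y)"
    using assms(3) by metis
  then show ?thesis using assms(1,2) unfolding function_space_def by blast
qed

text \<open>\<open>bireg\<close> insists on summation over \<open>{..<K}\<close>; freeing the index
  set lets sums be indexed by a disjoint union and products by a Cartesian product.\<close>

lemma bireg_finite_sum:
  assumes "finite I" "\<And>i. i \<in> I \<Longrightarrow> f i \<in> reg X U \<and> g i \<in> reg Y V"
  shows "(\<lambda>(x, y). \<Sum>i\<in>I. f i x * g i y) \<in> bireg X Y U V"
proof -
  obtain h where h: "bij_betw h {0..<card I} I" using ex_bij_betw_nat_finite[OF assms(1)] by blast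
  have "(\<lambda>(x, y). \<Sum>i\<in>I. f i x * g i y) = (\<lambda>(x, y). \<Sum>k<card I. f (h k) x * g (h k) y)"
    using sum.reindex_bij_betw[OF h, symmetric] by (auto simp: fun_eq_iff atLeast0LessThan)
  moreover have "\<forall>k<card I. f (h k) \<in> reg X U \<and> g (h k) \<in> reg Y V"
    using assms(2) bij_betwE[OF h] by auto
  ultimately show ?thesis unfolding bireg_def mem_Collect_eq
    by - (rule exI[of _ "card I"], rule exI[of _ "\<lambda>k. f (h k)"], rule exI[of _ "\<lambda>k. g (h k)"], auto)
qed

lemma bireg_tensor:
  assumes "f \<in> reg X U" "g \<in> reg Y V"
  shows "(\<lambda>(x, y). f x * g y) \<in> bireg X Y U V"
  using bireg_finite_sum[of "{0::nat}" "\<lambda>_. f" X U "\<lambda>_. g" Y V] assms by simp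

lemma bireg_add:
  assumes "p \<in> bireg X Y U V" "q \<in> bireg X Y U V"
  shows "(\<lambda>z. p z + q z) \<in> bireg X Y U V"
proof -
  obtain K f g where p: "\<forall>k<K::nat. f k \<in> reg X U \<and> g k \<in> reg Y V" "p = (\<lambda>(x, y). \<Sum>k<K. f k x * g k y)"
    using assms(1) unfolding bireg_def by blast
  obtain K' f' g' where q: "\<forall>k<K'::nat. f' k \<in> reg X U \<and> g' k \<in> reg Y V"
      "q = (\<lambda>(x, y). \<Sum>k<K'. f' k x * g' k y)"
    using assms(2) unfolding bireg_def by blast
  have "(\<lambda>(x, y). \<Sum>i\<in>{..<K} <+> {..<K'}. case_sum f f' i x * case_sum g g' i y) \<in> bireg X Y U V"
    by (rule bireg_finite_sum) (use p q in auto)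
  moreover have "(\<lambda>(x, y). \<Sum>i\<in>{..<K} <+> {..<K'}. case_sum f f' i x * case_sum g g' i y) =
      (\<lambda>z. p z + q z)"
    by (auto simp: fun_eq_iff p q sum.Plus)
  ultimately show ?thesis by simp
qed

lemma bireg_mult:
  assumes "function_space X" "function_space Y" "openin (ztop X) U" "openin (ztop Y) V"
    and "p \<in> bireg X Y U V" "q \<in> bireg X Y U V"
  shows "(\<lambda>z. p z * q z) \<in> bireg X Y U V"
proof -
  obtain K f g where p: "\<forall>k<K::nat. f k \<in> reg X U \<and> g k \<in> reg Y V" "p = (\<lambda>(x, y). \<Sum>k<K. f k x * g k y)"
    using assms(5) unfolding bireg_def by blast
  obtain K' f' g' where q: "\<forall>k<K'::nat. f' k \<in> reg X U \<and> g' k \<in> reg Y V"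
      "q = (\<lambda>(x, y). \<Sum>k<K'. f' k x * g' k y)"
    using assms(6) unfolding bireg_def by blast
  have "(\<lambda>(x, y). \<Sum>i\<in>{..<K} \<times> {..<K'}. (\<lambda>x. f (fst i) x * f' (snd i) x) x *
       (\<lambda>y. g (fst i) y * g' (snd i) y) y) \<in> bireg X Y U V"
    by (rule bireg_finite_sum) (use p q assms in \<open>auto intro!: function_space_mult\<close>)
  moreover have "(\<lambda>(x, y). \<Sum>i\<in>{..<K} \<times> {..<K'}. (\<lambda>x. f (fst i) x * f' (snd i) x) x *
       (\<lambda>y. g (fst i) y * g' (snd i) y) y) = (\<lambda>z. p z * q z)"
  proof
    fix z :: "'a \<times> 'b"
    obtain x y where z: "z = (x, y)" by (cases z)
    have "p z * q z = (\<Sum>(i, j)\<in>{..<K} \<times> {..<K'}. (f i x * g i y) * (f' j x * g' j y))"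
      unfolding p q z prod.case by (simp only: sum_product sum.cartesian_product)
    then show "(\<lambda>(x, y). \<Sum>i\<in>{..<K} \<times> {..<K'}. (\<lambda>x. f (fst i) x * f' (snd i) x) x *
       (\<lambda>y. g (fst i) y * g' (snd i) y) y) z = p z * q z"
      by (auto simp: z case_prod_beta intro!: sum.cong)
  qed
  ultimately show ?thesis by simp
qed

lemma ztop_product: "ztop (product X Y) = product_top X Y"
  by (simp add: product_def)

lemma openin_product_nonzero:
  assumes "openin (ztop X) U" "openin (ztop Y) V" "h \<in> bireg X Y U V"
  shows "openin (ztop (product X Y)) {z \<in> U \<times> V. h z \<noteq> 0}"
  unfolding ztop_product product_top_def by (rule topology_generated_by_Basis) (use assms in blast)

lemma openin_product_Times:
  assumes "function_space X" "function_space Y" "openin (ztop X) U" "openin (ztop Y) V"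
  shows "openin (ztop (product X Y)) (U \<times> V)"
proof -
  have "(\<lambda>(x, y). 1 * 1) \<in> bireg X Y U V"
    using bireg_tensor[of "\<lambda>_. 1" X U "\<lambda>_. 1" Y V] assms by (simp add: function_space_const)
  from openin_product_nonzero[OF assms(3,4) this] show ?thesis by (simp add: case_prod_beta)
qed

lemma points_product:
  assumes "function_space X" "function_space Y"
  shows "points (product X Y) = points X \<times> points Y"
proof
  show "points (product X Y) \<subseteq> points X \<times> points Y"
    unfolding ztop_product product_top_def topology_generated_by_topspace
    by (auto dest!: openin_subset)
  show "points X \<times> points Y \<subseteq> points (product X Y)"
    by (rule openin_subset, rule openin_product_Times[OF assms]) auto
qed

lemma isomorphism_refl: "isomorphism X X id"
proof -
  have "{x \<in> points X. x \<in> V} = V" if "openin (ztop X) V" for V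
    using openin_subset[OF that] by auto
  then have "morphism X X id" unfolding morphism_def by auto
  then show ?thesis unfolding isomorphism_def by (intro conjI exI[of _ id]) auto
qed

lemma poly_fun_reg_affine:
  "p \<in> poly_fun N \<Longrightarrow> openin (ztop (affine_space N)) U \<Longrightarrow> p \<in> reg (affine_space N) U"
  unfolding reg_affine_space
  by - (intro ballI, rule exI[of _ U], rule exI[of _ p], rule exI[of _ "\<lambda>_. 1"], (auto simp: poly_fun.const))

text \<open>Affine space is the test variety to which the definition of completeness will be
  applied.\<close>

lemma variety_affine_space: "variety (affine_space N)"
  unfolding variety_def
proof (intro conjI)
  show "\<exists>\<U>. finite \<U> \<and> \<Union> \<U> = points (affine_space N) \<and>
     (\<forall>U\<in>\<U>. openin (ztop (affine_space N)) U \<and> affine_algebraic (induced (affine_space N) U))"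
  proof (intro exI[of _ "{points (affine_space N)}"] conjI)
    have "affine_algebraic (induced (affine_space N) (points (affine_space N)))"
      unfolding affine_algebraic_def
      by - (rule exI[of _ N], rule exI[of _ "points (affine_space N)"], rule exI[of _ id], (intro conjI isomorphism_refl)?, (rule closedin_topspace))
    then show "\<forall>U\<in>{points (affine_space N)}. openin (ztop (affine_space N)) U \<and>
        affine_algebraic (induced (affine_space N) U)"
      using openin_topspace by blast
  qed auto
  let ?A = "affine_space N"
  let ?D = "{(x, x) | x. x \<in> points ?A}"
  have "openin (ztop (product ?A ?A)) (points (product ?A ?A) - ?D)"
  proof (subst openin_subopen, intro ballI)
    fix z assume z: "z \<in> points (product ?A ?A) - ?D"
    obtain u v where uv: "z = (u, v)" "u \<in> cvec N" "v \<in> cvec N" "u \<noteq> v"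
      using z by (cases z) (auto simp: points_product function_space_affine)
    then obtain i where i: "u i \<noteq> v i" by (auto simp: fun_eq_iff)
    with uv(2,3) have "i < N" by (auto simp: cvec_def intro: ccontr)
    note i = i this
    have op: "openin (ztop ?A) (cvec N)" using openin_topspace[of "ztop ?A"] unfolding points_affine_space .
    have regs: "(\<lambda>x. x i) \<in> reg ?A (cvec N)" "(\<lambda>_. c) \<in> reg ?A (cvec N)" for c
      by (rule poly_fun_reg_affine[OF poly_fun.coord[OF i(2)] op]) (rule poly_fun_reg_affine[OF poly_fun.const op])
    \<comment> \<open>The equation of the diagonal in a coordinate where the two points differ,
      split into two tensors.\<close>
    define h :: "(nat \<Rightarrow> complex) \<times> (nat \<Rightarrow> complex) \<Rightarrow> complex"
      where "h = (\<lambda>z. (case z of (x, y) \<Rightarrow> x i * 1) + (case z of (x, y) \<Rightarrow> - 1 * y i))"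
    have "h \<in> bireg ?A ?A (cvec N) (cvec N)"
      unfolding h_def by (intro bireg_add bireg_tensor regs)
    from openin_product_nonzero[OF op op this]
    have "openin (ztop (product ?A ?A)) {z \<in> cvec N \<times> cvec N. h z \<noteq> 0}" .
    moreover have "z \<in> {z \<in> cvec N \<times> cvec N. h z \<noteq> 0}" using uv i by (simp add: h_def)
    moreover have "{z \<in> cvec N \<times> cvec N. h z \<noteq> 0} \<subseteq> points (product ?A ?A) - ?D"
      by (auto simp: points_product function_space_affine h_def)
    ultimately show "\<exists>T. openin (ztop (product ?A ?A)) T \<and> z \<in> T \<and> T \<subseteq> points (product ?A ?A) - ?D"
      by blast
  qed
  moreover have "?D \<subseteq> points (product ?A ?A)" by (auto simp: points_product function_space_affine)
  ultimately show "closedin (ztop (product ?A ?A)) ?D" by (simp add: closedin_def)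
qed (auto intro: function_space_affine irreducible_affine_space)

section \<open>Local structure of varieties\<close>

text \<open>An affine chart seen from \<open>X\<close> alone. Of the isomorphism with a closed
  subset of affine space it retains that the coordinates \<open>z\<close> separate points, that
  polynomials in \<open>z\<close> have open non-vanishing loci, and that regular functions are
  locally the quotients of such polynomials; the equations of the image are forgotten.\<close>

definition rational_chart :: "'a fspace \<Rightarrow> 'a set \<Rightarrow> nat \<Rightarrow> ('a \<Rightarrow> nat \<Rightarrow> complex) \<Rightarrow> bool" where
  "rational_chart X U N z \<longleftrightarrow> openin (ztop X) U \<and> inj_on z U \<and>
     (\<forall>p\<in>poly_fun N. openin (ztop X) {y \<in> U. p (z y) \<noteq> 0}) \<and>
     (\<forall>x\<in>U. z x \<in> cvec N) \<and>
     (\<forall>W. \<forall>p\<in>poly_fun N. \<forall>q\<in>poly_fun N. openin (ztop X) W \<and> W \<subseteq> U \<and> (\<forall>y\<in>W. q (z y) \<noteq> 0) \<longrightarrow>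
        (\<lambda>y. p (z y) / q (z y)) \<in> reg X W) \<and>
     (\<forall>W f x. openin (ztop X) W \<and> W \<subseteq> U \<and> f \<in> reg X W \<and> x \<in> W \<longrightarrow>
        (\<exists>W'. openin (ztop X) W' \<and> x \<in> W' \<and> W' \<subseteq> W \<and>
          (\<exists>p\<in>poly_fun N. \<exists>q\<in>poly_fun N. \<forall>y\<in>W'. q (z y) \<noteq> 0 \<and> f y = p (z y) / q (z y))))"

lemma ztop_induced [simp]: "ztop (induced X S) = subtopology (ztop X) S"
  by (simp add: induced_def)

lemma reg_induced:
  "f \<in> reg (induced X S) U \<longleftrightarrow>
    (\<forall>x\<in>U. \<exists>V. openin (ztop X) V \<and> x \<in> V \<and> (\<exists>g\<in>reg X V. \<forall>y\<in>U \<inter> V. f y = g y))"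
  by (simp add: induced_def)

lemma reg_imp_reg_induced: "f \<in> reg X V \<Longrightarrow> openin (ztop X) V \<Longrightarrow> U \<subseteq> V \<Longrightarrow> f \<in> reg (induced X S) U"
  unfolding reg_induced by blast

lemma reg_induced_open_imp_reg:
  assumes "function_space X" "f \<in> reg (induced X S) U" "openin (ztop X) W" "W \<subseteq> U"
  shows "f \<in> reg X W"
proof (rule function_space_glue[OF assms(1,3)])
  fix x assume x: "x \<in> W"
  then have "x \<in> U" using assms(4) by blast
  from bspec[OF assms(2)[unfolded reg_induced] this]
  obtain V g where V: "openin (ztop X) V" "x \<in> V" "g \<in> reg X V" "\<forall>y\<in>U \<inter> V. f y = g y" by auto
  have "g \<in> reg X (V \<inter> W)"
    by (rule function_space_restrict[OF assms(1) V(1) _ _ V(3)]) (use V assms in auto)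
  then show "\<exists>V g. openin (ztop X) V \<and> x \<in> V \<and> V \<subseteq> W \<and> g \<in> reg X V \<and> (\<forall>y\<in>V. f y = g y)"
    using V assms x by - (rule exI[of _ "V \<inter> W"], rule exI[of _ g], auto)
qed

lemma rational_chart_of_isomorphism:
  assumes X: "function_space X" and U: "openin (ztop X) U"
    and Z: "closedin (ztop (affine_space N)) Z"
    and iso: "isomorphism (induced X U) (induced (affine_space N) Z) \<phi>"
  shows "rational_chart X U N \<phi>"
proof -
  let ?A = "affine_space N" and ?XU = "induced X U"
  let ?B = "induced ?A Z"
  have ptsXU: "points ?XU = U" using openin_subset[OF U] by auto
  have ptsB: "points ?B = Z" using closedin_subset[OF Z] by auto
  obtain \<psi> where \<phi>: "morphism ?XU ?B \<phi>" and \<psi>: "morphism ?B ?XU \<psi>" and inv: "\<And>x. x \<in> U \<Longrightarrow> \<psi> (\<phi> x) = x"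
    using iso unfolding isomorphism_def ptsXU by blast
  have cont: "continuous_map (ztop ?XU) (ztop ?B) \<phi>" using \<phi> by (simp add: morphism_def)
  have \<phi>Z: "\<phi> x \<in> Z" if "x \<in> U" for x
    using continuous_map_image_subset_topspace[OF cont] that unfolding ptsXU ptsB by blast
  have pre: "openin (ztop X) {y \<in> U. \<phi> y \<in> V}" if V: "openin (ztop ?A) V" for V
  proof -
    have "openin (ztop ?B) (V \<inter> Z)" using openin_subtopology_Int[OF V] by simp
    from openin_continuous_map_preimage[OF cont this]
    have "openin (ztop ?XU) {y \<in> U. \<phi> y \<in> V \<inter> Z}" unfolding ptsXU .
    moreover have "{y \<in> U. \<phi> y \<in> V \<inter> Z} = {y \<in> U. \<phi> y \<in> V}" using \<phi>Z by blast
    ultimately show ?thesis using openin_trans_full[of "ztop X" U] U by simp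
  qed
  have \<phi>cvec: "\<phi> x \<in> cvec N" if "x \<in> U" for x
    using \<phi>Z[OF that] closedin_subset[OF Z] by auto
  have c3: "openin (ztop X) {y \<in> U. p (\<phi> y) \<noteq> 0}" if "p \<in> poly_fun N" for p
  proof -
    have "{y \<in> U. p (\<phi> y) \<noteq> 0} = {y \<in> U. \<phi> y \<in> {v \<in> cvec N. p v \<noteq> 0}}" using \<phi>cvec by auto
    then show ?thesis using pre[OF openin_affine_nonzero[OF that]] by simp
  qed
  have c2: "(\<lambda>y. p (\<phi> y) / q (\<phi> y)) \<in> reg X W"
    if "p \<in> poly_fun N" "q \<in> poly_fun N" and W: "openin (ztop X) W" "W \<subseteq> U" and nz: "\<forall>y\<in>W. q (\<phi> y) \<noteq> 0" for p q W
  proof -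
    let ?V = "{v \<in> cvec N. q v \<noteq> 0}"
    have V: "openin (ztop ?A) ?V" using openin_affine_nonzero[OF that(2)] .
    have "(\<lambda>v. p v / q v) \<in> reg ?A ?V" unfolding reg_affine_space
      using that V by - (intro ballI, rule exI[of _ ?V], rule exI[of _ p], rule exI[of _ q], auto)
    then have "(\<lambda>v. p v / q v) \<in> reg ?B (?V \<inter> Z)" by (rule reg_imp_reg_induced[OF _ V]) auto
    moreover have "openin (ztop ?B) (?V \<inter> Z)" using openin_subtopology_Int[OF V] by simp
    ultimately have "(\<lambda>v. p v / q v) \<circ> \<phi> \<in> reg ?XU {x \<in> points ?XU. \<phi> x \<in> ?V \<inter> Z}"
      using \<phi> unfolding morphism_def by blast
    from reg_induced_open_imp_reg[OF X this W(1)]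
    show ?thesis using W nz \<phi>Z \<phi>cvec unfolding ptsXU by (auto simp: comp_def)
  qed
  \<comment> \<open>Transport \<open>f\<close> to the image by the inverse \<open>\<psi>\<close>,
    extend it locally to affine space, where it is a quotient of polynomials, and pull back by
    \<open>\<phi>\<close>.\<close>
  have c5: "\<exists>W'. openin (ztop X) W' \<and> x \<in> W' \<and> W' \<subseteq> W \<and>
          (\<exists>p\<in>poly_fun N. \<exists>q\<in>poly_fun N. \<forall>y\<in>W'. q (\<phi> y) \<noteq> 0 \<and> f y = p (\<phi> y) / q (\<phi> y))"
    if W: "openin (ztop X) W" "W \<subseteq> U" and f: "f \<in> reg X W" and x: "x \<in> W" for W f x
  proof -
    have "f \<in> reg ?XU W" by (rule reg_imp_reg_induced[OF f W(1)]) auto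
    moreover have "openin (ztop ?XU) W" using openin_subtopology_Int[OF W(1), of U] W(2) by (simp add: Int_absorb2)
    ultimately have fB: "f \<circ> \<psi> \<in> reg ?B {y \<in> points ?B. \<psi> y \<in> W}"
      using \<psi> unfolding morphism_def by blast
    have mem: "\<phi> y \<in> {y \<in> points ?B. \<psi> y \<in> W}" if "y \<in> W" for y
      using that W \<phi>Z inv unfolding ptsB by auto
    from bspec[OF fB[unfolded reg_induced] mem[OF x]]
    obtain V g where V: "openin (ztop ?A) V" "\<phi> x \<in> V" and g: "g \<in> reg ?A V"
      and eq: "\<forall>y\<in>{y \<in> points ?B. \<psi> y \<in> W} \<inter> V. (f \<circ> \<psi>) y = g y" by auto
    obtain V1 p q where V1: "openin (ztop ?A) V1" "\<phi> x \<in> V1" "V1 \<subseteq> V" and pq: "p \<in> poly_fun N" "q \<in> poly_fun N"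
      "\<forall>v\<in>V1. q v \<noteq> 0 \<and> g v = p v / q v"
      using g V(2) by (rule reg_affineE)
    let ?W' = "{y \<in> U. \<phi> y \<in> V1} \<inter> W"
    have "openin (ztop X) ?W'" using pre[OF V1(1)] W(1) by (rule openin_Int)
    moreover have "x \<in> ?W'" using x W V1 by auto
    moreover have "\<forall>y\<in>?W'. q (\<phi> y) \<noteq> 0 \<and> f y = p (\<phi> y) / q (\<phi> y)"
    proof
      fix y assume y: "y \<in> ?W'"
      then have "(f \<circ> \<psi>) (\<phi> y) = g (\<phi> y)" using mem[of y] eq V1(3) by blast
      then show "q (\<phi> y) \<noteq> 0 \<and> f y = p (\<phi> y) / q (\<phi> y)" using pq(3) y inv by auto
    qed
    ultimately show ?thesis using pq(1,2) by (intro exI[of _ ?W']) blast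
  qed
  have c4: "inj_on \<phi> U" using inv by (metis inj_onI)
  show ?thesis unfolding rational_chart_def
    by (intro conjI ballI allI impI U c4) (use c2 c3 c5 \<phi>cvec in \<open>auto simp del: not_iff\<close>)
qed

lemma rational_chart_quotient:
  assumes "rational_chart X U N z" "openin (ztop X) W" "W \<subseteq> U" "f \<in> reg X W" "x \<in> W"
  obtains W' p q where "openin (ztop X) W'" "x \<in> W'" "W' \<subseteq> W" "p \<in> poly_fun N" "q \<in> poly_fun N"
    "\<forall>y\<in>W'. q (z y) \<noteq> 0 \<and> f y = p (z y) / q (z y)"
proof -
  have "\<forall>W f x. openin (ztop X) W \<and> W \<subseteq> U \<and> f \<in> reg X W \<and> x \<in> W \<longrightarrow>
        (\<exists>W'. openin (ztop X) W' \<and> x \<in> W' \<and> W' \<subseteq> W \<and>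
          (\<exists>p\<in>poly_fun N. \<exists>q\<in>poly_fun N. \<forall>y\<in>W'. q (z y) \<noteq> 0 \<and> f y = p (z y) / q (z y)))"
    using assms(1) unfolding rational_chart_def by (elim conjE)
  from this[rule_format, of W f x] show thesis using assms that by auto
qed

section \<open>Regular functions on a variety\<close>

locale complex_variety =
  fixes S :: "'a fspace"
  assumes variety: "variety S"
begin

abbreviation "zopen \<equiv> openin (ztop S)"

lemma fs: "function_space S"
  using variety by (simp add: variety_def)

lemma irreducible: "irreducible_space (ztop S)"
  using variety by (simp add: variety_def)

lemma chart_exists:
  assumes "x \<in> points S"
  obtains U N z where "x \<in> U" "rational_chart S U N z"
proof -
  obtain \<U> where \<U>: "\<Union>\<U> = points S" "\<And>U. U \<in> \<U> \<Longrightarrow> zopen U"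
      "\<And>U. U \<in> \<U> \<Longrightarrow> affine_algebraic (induced S U)"
    using variety unfolding variety_def by blast
  then obtain U where U: "U \<in> \<U>" "x \<in> U" using assms by blast
  obtain N Z \<phi> where "closedin (ztop (affine_space N)) Z" "isomorphism (induced S U) (induced (affine_space N) Z) \<phi>"
    using \<U>(3)[OF U(1)] unfolding affine_algebraic_def by blast
  then show thesis using that U(2) rational_chart_of_isomorphism[OF fs \<U>(2)[OF U(1)]] by blast
qed

lemma reg_const: "zopen W \<Longrightarrow> (\<lambda>_. c) \<in> reg S W"
  by (rule function_space_const[OF fs])

lemma reg_add: "zopen W \<Longrightarrow> f \<in> reg S W \<Longrightarrow> g \<in> reg S W \<Longrightarrow> (\<lambda>x. f x + g x) \<in> reg S W"
  by (rule function_space_add[OF fs])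

lemma reg_mult: "zopen W \<Longrightarrow> f \<in> reg S W \<Longrightarrow> g \<in> reg S W \<Longrightarrow> (\<lambda>x. f x * g x) \<in> reg S W"
  by (rule function_space_mult[OF fs])

lemma reg_diff: "zopen W \<Longrightarrow> f \<in> reg S W \<Longrightarrow> g \<in> reg S W \<Longrightarrow> (\<lambda>x. f x - g x) \<in> reg S W"
  using reg_add[of W f "\<lambda>x. - 1 * g x"] reg_mult[of W "\<lambda>_. - 1" g] reg_const[of W "- 1"] by simp

lemma reg_sum:
  "zopen W \<Longrightarrow> (\<And>i. i \<in> I \<Longrightarrow> f i \<in> reg S W) \<Longrightarrow> (\<lambda>x. \<Sum>i\<in>I. f i x) \<in> reg S W"
  by (induction I rule: infinite_finite_induct) (auto intro: reg_add reg_const)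

lemma reg_restrict:
  "f \<in> reg S U \<Longrightarrow> zopen U \<Longrightarrow> zopen V \<Longrightarrow> V \<subseteq> U \<Longrightarrow> f \<in> reg S V"
  by (rule function_space_restrict[OF fs])

lemma reg_cong:
  assumes "f \<in> reg S W" "zopen W" "\<And>x. x \<in> W \<Longrightarrow> f x = g x"
  shows "g \<in> reg S W"
  by (rule function_space_glue[OF fs assms(2)])
     (use assms in \<open>auto intro!: exI[of _ W] exI[of _ f]\<close>)

lemma local_quotient:
  assumes "zopen W" "f \<in> reg S W" "x \<in> W"
  obtains U N z W' p q where "rational_chart S U N z" "zopen W'" "x \<in> W'" "W' \<subseteq> W" "W' \<subseteq> U"
    "p \<in> poly_fun N" "q \<in> poly_fun N" "\<forall>y\<in>W'. q (z y) \<noteq> 0 \<and> f y = p (z y) / q (z y)"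
proof -
  have "x \<in> points S" using assms openin_subset by blast
  then obtain U N z where U: "x \<in> U" "rational_chart S U N z" by (rule chart_exists)
  have oU: "zopen U" using U by (simp add: rational_chart_def)
  have o: "zopen (W \<inter> U)" using oU assms by blast
  have "f \<in> reg S (W \<inter> U)" by (rule reg_restrict[OF assms(2,1) o]) auto
  then obtain W' p q where "zopen W'" "x \<in> W'" "W' \<subseteq> W \<inter> U" "p \<in> poly_fun N" "q \<in> poly_fun N"
      "\<forall>y\<in>W'. q (z y) \<noteq> 0 \<and> f y = p (z y) / q (z y)"
    using rational_chart_quotient[OF U(2) o _ _, of f x] U(1) assms(3) by auto
  then show thesis using that[OF U(2), of W' p q] by auto
qed

text \<open>The axioms of \<open>function_space\<close> speak neither of zeros nor of inverses;
  openness of the non-vanishing locus, and invertibility on it, come from the local form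
  \<open>p / q\<close> in a chart.\<close>

lemma openin_nonzero:
  assumes "zopen W" "f \<in> reg S W"
  shows "zopen {x \<in> W. f x \<noteq> 0}"
proof (subst openin_subopen, intro ballI)
  fix x assume x: "x \<in> {x \<in> W. f x \<noteq> 0}"
  then have "x \<in> W" by simp
  from assms this obtain U N z W' p q where W': "rational_chart S U N z" "zopen W'" "x \<in> W'" "W' \<subseteq> W" "W' \<subseteq> U"
    "p \<in> poly_fun N" "q \<in> poly_fun N" "\<forall>y\<in>W'. q (z y) \<noteq> 0 \<and> f y = p (z y) / q (z y)"
    by (rule local_quotient)
  have "zopen {y \<in> U. p (z y) \<noteq> 0}" using W' by (simp add: rational_chart_def)
  then have "zopen ({y \<in> U. p (z y) \<noteq> 0} \<inter> W')" using W'(2) by (rule openin_Int)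
  then show "\<exists>T. zopen T \<and> x \<in> T \<and> T \<subseteq> {x \<in> W. f x \<noteq> 0}"
    using W' x by (intro exI[of _ "{y \<in> U. p (z y) \<noteq> 0} \<inter> W'"]) auto
qed

lemma reg_inverse:
  assumes "zopen W" "f \<in> reg S W" "\<And>x. x \<in> W \<Longrightarrow> f x \<noteq> 0"
  shows "(\<lambda>x. inverse (f x)) \<in> reg S W"
proof (rule function_space_glue[OF fs assms(1)])
  fix x assume x: "x \<in> W"
  from assms(1,2) this obtain U N z W' p q where W': "rational_chart S U N z" "zopen W'" "x \<in> W'" "W' \<subseteq> W" "W' \<subseteq> U"
    "p \<in> poly_fun N" "q \<in> poly_fun N" "\<forall>y\<in>W'. q (z y) \<noteq> 0 \<and> f y = p (z y) / q (z y)"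
    by (rule local_quotient)
  have nz: "\<forall>y\<in>W'. p (z y) \<noteq> 0" using assms(3) W' by fastforce
  have "(\<lambda>y. q (z y) / p (z y)) \<in> reg S W'"
    using W'(1,2,5,6,7) nz unfolding rational_chart_def by blast
  then show "\<exists>V g. zopen V \<and> x \<in> V \<and> V \<subseteq> W \<and> g \<in> reg S V \<and> (\<forall>y\<in>V. inverse (f y) = g y)"
    using W' by - (rule exI[of _ W'], rule exI[of _ "\<lambda>y. q (z y) / p (z y)"], auto)
qed

text \<open>Points are closed: two points in one chart differ in a coordinate, and if
  \<open>y\<close> lies outside the chart of \<open>x\<close>, the chart itself separates
  them.\<close>

lemma separate_points:
  assumes "x \<in> points S" "y \<in> points S" "x \<noteq> y"
  obtains U where "zopen U" "x \<in> U" "y \<notin> U"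
proof -
  obtain U N z where U: "x \<in> U" "rational_chart S U N z" using assms(1) by (rule chart_exists)
  have oU: "zopen U" and inj: "inj_on z U"
    and c3: "\<And>p. p \<in> poly_fun N \<Longrightarrow> zopen {y \<in> U. p (z y) \<noteq> 0}"
    and cv: "\<And>x. x \<in> U \<Longrightarrow> z x \<in> cvec N"
    using U(2) by (auto simp: rational_chart_def)
  show thesis
  proof (cases "y \<in> U")
    case False
    then show ?thesis using that oU U(1) by blast
  next
    case True
    then have "z x \<noteq> z y" using inj U(1) assms(3) by (auto simp: inj_on_def)
    then obtain i where i: "z x i \<noteq> z y i" by (auto simp: fun_eq_iff)
    have "i < N" using cv[OF True] cv[OF U(1)] i by (auto simp: cvec_def intro: ccontr)
    then have "(\<lambda>v. v i - z y i) \<in> poly_fun N" by (intro poly_fun_diff poly_fun.coord poly_fun.const)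
    from c3[OF this] show ?thesis using that[of "{w \<in> U. z w i - z y i \<noteq> 0}"] U(1) i by auto
  qed
qed

lemma opens_meet:
  "zopen U \<Longrightarrow> zopen V \<Longrightarrow> U \<noteq> {} \<Longrightarrow> V \<noteq> {} \<Longrightarrow> U \<inter> V \<noteq> {}"
  using irreducible_space_opens_meet[OF irreducible] .

end

text \<open>For local data \<open>c\<close> on \<open>W\<close>, expressed by \<open>R i W c\<close>
  and stable under restriction, finitely many neighbourhoods can be replaced by one. Intersecting
  with \<open>topspace T\<close> covers the case of an empty \<open>I\<close>.\<close>

lemma common_nbhd:
  assumes "finite I" "x \<in> topspace T"
    and "\<And>i. i \<in> I \<Longrightarrow> \<exists>W c. openin T W \<and> x \<in> W \<and> R i W c"
    and anti: "\<And>i W W' c. i \<in> I \<Longrightarrow> R i W c \<Longrightarrow> openin T W \<Longrightarrow> openin T W' \<Longrightarrow> W' \<subseteq> W \<Longrightarrow> R i W' c"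
  obtains W c where "openin T W" "x \<in> W" "\<forall>i\<in>I. R i W (c i)"
proof -
  obtain F c where F: "\<And>i. i \<in> I \<Longrightarrow> openin T (F i) \<and> x \<in> F i \<and> R i (F i) (c i)" using assms(3) by metis
  let ?W = "topspace T \<inter> (\<Inter>i\<in>I. F i)"
  have o: "openin T ?W"
  proof (cases "I = {}")
    case False
    then have "openin T (\<Inter>i\<in>I. F i)" using F assms(1) by (intro openin_INT2) auto
    then show ?thesis by auto
  qed auto
  have "R i ?W (c i)" if "i \<in> I" for i
    using anti[OF that _ _ o] F[OF that] that by blast
  then show thesis using that[OF o, of c] F assms(2) by blast
qed

section \<open>Linear algebra in spaces of functions\<close>

interpretation fun_vs: vector_space "\<lambda>(c::complex) (f::'b \<Rightarrow> complex) y. c * f y"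
  by unfold_locales (auto simp: algebra_simps fun_eq_iff)

text \<open>A basis \<open>C\<close> of the span of \<open>B\<close> stays independent after
  \<open>e\<close> is inserted, so values can be prescribed on it. The ambient space consists of all
  functions, so that neither local rings nor their quotients have to be formed.\<close>

lemma span_separating_functional:
  fixes e :: "'b \<Rightarrow> complex"
  assumes "e \<notin> fun_vs.span B"
  obtains F where "\<And>f g. F (\<lambda>y. f y + g y) = F f + F g" "\<And>c f. F (\<lambda>y. c * f y) = c * F f"
    "\<And>b. b \<in> B \<Longrightarrow> F b = (0::complex)" "F e = 1"
proof -
  obtain C where C: "C \<subseteq> B" "fun_vs.independent C" "B \<subseteq> fun_vs.span C"
    by (rule fun_vs.maximal_independent_subset)
  have "e \<notin> fun_vs.span C" using assms fun_vs.span_mono[OF C(1)] by blast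
  then have ind: "fun_vs.independent (insert e C)" using C(2) by (simp add: fun_vs.independent_insert)
  interpret vp: vector_space_pair "\<lambda>(c::complex) (f::'b \<Rightarrow> complex) y. c * f y" "(*) :: complex \<Rightarrow> complex \<Rightarrow> complex"
    by (rule vector_space_pair.intro[OF fun_vs.vector_space_axioms vector_space_over_itself.vector_space_axioms])
  obtain F where F: "Vector_Spaces.linear (\<lambda>(c::complex) (f::'b \<Rightarrow> complex) y. c * f y) (*) F"
     "\<forall>x\<in>insert e C. F x = (if x = e then 1 else 0)"
    using vp.linear_independent_extend[OF ind, of "\<lambda>x. if x = e then 1 else 0"] by blast
  have add: "F (f + g) = F f + F g" and scale: "F (\<lambda>y. c * f y) = c * F f" for f g c
    using F(1) by (simp_all add: Vector_Spaces.linear_iff)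
  have "e \<notin> C" using \<open>e \<notin> fun_vs.span C\<close> fun_vs.span_base by blast
  have "F b = 0" if "b \<in> B" for b
  proof -
    have "b \<in> fun_vs.span C" using C(3) that by blast
    then show ?thesis
    proof (induction rule: fun_vs.span_induct)
      case base
      have "F 0 = 0" using scale[of 0 0] by (simp add: zero_fun_def)
      then show ?case by (auto simp: fun_vs.subspace_def add scale)
    next
      case (step x)
      then show ?case using F(2) \<open>e \<notin> C\<close> by auto
    qed
  qed
  then show thesis using that[of F] F(2) add scale by (auto simp: plus_fun_def)
qed

lemma sum_fun_apply: "(\<Sum>k\<in>K. F k) x = (\<Sum>k\<in>K. F k x :: complex)"
  by (induction K rule: infinite_finite_induct) (auto simp: plus_fun_def zero_fun_def)

lemma fun_subspace_iff:
  fixes T :: "('b \<Rightarrow> complex) set"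
  shows "fun_vs.subspace T \<longleftrightarrow> (\<lambda>_. 0) \<in> T \<and> (\<forall>D\<in>T. \<forall>E\<in>T. (\<lambda>f. D f + E f) \<in> T) \<and>
    (\<forall>c. \<forall>D\<in>T. (\<lambda>f. c * D f) \<in> T)"
  unfolding fun_vs.subspace_def by (simp add: zero_fun_def plus_fun_def)

text \<open>In the applications \<open>T\<close> is a tangent space and the
  \<open>\<theta> j\<close> are the values of 1-forms at a point. Linearity is demanded on
  \<open>T\<close> only, because a form is unconstrained on arguments that are not tangent
  vectors.\<close>

locale joint_forms =
  fixes T :: "('b \<Rightarrow> complex) set" and J :: "'j set" and \<theta> :: "'j \<Rightarrow> ('b \<Rightarrow> complex) \<Rightarrow> complex"
  assumes subspace: "fun_vs.subspace T" and finite_J: "finite J"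
    and add: "\<And>j D E. j \<in> J \<Longrightarrow> D \<in> T \<Longrightarrow> E \<in> T \<Longrightarrow> \<theta> j (\<lambda>f. D f + E f) = \<theta> j D + \<theta> j E"
    and scale: "\<And>j c D. j \<in> J \<Longrightarrow> D \<in> T \<Longrightarrow> \<theta> j (\<lambda>f. c * D f) = c * \<theta> j D"
    and inj: "\<And>D. D \<in> T \<Longrightarrow> (\<And>j. j \<in> J \<Longrightarrow> \<theta> j D = 0) \<Longrightarrow> D = (\<lambda>_. 0)"
begin

lemma T_zero: "(\<lambda>_. 0) \<in> T" and T_add: "D \<in> T \<Longrightarrow> E \<in> T \<Longrightarrow> (\<lambda>f. D f + E f) \<in> T"
  and T_scale: "D \<in> T \<Longrightarrow> (\<lambda>f. c * D f) \<in> T"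
  using subspace unfolding fun_subspace_iff by blast+

lemma form_zero: "j \<in> J \<Longrightarrow> \<theta> j (\<lambda>_. 0) = 0"
  using scale[of j "\<lambda>_. 0" 0] T_zero by simp

lemma form_linear_combination:
  assumes "finite K" "\<And>k. k \<in> K \<Longrightarrow> e k \<in> T"
  shows "(\<lambda>f. \<Sum>k\<in>K. c k * e k f) \<in> T"
    and "j \<in> J \<Longrightarrow> \<theta> j (\<lambda>f. \<Sum>k\<in>K. c k * e k f) = (\<Sum>k\<in>K. c k * \<theta> j (e k))"
proof -
  have "(\<lambda>f. \<Sum>k\<in>K. c k * e k f) \<in> T \<and>
    (\<forall>j\<in>J. \<theta> j (\<lambda>f. \<Sum>k\<in>K. c k * e k f) = (\<Sum>k\<in>K. c k * \<theta> j (e k)))"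
    using assms
  proof (induction K rule: finite_induct)
    case empty
    then show ?case by (simp add: T_zero form_zero)
  next
    case (insert k K)
    then have k: "(\<lambda>f. c k * e k f) \<in> T" and K: "(\<lambda>f. \<Sum>k\<in>K. c k * e k f) \<in> T"
      by (auto intro: T_scale)
    have "\<theta> j (\<lambda>f. c k * e k f + (\<Sum>k\<in>K. c k * e k f)) = c k * \<theta> j (e k) + (\<Sum>k\<in>K. c k * \<theta> j (e k))"
      if "j \<in> J" for j
      using add[OF that k K] scale[OF that, of "e k" "c k"] insert that by auto
    then show ?case using insert.hyps T_add[OF k K] by simp
  qed
  then show "(\<lambda>f. \<Sum>k\<in>K. c k * e k f) \<in> T"
    and "j \<in> J \<Longrightarrow> \<theta> j (\<lambda>f. \<Sum>k\<in>K. c k * e k f) = (\<Sum>k\<in>K. c k * \<theta> j (e k))"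
    by auto
qed

text \<open>Choose a jointly injective subfamily \<open>I\<close> of least cardinality. Omitting
  \<open>j\<close> from it leaves a non-zero vector killed by the other forms;
  \<open>\<theta> j\<close> does not kill it, and rescaling gives \<open>e j\<close>.\<close>

lemma dual_basis:
  obtains I e where "I \<subseteq> J" "card I = fun_vs.dim T"
    "\<forall>D\<in>T. (\<forall>j\<in>I. \<theta> j D = 0) \<longrightarrow> D = (\<lambda>_. 0)"
    "\<forall>j\<in>I. e j \<in> T" "\<forall>i\<in>I. \<forall>j\<in>I. \<theta> i (e j) = (if i = j then 1 else 0)"
proof -
  define ok where "ok I \<longleftrightarrow> I \<subseteq> J \<and> (\<forall>D\<in>T. (\<forall>j\<in>I. \<theta> j D = 0) \<longrightarrow> D = (\<lambda>_. 0))" for I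
  have "ok J" using inj by (auto simp: ok_def)
  then obtain I where I: "ok I" and min: "\<And>I'. ok I' \<Longrightarrow> card I \<le> card I'"
    using ex_has_least_nat[of ok J card] by blast
  have IJ: "I \<subseteq> J" using I by (simp add: ok_def)
  then have fI: "finite I" using finite_J finite_subset by blast
  have injI: "D = (\<lambda>_. 0)" if "D \<in> T" "\<And>j. j \<in> I \<Longrightarrow> \<theta> j D = 0" for D
    using I that by (auto simp: ok_def)
  have "\<exists>E\<in>T. \<forall>i\<in>I. \<theta> i E = (if i = j then 1 else 0)" if j: "j \<in> I" for j
  proof -
    have "\<not> ok (I - {j})" using min[of "I - {j}"] card_Diff1_less[OF fI j] by auto
    then obtain D where D: "D \<in> T" "D \<noteq> (\<lambda>_. 0)" "\<And>i. i \<in> I - {j} \<Longrightarrow> \<theta> i D = 0"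
      using IJ by (auto simp: ok_def)
    then have "\<theta> j D \<noteq> 0" using injI[of D] by blast
    then show ?thesis
      using D scale[of _ D "1 / \<theta> j D"] IJ j T_scale[OF D(1), of "1 / \<theta> j D"]
      by (intro bexI[of _ "\<lambda>f. 1 / \<theta> j D * D f"]) auto
  qed
  then obtain e where e: "\<And>j. j \<in> I \<Longrightarrow> e j \<in> T"
    "\<And>i j. i \<in> I \<Longrightarrow> j \<in> I \<Longrightarrow> \<theta> i (e j) = (if i = j then 1 else 0)" by metis
  have comb: "\<theta> i (\<lambda>f. \<Sum>k\<in>I. c k * e k f) = c i" if "i \<in> I" for c i
  proof -
    have "\<theta> i (\<lambda>f. \<Sum>k\<in>I. c k * e k f) = (\<Sum>k\<in>I. c k * \<theta> i (e k))"
      by (rule form_linear_combination(2)[OF fI e(1)]) (use that IJ in auto)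
    also have "\<dots> = (\<Sum>k\<in>I. if k = i then c k else 0)"
      by (rule sum.cong) (use e(2) that in auto)
    finally show ?thesis using that fI by simp
  qed
  have einj: "inj_on e I" using e by (intro inj_onI) (metis zero_neq_one)
  have ind: "fun_vs.independent (e ` I)"
  proof (rule fun_vs.independent_if_scalars_zero)
    fix c x assume z: "(\<Sum>x\<in>e ` I. (\<lambda>f. c x * x f)) = 0" and "x \<in> e ` I"
    then obtain i where i: "i \<in> I" "x = e i" by blast
    have "(\<Sum>k\<in>I. c (e k) * e k f) = (\<Sum>x\<in>e ` I. (\<lambda>f. c x * x f)) f" for f
      using sum.reindex[OF einj, of "\<lambda>x. (\<lambda>f. c x * x f) f"] by (simp add: sum_fun_apply)
    then have "(\<lambda>f. \<Sum>k\<in>I. c (e k) * e k f) = (\<lambda>_. 0)" unfolding z by (simp add: fun_eq_iff)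
    then show "c x = 0" using comb[OF i(1), of "\<lambda>k. c (e k)"] form_zero[of i] i IJ by auto
  qed (use fI in simp)
  have "T \<subseteq> fun_vs.span (e ` I)"
  proof
    fix D assume D: "D \<in> T"
    have s: "(\<lambda>f. \<Sum>k\<in>I. \<theta> k D * e k f) \<in> T" by (rule form_linear_combination(1)[OF fI e(1)])
    let ?E = "\<lambda>f. D f + (- 1) * (\<Sum>k\<in>I. \<theta> k D * e k f)"
    have E: "?E \<in> T" using T_add[OF D T_scale[OF s, of "- 1"]] .
    have "\<theta> i ?E = 0" if "i \<in> I" for i
    proof -
      have i: "i \<in> J" using that IJ by blast
      show ?thesis using add[OF i D T_scale[OF s, of "- 1"]] scale[OF i s, of "- 1"] comb[OF that] by simp
    qed
    then have "?E = (\<lambda>_. 0)" by (rule injI[OF E])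
    then have "D = (\<Sum>k\<in>I. (\<lambda>f. \<theta> k D * e k f))" by (subst fun_eq_iff, subst sum_fun_apply, auto simp: fun_eq_iff)
    also have "\<dots> \<in> fun_vs.span (e ` I)"
      by (intro fun_vs.span_sum fun_vs.span_scale fun_vs.span_base) auto
    finally show "D \<in> fun_vs.span (e ` I)" .
  qed
  then have "card (e ` I) = fun_vs.dim T" by (intro fun_vs.basis_card_eq_dim ind) (use e in auto)
  then have "card I = fun_vs.dim T" by (simp add: card_image[OF einj])
  then show thesis using that[OF IJ] injI e by blast
qed

text \<open>When the number of forms equals the dimension, the subfamily found in
  \<open>dual_basis\<close> must be the whole family.\<close>

lemma surjective:
  assumes "card J = fun_vs.dim T"
  shows "\<exists>D\<in>T. \<forall>j\<in>J. \<theta> j D = a j"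
proof -
  obtain I e where I: "I \<subseteq> J" "card I = fun_vs.dim T" "\<forall>j\<in>I. e j \<in> T"
    "\<forall>i\<in>I. \<forall>j\<in>I. \<theta> i (e j) = (if i = j then 1 else 0)"
    by (rule dual_basis)
  then have "I = J" using assms finite_J card_subset_eq by metis
  note e = I(3,4)[unfolded this]
  have "\<theta> j (\<lambda>f. \<Sum>k\<in>J. a k * e k f) = a j" if "j \<in> J" for j
  proof -
    have "\<theta> j (\<lambda>f. \<Sum>k\<in>J. a k * e k f) = (\<Sum>k\<in>J. a k * \<theta> j (e k))"
      by (rule form_linear_combination(2)[OF finite_J]) (use that e in auto)
    also have "\<dots> = (\<Sum>k\<in>J. if k = j then a k else 0)"
      by (rule sum.cong) (use e(2) that in auto)
    finally show ?thesis using that finite_J by simp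
  qed
  moreover have "(\<lambda>f. \<Sum>k\<in>J. a k * e k f) \<in> T"
    by (rule form_linear_combination(1)[OF finite_J]) (use e in auto)
  ultimately show ?thesis by blast
qed

end

section \<open>Tangent vectors\<close>

lemma reg_atI: "openin (ztop S) U \<Longrightarrow> x \<in> U \<Longrightarrow> f \<in> reg S U \<Longrightarrow> f \<in> reg_at S x"
  by (auto simp: reg_at_def)

lemma reg_atE:
  assumes "f \<in> reg_at S x"
  obtains U where "openin (ztop S) U" "x \<in> U" "f \<in> reg S U"
  using assms by (auto simp: reg_at_def)

lemma tangent_outside: "D \<in> tangent_space S x \<Longrightarrow> f \<notin> reg_at S x \<Longrightarrow> D f = 0"
  by (simp add: tangent_space_def)

lemma tangent_add:
  "D \<in> tangent_space S x \<Longrightarrow> f \<in> reg_at S x \<Longrightarrow> g \<in> reg_at S x \<Longrightarrow> D (\<lambda>y. f y + g y) = D f + D g"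
  by (simp add: tangent_space_def)

lemma tangent_mult:
  "D \<in> tangent_space S x \<Longrightarrow> f \<in> reg_at S x \<Longrightarrow> g \<in> reg_at S x \<Longrightarrow>
    D (\<lambda>y. f y * g y) = f x * D g + g x * D f"
  by (simp add: tangent_space_def)

lemma tangent_scale: "D \<in> tangent_space S x \<Longrightarrow> f \<in> reg_at S x \<Longrightarrow> D (\<lambda>y. c * f y) = c * D f"
  by (simp add: tangent_space_def)

lemma tangent_germ:
  assumes "D \<in> tangent_space S x" "f \<in> reg_at S x" "g \<in> reg_at S x"
    and "openin (ztop S) U" "x \<in> U" "\<And>y. y \<in> U \<Longrightarrow> f y = g y"
  shows "D f = D g"
proof -
  have "\<forall>U. openin (ztop S) U \<and> x \<in> U \<and> (\<forall>y\<in>U. f y = g y) \<longrightarrow> D f = D g"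
    using assms(1,2,3) by (simp add: tangent_space_def)
  then show ?thesis using assms(4-) by blast
qed

lemma tangent_space_subspace: "fun_vs.subspace (tangent_space S x)"
  unfolding fun_subspace_iff
proof (intro conjI ballI allI)
  show "(\<lambda>_. 0) \<in> tangent_space S x" by (simp add: tangent_space_def)
next
  fix D E assume D: "D \<in> tangent_space S x" and E: "E \<in> tangent_space S x"
  have germ: "D f + E f = D g + E g"
    if "f \<in> reg_at S x" "g \<in> reg_at S x" "openin (ztop S) U" "x \<in> U" "\<forall>y\<in>U. f y = g y" for f g U
    using tangent_germ[OF D that(1-4)] tangent_germ[OF E that(1-4)] that(5) by simp
  show "(\<lambda>f. D f + E f) \<in> tangent_space S x"
    unfolding tangent_space_def mem_Collect_eq
    by (intro conjI allI ballI impI)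
       (use germ in \<open>auto simp: tangent_outside[OF D] tangent_outside[OF E] tangent_add[OF D] tangent_add[OF E]
        tangent_mult[OF D] tangent_mult[OF E] tangent_scale[OF D] tangent_scale[OF E] algebra_simps\<close>)
next
  fix c D assume D: "D \<in> tangent_space S x"
  have germ: "c * D f = c * D g"
    if "f \<in> reg_at S x" "g \<in> reg_at S x" "openin (ztop S) U" "x \<in> U" "\<forall>y\<in>U. f y = g y" for f g U
    using tangent_germ[OF D that(1-4)] that(5) by simp
  show "(\<lambda>f. c * D f) \<in> tangent_space S x"
    unfolding tangent_space_def mem_Collect_eq
    by (intro conjI allI ballI impI)
       (use germ in \<open>auto simp: tangent_outside[OF D] tangent_add[OF D]
        tangent_mult[OF D] tangent_scale[OF D] algebra_simps\<close>)
qed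

lemma tangent_scaleR: "D \<in> tangent_space S x \<Longrightarrow> (\<lambda>f. c * D f) \<in> tangent_space S x"
  and tangent_sum: "D \<in> tangent_space S x \<Longrightarrow> E \<in> tangent_space S x \<Longrightarrow> (\<lambda>f. D f + E f) \<in> tangent_space S x"
  and tangent_zero: "(\<lambda>_. 0) \<in> tangent_space S x"
  using tangent_space_subspace[of S x] unfolding fun_subspace_iff by blast+

context complex_variety
begin

abbreviation "T \<equiv> tangent_space S"

lemma reg_at_const: "x \<in> points S \<Longrightarrow> (\<lambda>_. c) \<in> reg_at S x"
  by (rule reg_atI[of S "points S"]) (auto intro: reg_const)

lemma reg_at_add: "f \<in> reg_at S x \<Longrightarrow> g \<in> reg_at S x \<Longrightarrow> (\<lambda>y. f y + g y) \<in> reg_at S x"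
  and reg_at_mult: "f \<in> reg_at S x \<Longrightarrow> g \<in> reg_at S x \<Longrightarrow> (\<lambda>y. f y * g y) \<in> reg_at S x"
proof -
  assume "f \<in> reg_at S x" "g \<in> reg_at S x"
  then obtain U V where U: "zopen U" "x \<in> U" "f \<in> reg S U" and V: "zopen V" "x \<in> V" "g \<in> reg S V"
    by (auto elim!: reg_atE)
  have o: "zopen (U \<inter> V)" "x \<in> U \<inter> V" using U V by auto
  have "f \<in> reg S (U \<inter> V)" "g \<in> reg S (U \<inter> V)"
    using reg_restrict[OF U(3,1) o(1)] reg_restrict[OF V(3,1) o(1)] by auto
  then show "(\<lambda>y. f y + g y) \<in> reg_at S x" "(\<lambda>y. f y * g y) \<in> reg_at S x"
    using reg_atI[OF o] reg_add[OF o(1)] reg_mult[OF o(1)] by auto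
qed

lemma reg_at_scale: "f \<in> reg_at S x \<Longrightarrow> (\<lambda>y. c * f y) \<in> reg_at S x"
proof -
  assume f: "f \<in> reg_at S x"
  then have "x \<in> points S" using openin_subset by (auto elim!: reg_atE)
  then show ?thesis using reg_at_mult[OF reg_at_const f] by blast
qed

lemma reg_at_points: "f \<in> reg_at S x \<Longrightarrow> x \<in> points S"
  using openin_subset by (auto elim!: reg_atE)

lemma reg_at_shift: "f \<in> reg_at S x \<Longrightarrow> (\<lambda>y. f y - c) \<in> reg_at S x"
  using reg_at_add[of f x "\<lambda>_. - c"] reg_at_const[OF reg_at_points, of f x "- c"] by simp

lemma reg_at_germ:
  assumes "f \<in> reg_at S x" "zopen U" "x \<in> U" "\<And>y. y \<in> U \<Longrightarrow> f y = g y"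
  shows "g \<in> reg_at S x"
proof -
  obtain V where V: "zopen V" "x \<in> V" "f \<in> reg S V" using assms(1) by (rule reg_atE)
  have o: "zopen (U \<inter> V)" using assms V by auto
  have "f \<in> reg S (U \<inter> V)" using reg_restrict[OF V(3,1) o] by auto
  then have "g \<in> reg S (U \<inter> V)" by (rule reg_cong[OF _ o]) (use assms in auto)
  then show ?thesis by (rule reg_atI[OF o, rotated]) (use assms V in auto)
qed

lemma tangent_const:
  assumes "D \<in> T x" "x \<in> points S"
  shows "D (\<lambda>_. c) = 0"
proof -
  have "D (\<lambda>y. 1 * 1) = 1 * D (\<lambda>_. 1) + 1 * D (\<lambda>_. 1)"
    by (rule tangent_mult[OF assms(1)]) (rule reg_at_const[OF assms(2)])+
  then have "D (\<lambda>_. 1) = 0" by simp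
  then show ?thesis using tangent_scale[OF assms(1) reg_at_const[OF assms(2)], of c 1] by simp
qed

lemma tangent_shift:
  assumes "D \<in> T x" "f \<in> reg_at S x"
  shows "D (\<lambda>y. f y - c) = D f"
  using tangent_add[OF assms reg_at_const[OF reg_at_points[OF assms(2)]], of "- c"]
    tangent_const[OF assms(1) reg_at_points[OF assms(2)], of "- c"] by simp

lemma tangent_finite_sum:
  assumes D: "D \<in> T x" and x: "x \<in> points S" and f: "\<And>i. i \<in> I \<Longrightarrow> f i \<in> reg_at S x"
  shows "(\<lambda>y. \<Sum>i\<in>I. c i * f i y) \<in> reg_at S x" and "D (\<lambda>y. \<Sum>i\<in>I. c i * f i y) = (\<Sum>i\<in>I. c i * D (f i))"
proof -
  have "(\<lambda>y. \<Sum>i\<in>I. c i * f i y) \<in> reg_at S x \<and> D (\<lambda>y. \<Sum>i\<in>I. c i * f i y) = (\<Sum>i\<in>I. c i * D (f i))"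
    using f
  proof (induction I rule: infinite_finite_induct)
    case (insert i I)
    then have i: "(\<lambda>y. c i * f i y) \<in> reg_at S x" and I: "(\<lambda>y. \<Sum>i\<in>I. c i * f i y) \<in> reg_at S x"
      by (auto intro: reg_at_scale)
    show ?case using insert reg_at_add[OF i I] tangent_add[OF D i I] tangent_scale[OF D, of "f i" "c i"] by simp
  qed (use reg_at_const[OF x] tangent_const[OF D x] in auto)
  then show "(\<lambda>y. \<Sum>i\<in>I. c i * f i y) \<in> reg_at S x" "D (\<lambda>y. \<Sum>i\<in>I. c i * f i y) = (\<Sum>i\<in>I. c i * D (f i))"
    by auto
qed

lemma chart_pullback:
  assumes "rational_chart S U N z" "p \<in> poly_fun N" "zopen W" "W \<subseteq> U"
  shows "(\<lambda>y. p (z y)) \<in> reg S W"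
proof -
  have "\<forall>W. \<forall>p\<in>poly_fun N. \<forall>q\<in>poly_fun N. zopen W \<and> W \<subseteq> U \<and> (\<forall>y\<in>W. q (z y) \<noteq> 0) \<longrightarrow>
        (\<lambda>y. p (z y) / q (z y)) \<in> reg S W"
    using assms(1) unfolding rational_chart_def by (elim conjE)
  from this[rule_format, of p "\<lambda>_. 1" W] show ?thesis using assms poly_fun.const by auto
qed

lemma chart_open: "rational_chart S U N z \<Longrightarrow> zopen U"
  by (simp add: rational_chart_def)

lemma chart_coord: 
  assumes "rational_chart S U N z" "zopen W" "W \<subseteq> U" "k < N"
  shows "(\<lambda>y. z y k) \<in> reg S W"
  using chart_pullback[OF assms(1) poly_fun.coord[OF assms(4)] assms(2,3)] .

text \<open>\<open>dp\<close> consists of the formal partial derivatives of \<open>p\<close>, built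
  along the induction by the sum and product rules; they depend neither on the point nor on the
  tangent vector.\<close>

lemma chart_pullback_differential:
  assumes z: "rational_chart S U N z" and p: "p \<in> poly_fun N"
  shows "\<exists>dp. (\<forall>k<N. dp k \<in> poly_fun N) \<and> (\<forall>x\<in>U. \<forall>D\<in>T x.
    D (\<lambda>y. p (z y)) = (\<Sum>k<N. dp k (z x) * D (\<lambda>y. z y k)))"
proof -
  have U: "zopen U" using z by (rule chart_open)
  then have pts: "x \<in> points S" if "x \<in> U" for x using that openin_subset by blast
  have at: "(\<lambda>y. p (z y)) \<in> reg_at S x" if "p \<in> poly_fun N" "x \<in> U" for p x
    using reg_atI[OF U that(2) chart_pullback[OF z that(1) U]] by blast
  show ?thesis using p
  proof (induction rule: poly_fun.induct)
    case (const c)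
    show ?case by (rule exI[of _ "\<lambda>_ _. 0"]) (use poly_fun.const tangent_const pts in auto)
  next
    case (coord i)
    have "(\<Sum>k<N. (if k = i then 1 else 0) * D (\<lambda>y. z y k)) = D (\<lambda>y. z y i)" for D :: "'a tvec"
      using coord by (subst sum.cong[OF refl, of _ _ "\<lambda>k. if k = i then D (\<lambda>y. z y k) else 0"]) auto
    then show ?case by (intro exI[of _ "\<lambda>k _. if k = i then 1 else 0"]) (auto intro: poly_fun.const)
  next
    case (add p q)
    then obtain dp dq where dp: "\<forall>k<N. dp k \<in> poly_fun N" "\<forall>x\<in>U. \<forall>D\<in>T x.
        D (\<lambda>y. p (z y)) = (\<Sum>k<N. dp k (z x) * D (\<lambda>y. z y k))"
      and dq: "\<forall>k<N. dq k \<in> poly_fun N" "\<forall>x\<in>U. \<forall>D\<in>T x.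
        D (\<lambda>y. q (z y)) = (\<Sum>k<N. dq k (z x) * D (\<lambda>y. z y k))" by auto
    have "D (\<lambda>y. p (z y) + q (z y)) = (\<Sum>k<N. (dp k (z x) + dq k (z x)) * D (\<lambda>y. z y k))"
      if "x \<in> U" "D \<in> T x" for x D
      using tangent_add[OF that(2) at[OF add.hyps(1) that(1)] at[OF add.hyps(2) that(1)]]
        dp(2)[rule_format, OF that] dq(2)[rule_format, OF that]
      by (simp add: sum.distrib distrib_right)
    then show ?case using dp(1) dq(1)
      by (intro exI[of _ "\<lambda>k v. dp k v + dq k v"]) (auto intro: poly_fun.add)
  next
    case (mult p q)
    then obtain dp dq where dp: "\<forall>k<N. dp k \<in> poly_fun N" "\<forall>x\<in>U. \<forall>D\<in>T x.
        D (\<lambda>y. p (z y)) = (\<Sum>k<N. dp k (z x) * D (\<lambda>y. z y k))"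
      and dq: "\<forall>k<N. dq k \<in> poly_fun N" "\<forall>x\<in>U. \<forall>D\<in>T x.
        D (\<lambda>y. q (z y)) = (\<Sum>k<N. dq k (z x) * D (\<lambda>y. z y k))" by auto
    have "D (\<lambda>y. p (z y) * q (z y)) = (\<Sum>k<N. (p (z x) * dq k (z x) + q (z x) * dp k (z x)) * D (\<lambda>y. z y k))"
      if "x \<in> U" "D \<in> T x" for x D
      using tangent_mult[OF that(2) at[OF mult.hyps(1) that(1)] at[OF mult.hyps(2) that(1)]]
        dp(2)[rule_format, OF that] dq(2)[rule_format, OF that]
      by (simp add: sum.distrib distrib_right sum_distrib_left mult.assoc)
    moreover have "\<forall>k<N. (\<lambda>v. p v * dq k v + q v * dp k v) \<in> poly_fun N"
    proof (intro allI impI)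
      fix k assume "k < N"
      then have "dp k \<in> poly_fun N" "dq k \<in> poly_fun N" using dp(1) dq(1) by auto
      then show "(\<lambda>v. p v * dq k v + q v * dp k v) \<in> poly_fun N"
        by (intro poly_fun.add poly_fun.mult mult.hyps)
    qed
    ultimately show ?case by (intro exI[of _ "\<lambda>k v. p v * dq k v + q v * dp k v"] conjI ballI)
  qed
qed

text \<open>The quotient rule: write \<open>f\<close> as \<open>p / q\<close> in the chart,
  differentiate \<open>f * q = p\<close> and solve for the derivative of \<open>f\<close>. As
  \<open>q\<close> has no zeros nearby, the coefficients \<open>c k\<close> are regular.\<close>

lemma chart_differential:
  assumes z: "rational_chart S U N z" and x: "x \<in> U" and f: "f \<in> reg_at S x"
  obtains W c where "zopen W" "x \<in> W" "W \<subseteq> U" "f \<in> reg S W" "\<forall>k<N. c k \<in> reg S W"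
    "\<forall>y\<in>W. \<forall>D\<in>T y. D f = (\<Sum>k<N. c k y * D (\<lambda>y. z y k))"
proof -
  have U: "zopen U" using z by (rule chart_open)
  obtain V where V: "zopen V" "x \<in> V" "f \<in> reg S V" using f by (rule reg_atE)
  have o: "zopen (V \<inter> U)" using U V by auto
  have fVU: "f \<in> reg S (V \<inter> U)" by (rule reg_restrict[OF V(3,1) o]) auto
  obtain W p q where W: "zopen W" "x \<in> W" "W \<subseteq> V \<inter> U" and pq: "p \<in> poly_fun N" "q \<in> poly_fun N"
      "\<forall>y\<in>W. q (z y) \<noteq> 0 \<and> f y = p (z y) / q (z y)"
    by (rule rational_chart_quotient[OF z o _ fVU]) (use x V in auto)
  have WU: "W \<subseteq> U" using W by blast
  obtain dp where dp: "\<forall>k<N. dp k \<in> poly_fun N" "\<forall>x\<in>U. \<forall>D\<in>T x.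
        D (\<lambda>y. p (z y)) = (\<Sum>k<N. dp k (z x) * D (\<lambda>y. z y k))"
    using chart_pullback_differential[OF z pq(1)] by blast
  obtain dq where dq: "\<forall>k<N. dq k \<in> poly_fun N" "\<forall>x\<in>U. \<forall>D\<in>T x.
        D (\<lambda>y. q (z y)) = (\<Sum>k<N. dq k (z x) * D (\<lambda>y. z y k))"
    using chart_pullback_differential[OF z pq(2)] by blast
  have fW: "f \<in> reg S W" by (rule reg_restrict[OF fVU o W(1)]) (use W in auto)
  define c where "c k y = (dp k (z y) - f y * dq k (z y)) * inverse (q (z y))" for k y
  have cW: "c k \<in> reg S W" if "k < N" for k
    unfolding c_def using that pq dp(1) dq(1)
    by (intro reg_mult reg_diff reg_inverse chart_pullback[OF z] fW W(1) WU) auto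
  have "D f = (\<Sum>k<N. c k y * D (\<lambda>y. z y k))" if y: "y \<in> W" and D: "D \<in> T y" for y D
  proof -
    have at: "f \<in> reg_at S y" "(\<lambda>y. q (z y)) \<in> reg_at S y" "(\<lambda>y. p (z y)) \<in> reg_at S y"
      using reg_atI[OF W(1) y] fW chart_pullback[OF z pq(1) W(1) WU] chart_pullback[OF z pq(2) W(1) WU] by auto
    have yU: "y \<in> U" using y WU by blast
    have nz: "q (z y) \<noteq> 0" using pq y by blast
    have "D (\<lambda>y. p (z y)) = D (\<lambda>y. f y * q (z y))"
      by (rule tangent_germ[OF D at(3) reg_at_mult[OF at(1,2)] W(1) y]) (use pq in auto)
    also have "\<dots> = f y * D (\<lambda>y. q (z y)) + q (z y) * D f" by (rule tangent_mult[OF D at(1,2)])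
    finally have "q (z y) * D f = D (\<lambda>y. p (z y)) - f y * D (\<lambda>y. q (z y))" by simp
    then have "D f = (D (\<lambda>y. p (z y)) - f y * D (\<lambda>y. q (z y))) * inverse (q (z y))"
      using nz by (simp add: field_simps)
    also have "\<dots> = (\<Sum>k<N. c k y * D (\<lambda>y. z y k))"
    proof -
      have "D (\<lambda>y. p (z y)) - f y * D (\<lambda>y. q (z y)) =
          (\<Sum>k<N. dp k (z y) * D (\<lambda>y. z y k) - f y * (dq k (z y) * D (\<lambda>y. z y k)))"
        using dp(2)[rule_format, OF yU D] dq(2)[rule_format, OF yU D] by (simp add: sum_subtractf sum_distrib_left)
      then show ?thesis unfolding c_def by (simp only: sum_distrib_right) (auto intro!: sum.cong simp: algebra_simps)
    qed
    finally show ?thesis .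
  qed
  then show thesis using that[OF W(1,2) WU fW] cW by blast
qed

end

section \<open>Local coframes\<close>

lemma sym_formsE:
  assumes "s \<in> sym_forms X m U" "x \<in> U"
  obtains V K g f where "openin (ztop X) V" "x \<in> V" "V \<subseteq> U"
    "\<forall>k<K::nat. g k \<in> reg X V \<and> (\<forall>j<m. f k j \<in> reg X V)"
    "\<forall>y\<in>V. \<forall>D\<in>tangent_space X y. s y D = (\<Sum>k<K. g k y * (\<Prod>j<m. D (f k j)))"
proof -
  from assms(1) have "\<forall>x\<in>U. \<exists>V K g f. openin (ztop X) V \<and> x \<in> V \<and> V \<subseteq> U \<and>
      (\<forall>k<K::nat. g k \<in> reg X V \<and> (\<forall>j<m. f k j \<in> reg X V)) \<and>
      (\<forall>y\<in>V. \<forall>D\<in>tangent_space X y. s y D = (\<Sum>k<K. g k y * (\<Prod>j<m. D (f k j))))"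
    unfolding sym_forms_def mem_Collect_eq .
  from bspec[OF this assms(2)] show thesis using that by auto
qed

lemma one_formE:
  assumes "s \<in> sym_forms X 1 U" "x \<in> U"
  obtains V K g f where "openin (ztop X) V" "x \<in> V" "V \<subseteq> U"
    "\<forall>k<K::nat. g k \<in> reg X V \<and> f k \<in> reg X V"
    "\<forall>y\<in>V. \<forall>D\<in>tangent_space X y. s y D = (\<Sum>k<K. g k y * D (f k))"
proof -
  obtain V K g f where *: "openin (ztop X) V" "x \<in> V" "V \<subseteq> U"
    "\<forall>k<K::nat. g k \<in> reg X V \<and> (\<forall>j<1::nat. f k j \<in> reg X V)"
    "\<forall>y\<in>V. \<forall>D\<in>tangent_space X y. s y D = (\<Sum>k<K. g k y * (\<Prod>j<1. D (f k j)))"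
    using assms by (rule sym_formsE)
  then show thesis using that[of V K g "\<lambda>k. f k 0"] by simp
qed

lemma sym_form_scale:
  assumes "s \<in> sym_forms X m U" "x \<in> U" "D \<in> tangent_space X x"
  shows "s x (\<lambda>f. c * D f) = c ^ m * s x D"
proof -
  obtain V K g f where V: "openin (ztop X) V" "x \<in> V" "V \<subseteq> U"
    "\<forall>k<K::nat. g k \<in> reg X V \<and> (\<forall>j<m. f k j \<in> reg X V)"
    "\<forall>y\<in>V. \<forall>D\<in>tangent_space X y. s y D = (\<Sum>k<K. g k y * (\<Prod>j<m. D (f k j)))"
    using assms(1,2) by (rule sym_formsE)
  show ?thesis
    using V(5)[rule_format, OF V(2) assms(3)] V(5)[rule_format, OF V(2) tangent_scaleR[OF assms(3)], of c]
    by (simp add: prod.distrib sum_distrib_left algebra_simps)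
qed

lemma one_form_scale:
  assumes "s \<in> sym_forms X 1 U" "x \<in> U" "D \<in> tangent_space X x"
  shows "s x (\<lambda>f. c * D f) = c * s x D"
  using sym_form_scale[OF assms] by simp

lemma one_form_add:
  assumes "s \<in> sym_forms X 1 U" "x \<in> U" "D \<in> tangent_space X x" "E \<in> tangent_space X x"
  shows "s x (\<lambda>f. D f + E f) = s x D + s x E"
proof -
  obtain V K g f where V: "openin (ztop X) V" "x \<in> V" "V \<subseteq> U"
    "\<forall>k<K::nat. g k \<in> reg X V \<and> f k \<in> reg X V"
    "\<forall>y\<in>V. \<forall>D\<in>tangent_space X y. s y D = (\<Sum>k<K. g k y * D (f k))"
    using assms(1,2) by (rule one_formE)
  show ?thesis
    using V(5)[rule_format, OF V(2) assms(3)] V(5)[rule_format, OF V(2) assms(4)]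
      V(5)[rule_format, OF V(2) tangent_sum[OF assms(3,4)]]
    by (simp add: sum.distrib algebra_simps)
qed

lemma one_form_zero:
  assumes "s \<in> sym_forms X 1 U" "x \<in> U"
  shows "s x (\<lambda>_. 0) = 0"
  using one_form_scale[OF assms tangent_zero, of 0] by simp

context complex_variety
begin

text \<open>Germs modulo \<open>\<mm>\<^sup>2\<close>: a linear functional that kills \<open>\<mm>\<^sup>2\<close> is a tangent vector.\<close>

lemma cotangent_span:
  assumes x: "x \<in> points S" and H: "\<And>h. h \<in> H \<Longrightarrow> h \<in> reg_at S x"
    and e: "e \<in> reg_at S x" "e x = 0"
    and kill: "\<And>D. D \<in> T x \<Longrightarrow> (\<And>h. h \<in> H \<Longrightarrow> D h = 0) \<Longrightarrow> D e = 0"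
  shows "e \<in> fun_vs.span ((\<lambda>h y. h y - h x) ` H \<union> {\<lambda>y. u y * w y | u w. u \<in> reg_at S x \<and> w \<in> reg_at S x \<and> u x = 0 \<and> w x = 0} \<union>
      {u \<in> reg_at S x. \<exists>U. zopen U \<and> x \<in> U \<and> (\<forall>y\<in>U. u y = 0)})"
    (is "e \<in> fun_vs.span ?B")
proof (rule ccontr)
  assume "e \<notin> fun_vs.span ?B"
  then obtain F where add: "\<And>f g. F (\<lambda>y. f y + g y) = F f + F g" and scale: "\<And>c f. F (\<lambda>y. c * f y) = c * F f"
    and B: "\<And>b. b \<in> ?B \<Longrightarrow> F b = (0::complex)" and Fe: "F e = 1"
    by (rule span_separating_functional) blast
  \<comment> \<open>The three parts of \<open>?B\<close> are what makes this a tangent vector that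
    kills \<open>H\<close>: functions that vanish near \<open>x\<close> make \<open>D\<close> depend
    on germs only, products of two functions vanishing at \<open>x\<close> give the Leibniz rule,
    and the shifted \<open>h\<close> give \<open>D h = 0\<close>.\<close>
  define D where "D f = (if f \<in> reg_at S x then F (\<lambda>y. f y - f x) else 0)" for f
  have germ: "D f = D g" if f: "f \<in> reg_at S x" and g: "g \<in> reg_at S x"
    and U: "zopen U" "x \<in> U" "\<forall>y\<in>U. f y = g y" for f g U
  proof -
    let ?d = "\<lambda>y. (f y - f x) + (- 1) * (g y - g x)"
    have "?d \<in> reg_at S x" by (intro reg_at_add reg_at_scale reg_at_shift f g)
    moreover have "\<forall>y\<in>U. ?d y = 0" using U by auto
    ultimately have "?d \<in> ?B" using U by blast
    then have "F ?d = 0" by (rule B)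
    then have "F (\<lambda>y. f y - f x) = F (\<lambda>y. g y - g x)" by (simp only: add scale) simp
    then show ?thesis using f g by (simp add: D_def)
  qed
  have Dadd: "D (\<lambda>y. f y + g y) = D f + D g" if f: "f \<in> reg_at S x" and g: "g \<in> reg_at S x" for f g
  proof -
    have "(\<lambda>y. f y + g y - (f x + g x)) = (\<lambda>y. (f y - f x) + (g y - g x))" by (simp add: fun_eq_iff)
    then show ?thesis using f g reg_at_add[OF f g] add[of "\<lambda>y. f y - f x" "\<lambda>y. g y - g x"] by (simp add: D_def)
  qed
  have Dmult: "D (\<lambda>y. f y * g y) = f x * D g + g x * D f" if f: "f \<in> reg_at S x" and g: "g \<in> reg_at S x" for f g
  proof -
    let ?m = "\<lambda>y. (f y - f x) * (g y - g x)"
    have "?m \<in> {\<lambda>y. u y * w y | u w. u \<in> reg_at S x \<and> w \<in> reg_at S x \<and> u x = 0 \<and> w x = 0}"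
      using reg_at_shift[OF f, of "f x"] reg_at_shift[OF g, of "g x"]
      by - (rule CollectI, rule exI[of _ "\<lambda>y. f y - f x"], rule exI[of _ "\<lambda>y. g y - g x"], auto)
    then have m: "F ?m = 0" by (intro B) blast
    have "(\<lambda>y. f y * g y - f x * g x) = (\<lambda>y. ?m y + (f x * (g y - g x) + g x * (f y - f x)))"
      by (simp add: fun_eq_iff algebra_simps)
    then have "F (\<lambda>y. f y * g y - f x * g x) = F ?m + (f x * F (\<lambda>y. g y - g x) + g x * F (\<lambda>y. f y - f x))"
      by (simp only: add scale)
    then show ?thesis using f g reg_at_mult[OF f g] m by (simp add: D_def)
  qed
  have Dscale: "D (\<lambda>y. c * f y) = c * D f" if f: "f \<in> reg_at S x" for c f
  proof -
    have "(\<lambda>y. c * f y - c * f x) = (\<lambda>y. c * (f y - f x))" by (simp add: fun_eq_iff algebra_simps)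
    then show ?thesis using f reg_at_scale[OF f] scale[of c "\<lambda>y. f y - f x"] by (simp add: D_def)
  qed
  have D: "D \<in> T x"
    unfolding tangent_space_def mem_Collect_eq
    by (intro conjI allI ballI impI) (use germ Dadd Dmult Dscale in \<open>auto simp: D_def[of f for f]\<close>)
  have "D h = 0" if "h \<in> H" for h
    using H[OF that] B[of "\<lambda>y. h y - h x"] that by (auto simp: D_def)
  then have "D e = 0" by (rule kill[OF D])
  then show False using e Fe by (simp add: D_def)
qed

text \<open>Nakayama's lemma in coordinates: the matrix \<open>1 - E\<close> is invertible near \<open>x\<close>.\<close>

lemma eliminate:
  fixes \<zeta> :: "nat \<Rightarrow> 'a \<Rightarrow> 'a tvec \<Rightarrow> complex" and \<theta> :: "'j \<Rightarrow> 'a \<Rightarrow> 'a tvec \<Rightarrow> complex"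
  assumes "zopen W" "x \<in> W"
    and "\<forall>l<N. \<forall>j\<in>J. a l j \<in> reg S W" "\<forall>l<N. \<forall>k<N. E l k \<in> reg S W \<and> E l k x = 0"
    and "\<forall>l<N. \<forall>y\<in>W. \<forall>D\<in>T y. \<zeta> l y D = (\<Sum>j\<in>J. a l j y * \<theta> j y D) + (\<Sum>k<N. E l k y * \<zeta> k y D)"
  shows "\<exists>W' B. zopen W' \<and> x \<in> W' \<and> W' \<subseteq> W \<and> (\<forall>l<N. \<forall>j\<in>J. B l j \<in> reg S W') \<and>
    (\<forall>l<N. \<forall>y\<in>W'. \<forall>D\<in>T y. \<zeta> l y D = (\<Sum>j\<in>J. B l j y * \<theta> j y D))"
  using assms
proof (induction N arbitrary: W a E)
  case 0
  then show ?case by auto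
next
  case (Suc N)
  note W = Suc.prems(1,2) and aW = Suc.prems(3)[rule_format] and EW = Suc.prems(4)[rule_format]
    and eq = Suc.prems(5)[rule_format]
  \<comment> \<open>Gaussian elimination of the last unknown: the pivot \<open>1 - E N N\<close>
    equals 1 at \<open>x\<close>, hence is invertible on the neighbourhood
    \<open>W1\<close>.\<close>
  define r where "r y = inverse (1 - E N N y)" for y
  define W1 where "W1 = {y \<in> W. 1 - E N N y \<noteq> 0}"
  have W1: "zopen W1" unfolding W1_def
    by (intro openin_nonzero reg_diff reg_const W) (use EW in auto)
  have sub: "W1 \<subseteq> W" by (auto simp: W1_def)
  have x: "x \<in> W1" using W EW[of N N] by (simp add: W1_def)
  note res = reg_restrict[OF _ W(1) W1 sub]
  have rW: "r \<in> reg S W1" unfolding r_def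
    by (intro reg_inverse reg_diff reg_const W1 res) (use EW in \<open>auto simp: W1_def\<close>)
  define a' where "a' j y = r y * a N j y" for j y
  define E' where "E' k y = r y * E N k y" for k y
  have a'W: "a' j \<in> reg S W1" if "j \<in> J" for j unfolding a'_def
    by (intro reg_mult W1 rW res) (use aW that in auto)
  have E'W: "E' k \<in> reg S W1" "E' k x = 0" if "k < N" for k unfolding E'_def
    by (intro reg_mult W1 rW res) (use EW that in auto)
  have last: "\<zeta> N y D = (\<Sum>j\<in>J. a' j y * \<theta> j y D) + (\<Sum>k<N. E' k y * \<zeta> k y D)" if y: "y \<in> W1" and D: "D \<in> T y" for y D
  proof -
    have "\<zeta> N y D = (\<Sum>j\<in>J. a N j y * \<theta> j y D) + ((\<Sum>k<N. E N k y * \<zeta> k y D) + E N N y * \<zeta> N y D)"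
      using eq[of N y D] y sub D by auto
    then have "(1 - E N N y) * \<zeta> N y D = (\<Sum>j\<in>J. a N j y * \<theta> j y D) + (\<Sum>k<N. E N k y * \<zeta> k y D)"
      by (simp add: algebra_simps)
    moreover have "1 - E N N y \<noteq> 0" using y by (simp add: W1_def)
    ultimately have "\<zeta> N y D = r y * ((\<Sum>j\<in>J. a N j y * \<theta> j y D) + (\<Sum>k<N. E N k y * \<zeta> k y D))"
      unfolding r_def by (simp add: field_simps)
    then show ?thesis by (simp add: a'_def E'_def distrib_left sum_distrib_left mult.assoc)
  qed
  \<comment> \<open>Substituting the last row into the others leaves a system of the same shape;
    \<open>E2\<close> still vanishes at \<open>x\<close> because every summand contains an entry of
    \<open>E\<close>.\<close>
  define a2 where "a2 l j y = a l j y + E l N y * a' j y" for l j y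
  define E2 where "E2 l k y = E l k y + E l N y * E' k y" for l k y
  have "\<forall>l<N. \<forall>j\<in>J. a2 l j \<in> reg S W1" unfolding a2_def
    by (intro allI impI ballI reg_add reg_mult W1 a'W res) (use aW EW in auto)
  moreover have "\<forall>l<N. \<forall>k<N. E2 l k \<in> reg S W1 \<and> E2 l k x = 0" unfolding E2_def
    by (intro allI impI conjI reg_add reg_mult W1 E'W res) (use EW E'W in auto)
  moreover have "\<forall>l<N. \<forall>y\<in>W1. \<forall>D\<in>T y. \<zeta> l y D = (\<Sum>j\<in>J. a2 l j y * \<theta> j y D) + (\<Sum>k<N. E2 l k y * \<zeta> k y D)"
  proof (intro allI impI ballI)
    fix l y D assume l: "l < N" and y: "y \<in> W1" and D: "D \<in> T y"
    have "\<zeta> l y D = (\<Sum>j\<in>J. a l j y * \<theta> j y D) + ((\<Sum>k<N. E l k y * \<zeta> k y D) + E l N y * \<zeta> N y D)"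
      using eq[of l y D] y sub D l by auto
    then show "\<zeta> l y D = (\<Sum>j\<in>J. a2 l j y * \<theta> j y D) + (\<Sum>k<N. E2 l k y * \<zeta> k y D)"
      unfolding last[OF y D] by (simp add: a2_def E2_def sum.distrib sum_distrib_left algebra_simps)
  qed
  ultimately obtain W' B where W': "zopen W'" "x \<in> W'" "W' \<subseteq> W1" and B: "\<forall>l<N. \<forall>j\<in>J. B l j \<in> reg S W'"
      "\<forall>l<N. \<forall>y\<in>W'. \<forall>D\<in>T y. \<zeta> l y D = (\<Sum>j\<in>J. B l j y * \<theta> j y D)"
    using Suc.IH[OF W1 x, of a2 E2] by blast
  define BN where "BN j y = a' j y + (\<Sum>k<N. E' k y * B k j y)" for j y
  have BN: "BN j \<in> reg S W'" if "j \<in> J" for j unfolding BN_def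
    by (intro reg_add reg_sum reg_mult W' reg_restrict[OF a'W W1 W'(1,3)] reg_restrict[OF E'W(1) W1 W'(1,3)])
      (use that B in auto)
  have "\<zeta> N y D = (\<Sum>j\<in>J. BN j y * \<theta> j y D)" if y: "y \<in> W'" and D: "D \<in> T y" for y D
  proof -
    have "(\<Sum>k<N. E' k y * \<zeta> k y D) = (\<Sum>k<N. \<Sum>j\<in>J. E' k y * (B k j y * \<theta> j y D))"
      by (rule sum.cong) (use B(2) y D in \<open>auto simp: sum_distrib_left\<close>)
    also have "\<dots> = (\<Sum>j\<in>J. \<Sum>k<N. E' k y * (B k j y * \<theta> j y D))" by (rule sum.swap)
    also have "\<dots> = (\<Sum>j\<in>J. (\<Sum>k<N. E' k y * B k j y) * \<theta> j y D)"
      by (simp add: sum_distrib_right mult.assoc)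
    finally show ?thesis using last[of y D] y D W' by (auto simp: BN_def sum.distrib distrib_right)
  qed
  then show ?case using W' sub B BN
    by - (rule exI[of _ W'], rule exI[of _ "\<lambda>l. if l = N then BN else B l"], auto simp: less_Suc_eq)
qed

end

context complex_variety
begin

text \<open>The \<open>\<theta> j\<close> span the cotangent space at \<open>x\<close>, so the
  differential of each coordinate is a combination of them with constant coefficients, up to an
  error whose coefficients vanish at \<open>x\<close>. Nakayama's lemma in the form
  \<open>eliminate\<close> then removes the error on a whole neighbourhood.\<close>

lemma local_coframe:
  fixes \<theta> :: "'j \<Rightarrow> 'a \<Rightarrow> 'a tvec \<Rightarrow> complex"
  assumes z: "rational_chart S U N z" and x: "x \<in> U" and J: "finite J"
    and \<theta>: "\<And>j. j \<in> J \<Longrightarrow> \<theta> j \<in> sym_forms S 1 (points S)"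
    and inj: "\<And>D. D \<in> T x \<Longrightarrow> (\<And>j. j \<in> J \<Longrightarrow> \<theta> j x D = 0) \<Longrightarrow> D = (\<lambda>_. 0)"
  obtains W B where "zopen W" "x \<in> W" "W \<subseteq> U" "\<forall>l<N. \<forall>j\<in>J. B l j \<in> reg S W"
    "\<forall>l<N. \<forall>y\<in>W. \<forall>D\<in>T y. D (\<lambda>y. z y l) = (\<Sum>j\<in>J. B l j y * \<theta> j y D)"
proof -
  have U: "zopen U" using z by (rule chart_open)
  have pts: "y \<in> points S" if "y \<in> U" for y using that openin_subset[OF U] by blast
  let ?z = "\<lambda>k y. z y k"
  let ?van = "\<lambda>W E. \<forall>k<N. E k \<in> reg S W \<and> E k x = 0"
  let ?rel = "\<lambda>\<alpha> W a E. \<forall>y\<in>W. \<forall>D\<in>T y. \<alpha> y D = (\<Sum>j\<in>J. a j * \<theta> j y D) + (\<Sum>k<N. E k y * D (?z k))"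
  \<comment> \<open>\<open>gf \<alpha>\<close> says that near \<open>x\<close> the 1-form
    \<open>\<alpha>\<close> is in the complex span of the \<open>\<theta> j\<close> modulo forms
    with coefficients vanishing at \<open>x\<close>. The \<open>a j\<close> are numbers, not
    functions; only the error terms vary.\<close>
  define gf where "gf \<alpha> \<longleftrightarrow> (\<exists>W a E. zopen W \<and> x \<in> W \<and> W \<subseteq> U \<and>
      (?van W E) \<and>
      (?rel \<alpha> W a E))" for \<alpha>
  have gfE: "\<exists>W a E. zopen W \<and> x \<in> W \<and> W \<subseteq> U \<and> W \<subseteq> V \<and>
      (?van W E) \<and>
      (?rel \<alpha> W a E)"
    if "gf \<alpha>" "zopen V" "x \<in> V" for \<alpha> V
  proof -
    obtain W a E where W: "zopen W" "x \<in> W" "W \<subseteq> U" "?van W E"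
      "?rel \<alpha> W a E"
      using \<open>gf \<alpha>\<close> unfolding gf_def by blast
    have o: "zopen (W \<inter> V)" using W that by auto
    then show ?thesis using W that reg_restrict[OF _ W(1) o]
      by - (rule exI[of _ "W \<inter> V"], rule exI[of _ a], rule exI[of _ E], auto)
  qed
  have gf_cong: "gf \<beta>" if a: "gf \<alpha>" and V: "zopen V" "x \<in> V"
    and eq: "\<And>y D. y \<in> V \<Longrightarrow> D \<in> T y \<Longrightarrow> \<beta> y D = \<alpha> y D" for \<alpha> \<beta> V
  proof -
    obtain W a E where W: "zopen W" "x \<in> W" "W \<subseteq> U" "W \<subseteq> V" "?van W E"
      "?rel \<alpha> W a E"
      using gfE[OF a V] by blast
    then show ?thesis unfolding gf_def using eq
      by - (rule exI[of _ W], rule exI[of _ a], rule exI[of _ E], auto)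
  qed
  have gf_zero: "gf (\<lambda>_ _. 0)" unfolding gf_def using U x reg_const[OF U]
    by - (rule exI[of _ U], rule exI[of _ "\<lambda>_. 0"], rule exI[of _ "\<lambda>_ _. 0"], auto)
  have gf_add: "gf (\<lambda>y D. \<alpha> y D + \<beta> y D)" if a: "gf \<alpha>" and b: "gf \<beta>" for \<alpha> \<beta>
  proof -
    obtain W a E where W: "zopen W" "x \<in> W" "W \<subseteq> U" "?van W E"
      "?rel \<alpha> W a E"
      using gfE[OF a U x] by blast
    obtain W' a' E' where W': "zopen W'" "x \<in> W'" "W' \<subseteq> U" "W' \<subseteq> W" "?van W' E'"
      "?rel \<beta> W' a' E'"
      using gfE[OF b W(1,2)] by blast
    have "\<forall>k<N. (\<lambda>y. E k y + E' k y) \<in> reg S W' \<and> E k x + E' k x = 0"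
      using W W' reg_add[OF W'(1)] reg_restrict[OF _ W(1) W'(1,4)] by auto
    moreover have "\<forall>y\<in>W'. \<forall>D\<in>T y. \<alpha> y D + \<beta> y D =
        (\<Sum>j\<in>J. (a j + a' j) * \<theta> j y D) + (\<Sum>k<N. (E k y + E' k y) * D (?z k))"
      using W(5) W'(4,6) by (auto simp: distrib_right sum.distrib subset_iff)
    ultimately show ?thesis unfolding gf_def using W'
      by - (rule exI[of _ W'], rule exI[of _ "\<lambda>j. a j + a' j"], rule exI[of _ "\<lambda>k y. E k y + E' k y"], auto)
  qed
  have gf_scale: "gf (\<lambda>y D. c * \<alpha> y D)" if a: "gf \<alpha>" for \<alpha> c
  proof -
    obtain W a E where W: "zopen W" "x \<in> W" "W \<subseteq> U" "?van W E"
      "?rel \<alpha> W a E"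
      using gfE[OF a U x] by blast
    have "\<forall>k<N. (\<lambda>y. c * E k y) \<in> reg S W \<and> c * E k x = 0"
      using W reg_mult[OF W(1) reg_const[OF W(1)]] by auto
    moreover have "\<forall>y\<in>W. \<forall>D\<in>T y. c * \<alpha> y D =
        (\<Sum>j\<in>J. (c * a j) * \<theta> j y D) + (\<Sum>k<N. (c * E k y) * D (?z k))"
      using W(5) by (auto simp: distrib_left sum_distrib_left mult.assoc)
    ultimately show ?thesis unfolding gf_def using W
      by - (rule exI[of _ W], rule exI[of _ "\<lambda>j. c * a j"], rule exI[of _ "\<lambda>k y. c * E k y"], auto)
  qed
  have gf_sum: "gf (\<lambda>y D. \<Sum>i\<in>I. \<alpha> i y D)" if "\<And>i. i \<in> I \<Longrightarrow> gf (\<alpha> i)" for I :: "nat set" and \<alpha>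
    using that by (induction I rule: infinite_finite_induct) (auto intro: gf_zero gf_add)
  have gf_theta: "gf (\<theta> i)" if "i \<in> J" for i
  proof -
    have "(\<Sum>j\<in>J. (if j = i then 1 else 0) * \<theta> j y D) = \<theta> i y D" for y D
      using that J by (subst sum.cong[OF refl, of _ _ "\<lambda>j. if j = i then \<theta> j y D else 0"]) auto
    then show ?thesis unfolding gf_def using U x reg_const[OF U]
      by - (rule exI[of _ U], rule exI[of _ "\<lambda>j. if j = i then 1 else 0"], rule exI[of _ "\<lambda>_ _. 0"], auto)
  qed
  have gf_diff: "gf (\<lambda>y D. u y * D f)" if u: "u \<in> reg_at S x" "u x = 0" and f: "f \<in> reg_at S x" for u f
  proof -
    obtain W c where W: "zopen W" "x \<in> W" "W \<subseteq> U" "f \<in> reg S W" "\<forall>k<N. c k \<in> reg S W"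
      "\<forall>y\<in>W. \<forall>D\<in>T y. D f = (\<Sum>k<N. c k y * D (?z k))"
      using z x f by (rule chart_differential)
    obtain V where V: "zopen V" "x \<in> V" "u \<in> reg S V" using u(1) by (rule reg_atE)
    have o: "zopen (W \<inter> V)" using W V by auto
    have "\<forall>k<N. (\<lambda>y. u y * c k y) \<in> reg S (W \<inter> V) \<and> u x * c k x = 0"
      using reg_mult[OF o] reg_restrict[OF V(3,1) o] reg_restrict[OF _ W(1) o] W(5) u(2) by auto
    moreover have "\<forall>y\<in>W \<inter> V. \<forall>D\<in>T y. u y * D f = (\<Sum>j\<in>J. 0 * \<theta> j y D) + (\<Sum>k<N. (u y * c k y) * D (?z k))"
    proof (intro ballI)
      fix y D assume "y \<in> W \<inter> V" "D \<in> T y"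
      with W(6) have "D f = (\<Sum>k<N. c k y * D (?z k))" by blast
      then show "u y * D f = (\<Sum>j\<in>J. 0 * \<theta> j y D) + (\<Sum>k<N. (u y * c k y) * D (?z k))"
        by (simp only: sum_distrib_left mult.assoc) simp
    qed
    ultimately show ?thesis unfolding gf_def using o W V
      by - (rule exI[of _ "W \<inter> V"], rule exI[of _ "\<lambda>_. 0"], rule exI[of _ "\<lambda>k y. u y * c k y"], auto)
  qed
  \<comment> \<open>A function whose differential at the point \<open>x\<close> is
    \<open>\<theta> j\<close>: freeze the coefficients \<open>g k\<close> at \<open>x\<close>. Away
    from \<open>x\<close> the discrepancy has the coefficients \<open>g k - g k x\<close>, which
    vanish at \<open>x\<close>.\<close>
  have "\<exists>h. h \<in> reg_at S x \<and> (\<forall>D\<in>T x. D h = \<theta> j x D) \<and> gf (\<lambda>y D. D h)" if j: "j \<in> J" for j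
  proof -
    obtain V K g f where V: "zopen V" "x \<in> V" "V \<subseteq> points S"
      and gf': "\<forall>k<K::nat. g k \<in> reg S V \<and> f k \<in> reg S V"
      and th: "\<forall>y\<in>V. \<forall>D\<in>T y. \<theta> j y D = (\<Sum>k<K. g k y * D (f k))"
      using \<theta>[OF j] pts[OF x] by (rule one_formE)
    have fat: "f k \<in> reg_at S y" and gat: "g k \<in> reg_at S y" if "k < K" "y \<in> V" for k y
      using gf' that reg_atI[OF V(1)] by auto
    define h where "h y = (\<Sum>k<K. g k x * f k y)" for y
    have h: "h \<in> reg_at S x" unfolding h_def
      by (rule tangent_finite_sum(1)[OF tangent_zero pts[OF x]]) (use fat V in auto)
    have Dh: "D h = (\<Sum>k<K. g k x * D (f k))" if "y \<in> V" "D \<in> T y" for y D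
      unfolding h_def by (rule tangent_finite_sum(2)[OF that(2)]) (use that fat V in auto)
    have "gf (\<lambda>y D. \<theta> j y D + (\<Sum>k<K. (- 1) * ((g k y - g k x) * D (f k))))"
      by (intro gf_add gf_theta j gf_sum gf_scale gf_diff reg_at_shift) (use fat gat V in auto)
    then have "gf (\<lambda>y D. D h)"
      by (rule gf_cong[OF _ V(1,2)]) (use Dh th in \<open>auto simp: sum.distrib[symmetric] algebra_simps\<close>)
    moreover have "\<forall>D\<in>T x. D h = \<theta> j x D" using Dh[OF V(2)] th V(2) by auto
    ultimately show ?thesis using h by blast
  qed
  then obtain h where h: "\<And>j. j \<in> J \<Longrightarrow> h j \<in> reg_at S x"
    "\<And>j D. j \<in> J \<Longrightarrow> D \<in> T x \<Longrightarrow> D (h j) = \<theta> j x D" "\<And>j. j \<in> J \<Longrightarrow> gf (\<lambda>y D. D (h j))"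
    by metis
  \<comment> \<open>These functions form a vector space, so membership in the span provided by
    \<open>cotangent_span\<close> has to be followed up on generators only.\<close>
  define good where "good e \<longleftrightarrow> e \<in> reg_at S x \<and> gf (\<lambda>y D. D e)" for e
  have good_sub: "fun_vs.subspace {e. good e}" unfolding fun_subspace_iff
  proof (intro conjI ballI allI)
    show "(\<lambda>_. 0) \<in> {e. good e}" unfolding good_def mem_Collect_eq
      using reg_at_const[OF pts[OF x]] gf_cong[OF gf_zero U x] tangent_const pts by auto
  next
    fix e e' assume "e \<in> {e. good e}" "e' \<in> {e. good e}"
    then have e: "e \<in> reg_at S x" "e' \<in> reg_at S x" and gs: "gf (\<lambda>y D. D e)" "gf (\<lambda>y D. D e')"
      by (auto simp: good_def)
    obtain V V' where V: "zopen V" "x \<in> V" "e \<in> reg S V"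
      and V': "zopen V'" "x \<in> V'" "e' \<in> reg S V'" using e by (auto elim!: reg_atE)
    have o: "zopen (V \<inter> V')" "x \<in> V \<inter> V'" using V V' by auto
    have "gf (\<lambda>y D. D (\<lambda>y. e y + e' y))"
      by (rule gf_cong[OF gf_add[OF gs] o], rule tangent_add)
         (use reg_atI[OF V(1) _ V(3)] reg_atI[OF V'(1) _ V'(3)] in auto)
    then show "(\<lambda>y. e y + e' y) \<in> {e. good e}" using reg_at_add[OF e] by (simp add: good_def)
  next
    fix c e assume "e \<in> {e. good e}"
    then have e: "e \<in> reg_at S x" and gs: "gf (\<lambda>y D. D e)" by (auto simp: good_def)
    obtain V where V: "zopen V" "x \<in> V" "e \<in> reg S V" using e by (auto elim!: reg_atE)
    have "gf (\<lambda>y D. D (\<lambda>y. c * e y))"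
      by (rule gf_cong[OF gf_scale[OF gs] V(1,2)], rule tangent_scale) (use reg_atI[OF V(1) _ V(3)] in auto)
    then show "(\<lambda>y. c * e y) \<in> {e. good e}" using reg_at_scale[OF e] by (simp add: good_def)
  qed
  have gf_shift: "gf (\<lambda>y D. D (\<lambda>y. e y - c)) \<longleftrightarrow> gf (\<lambda>y D. D e)" if e: "e \<in> reg_at S x" for e c
  proof -
    obtain V where V: "zopen V" "x \<in> V" "e \<in> reg S V" using e by (auto elim!: reg_atE)
    have eq: "D (\<lambda>y. e y - c) = D e" if "y \<in> V" "D \<in> T y" for y D
      by (rule tangent_shift[OF that(2) reg_atI[OF V(1) that(1) V(3)]])
    show ?thesis
    proof
      assume "gf (\<lambda>y D. D (\<lambda>y. e y - c))"
      then show "gf (\<lambda>y D. D e)" by (rule gf_cong[OF _ V(1,2)]) (rule eq[symmetric])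
    next
      assume "gf (\<lambda>y D. D e)"
      then show "gf (\<lambda>y D. D (\<lambda>y. e y - c))" by (rule gf_cong[OF _ V(1,2)]) (rule eq)
    qed
  qed
  have "gf (\<lambda>y D. D (?z l))" if l: "l < N" for l
  proof -
    have zl: "?z l \<in> reg_at S x" by (rule reg_atI[OF U x chart_coord[OF z U order_refl l]])
    let ?e = "\<lambda>y. z y l - z x l"
    let ?B = "(\<lambda>h y. h y - h x) ` h ` J \<union> {\<lambda>y. u y * w y | u w. u \<in> reg_at S x \<and> w \<in> reg_at S x \<and> u x = 0 \<and> w x = 0} \<union>
      {u \<in> reg_at S x. \<exists>U. zopen U \<and> x \<in> U \<and> (\<forall>y\<in>U. u y = 0)}"
    have "?e \<in> fun_vs.span ?B"
    proof (rule cotangent_span[OF pts[OF x] _ reg_at_shift[OF zl]])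
      fix D assume D: "D \<in> T x" and "\<And>g. g \<in> h ` J \<Longrightarrow> D g = 0"
      then have "D = (\<lambda>_. 0)" using inj[OF D] h(2)[OF _ D] by auto
      then show "D ?e = 0" by simp
    qed (use h in auto)
    then have "good ?e"
    proof (rule fun_vs.span_induct[of _ _ good, OF _ good_sub])
      fix b assume "b \<in> ?B"
      then consider (a) j where "j \<in> J" "b = (\<lambda>y. h j y - h j x)"
        | (m) u w where "b = (\<lambda>y. u y * w y)" "u \<in> reg_at S x" "w \<in> reg_at S x" "u x = 0" "w x = 0"
        | (n) V where "b \<in> reg_at S x" "zopen V" "x \<in> V" "\<forall>y\<in>V. b y = 0" by blast
      then show "good b"
      proof cases
        case a
        then show ?thesis using h gf_shift reg_at_shift by (simp add: good_def)
      next
        case m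
        obtain V V' where V: "zopen V" "x \<in> V" "u \<in> reg S V"
          and V': "zopen V'" "x \<in> V'" "w \<in> reg S V'" using m by (auto elim!: reg_atE)
        have o: "zopen (V \<inter> V')" "x \<in> V \<inter> V'" using V V' by auto
        \<comment> \<open>By the Leibniz rule the differential of a product of two functions
          vanishing at \<open>x\<close> consists of error terms alone.\<close>
        have "gf (\<lambda>y D. u y * D w + w y * D u)" by (intro gf_add gf_diff m)
        then have "gf (\<lambda>y D. D (\<lambda>y. u y * w y))"
          by (rule gf_cong[OF _ o], intro tangent_mult)
             (use reg_atI[OF V(1) _ V(3)] reg_atI[OF V'(1) _ V'(3)] in auto)
        then show ?thesis using m reg_at_mult by (simp add: good_def)
      next
        case n
        have "D b = 0" if y: "y \<in> V" and D: "D \<in> T y" for y D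
        proof -
          have y': "y \<in> points S" using y n(2) openin_subset by blast
          have r0: "(\<lambda>_. 0) \<in> reg_at S y" by (rule reg_at_const[OF y'])
          have rb: "b \<in> reg_at S y" by (rule reg_at_germ[OF r0 n(2) y]) (simp add: n(4))
          have "D b = D (\<lambda>_. 0)" by (rule tangent_germ[OF D rb r0 n(2) y]) (simp add: n(4))
          then show ?thesis using tangent_const[OF D y'] by simp
        qed
        then show ?thesis using n gf_cong[OF gf_zero n(2,3)] by (simp add: good_def)
      qed
    qed
    then show ?thesis using gf_shift[OF zl] by (simp add: good_def)
  qed
  note coords = this
  \<comment> \<open>The relations for all \<open>l\<close> have to hold on one neighbourhood; the
    pair \<open>c\<close> packs constants and error coefficients so that \<open>common_nbhd\<close>
    applies.\<close>
  define R where "R l W c \<longleftrightarrow> W \<subseteq> U \<and> (\<forall>k<N. snd c k \<in> reg S W \<and> snd c k x = 0) \<and>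
      (\<forall>y\<in>W. \<forall>D\<in>T y. D (?z l) = (\<Sum>j\<in>J. fst c j * \<theta> j y D) + (\<Sum>k<N. snd c k y * D (?z k)))"
    for l W and c :: "('j \<Rightarrow> complex) \<times> (nat \<Rightarrow> 'a \<Rightarrow> complex)"
  have ex: "\<exists>W c. zopen W \<and> x \<in> W \<and> R l W c" if "l \<in> {..<N}" for l
  proof -
    have "gf (\<lambda>y D. D (?z l))" using that by (intro coords) simp
    then obtain W a E where "zopen W" "x \<in> W" "W \<subseteq> U" "?van W E"
      "?rel (\<lambda>y D. D (?z l)) W a E"
      unfolding gf_def by blast
    then show ?thesis unfolding R_def by (intro exI[of _ W] exI[of _ "(a, E)"]) simp
  qed
  have anti: "R l W' c" if R: "R l W c" and W: "zopen W" "zopen W'" "W' \<subseteq> W" for l W W' c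
    using R W(3) reg_restrict[OF _ W] unfolding R_def by auto
  obtain W c where W: "zopen W" "x \<in> W" and WR: "\<forall>l\<in>{..<N}. R l W (c l)"
    by (rule common_nbhd[where I = "{..<N}" and x = x and T = "ztop S" and R = R, OF _ pts[OF x] ex])
       (use anti in blast)+
  define a where "a l = fst (c l)" for l
  define E where "E l = snd (c l)" for l
  have aE: "(\<forall>k<N. E l k \<in> reg S W \<and> E l k x = 0) \<and>
      (\<forall>y\<in>W. \<forall>D\<in>T y. D (?z l) = (\<Sum>j\<in>J. a l j * \<theta> j y D) + (\<Sum>k<N. E l k y * D (?z k)))" if "l < N" for l
    using WR that unfolding R_def a_def E_def by simp
  have o: "zopen (W \<inter> U)" using W U by auto
  obtain W' B where W': "zopen W'" "x \<in> W'" "W' \<subseteq> W \<inter> U" "\<forall>l<N. \<forall>j\<in>J. B l j \<in> reg S W'"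
    "\<forall>l<N. \<forall>y\<in>W'. \<forall>D\<in>T y. D (?z l) = (\<Sum>j\<in>J. B l j y * \<theta> j y D)"
    using eliminate[OF o, of x N J "\<lambda>l j _. a l j" E "\<lambda>l y D. D (?z l)" \<theta>]
      aE W x reg_const[OF o] reg_restrict[OF _ W(1) o] by auto
  then show thesis using that[of W' B] by auto
qed

end

section \<open>Functions on the total space of the tangent bundle\<close>

text \<open>With \<open>R = reg S W\<close> these are polynomials in the fibre coordinates of the
  trivial bundle over \<open>W\<close>. The shape parallels \<open>poly_fun\<close>, so that
  freezing the point (\<open>bipoly_slice\<close>) and passing to the product variety
  (\<open>bipoly_bireg\<close>) are plain inductions.\<close>

inductive_set bipoly :: "nat \<Rightarrow> ('a \<Rightarrow> complex) set \<Rightarrow> ('a \<Rightarrow> (nat \<Rightarrow> complex) \<Rightarrow> complex) set"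
  for N :: nat and R :: "('a \<Rightarrow> complex) set" where
  base: "f \<in> R \<Longrightarrow> (\<lambda>x u. f x) \<in> bipoly N R"
| coord: "i < N \<Longrightarrow> (\<lambda>x u. u i) \<in> bipoly N R"
| add: "p \<in> bipoly N R \<Longrightarrow> q \<in> bipoly N R \<Longrightarrow> (\<lambda>x u. p x u + q x u) \<in> bipoly N R"
| mult: "p \<in> bipoly N R \<Longrightarrow> q \<in> bipoly N R \<Longrightarrow> (\<lambda>x u. p x u * q x u) \<in> bipoly N R"

lemma bipoly_mono:
  "p \<in> bipoly N R \<Longrightarrow> N \<le> M \<Longrightarrow> R \<subseteq> R' \<Longrightarrow> p \<in> bipoly M R'"
proof (induction rule: bipoly.induct)
  case (base f)
  then show ?case by (intro bipoly.base) auto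
next
  case (coord i)
  then show ?case by (intro bipoly.coord) auto
next
  case (add p q)
  then show ?case by (intro bipoly.add) auto
next
  case (mult p q)
  then show ?case by (intro bipoly.mult) auto
qed

lemma bipoly_slice: "p \<in> bipoly N R \<Longrightarrow> p x \<in> poly_fun N"
proof (induction rule: bipoly.induct)
  case (base f)
  show ?case by (rule poly_fun.const)
next
  case (coord i)
  then show ?case by (rule poly_fun.coord)
next
  case (add p q)
  then show ?case by (intro poly_fun.add)
next
  case (mult p q)
  then show ?case by (intro poly_fun.mult)
qed

lemma bipoly_sum:
  assumes "(\<lambda>_. 0) \<in> R" "\<And>i. i \<in> I \<Longrightarrow> p i \<in> bipoly N R"
  shows "(\<lambda>x u. \<Sum>i\<in>I. p i x u) \<in> bipoly N R"
  using assms(2)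
proof (induction I rule: infinite_finite_induct)
  case (insert i I)
  then have "(\<lambda>x u. p i x u + (\<Sum>i\<in>I. p i x u)) \<in> bipoly N R" by (intro bipoly.add) auto
  then show ?case using insert.hyps by simp
qed (use bipoly.base[OF assms(1)] in auto)

lemma poly_fun_bipoly:
  assumes "p \<in> poly_fun N" "\<And>c. (\<lambda>_. c) \<in> R"
  shows "(\<lambda>x. p) \<in> bipoly N R"
  using assms(1)
proof (induction rule: poly_fun.induct)
  case (const c)
  show ?case by (rule bipoly.base[OF assms(2)])
next
  case (coord i)
  then show ?case by (rule bipoly.coord)
next
  case (add p q)
  then show ?case by (intro bipoly.add)
next
  case (mult p q)
  then show ?case by (intro bipoly.mult)
qed

lemma sum_matrix_mult:
  fixes b :: "nat \<Rightarrow> 'j \<Rightarrow> complex"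
  assumes "s = (\<Sum>k<N. c k * t k)" "\<And>k. k < N \<Longrightarrow> t k = (\<Sum>j\<in>J. b k j * u j)"
  shows "s = (\<Sum>j\<in>J. (\<Sum>k<N. c k * b k j) * u j)"
proof -
  have "s = (\<Sum>k<N. \<Sum>j\<in>J. c k * (b k j * u j))" using assms by (simp add: sum_distrib_left)
  also have "\<dots> = (\<Sum>j\<in>J. \<Sum>k<N. c k * (b k j * u j))" by (rule sum.swap)
  finally show ?thesis by (simp add: sum_distrib_right mult.assoc)
qed

context complex_variety
begin

lemma bipoly_subst:
  assumes "p \<in> bipoly N (reg S W)" "zopen W" "\<And>i. i < N \<Longrightarrow> v i \<in> reg S W"
  shows "(\<lambda>x. p x (\<lambda>i. v i x)) \<in> reg S W"
  using assms(1)
proof (induction rule: bipoly.induct)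
  case (add p q)
  then show ?case by (intro reg_add assms)
next
  case (mult p q)
  then show ?case by (intro reg_mult assms)
qed (use assms in auto)

lemma bipoly_bireg:
  assumes "p \<in> bipoly N (reg S W)" "zopen W"
  shows "(\<lambda>(x, u). p x u) \<in> bireg S (affine_space N) W (cvec N)"
proof -
  have A: "openin (ztop (affine_space N)) (cvec N)"
    using openin_topspace[of "ztop (affine_space N)"] unfolding points_affine_space .
  have one: "(\<lambda>_. 1) \<in> reg S W" "(\<lambda>_. 1) \<in> reg (affine_space N) (cvec N)"
    using reg_const[OF assms(2)] function_space_const[OF function_space_affine A] by auto
  show ?thesis using assms(1)
  proof (induction rule: bipoly.induct)
    case (base f)
    then show ?case using bireg_tensor[OF base one(2)] by simp
  next
    case (coord i)
    then show ?case using bireg_tensor[OF one(1) poly_fun_reg_affine[OF poly_fun.coord[OF coord] A]] by simp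
  next
    case (add p q)
    then show ?case using bireg_add[OF add.IH] by (simp add: case_prod_beta)
  next
    case (mult p q)
    then show ?case using bireg_mult[OF fs function_space_affine assms(2) A mult.IH] by (simp add: case_prod_beta)
  qed
qed

end

text \<open>\<open>\<theta>\<close> plays the part of the restrictions to \<open>S\<close> of the invariant 1-forms.\<close>

locale framed_variety = complex_variety S for S :: "'a fspace" +
  fixes n :: nat and \<theta> :: "nat \<Rightarrow> 'a \<Rightarrow> 'a tvec \<Rightarrow> complex" and d :: nat
  assumes \<theta>: "i < n \<Longrightarrow> \<theta> i \<in> sym_forms S 1 (points S)"
    and \<theta>_inj: "x \<in> points S \<Longrightarrow> D \<in> tangent_space S x \<Longrightarrow> (\<And>i. i < n \<Longrightarrow> \<theta> i x D = 0) \<Longrightarrow> D = (\<lambda>_. 0)"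
    and dim_tangent: "x \<in> points S \<Longrightarrow> fun_vs.dim (tangent_space S x) = d"
begin

definition w :: "'a \<Rightarrow> 'a tvec \<Rightarrow> nat \<Rightarrow> complex" where
  "w x D i = (if i < n then \<theta> i x D else 0)"

lemma w_cvec: "w x D \<in> cvec n"
  by (simp add: w_def cvec_def)

lemma joint_forms_tangent:
  assumes "x \<in> points S" "J \<subseteq> {..<n}"
    and "\<And>D. D \<in> T x \<Longrightarrow> (\<And>j. j \<in> J \<Longrightarrow> \<theta> j x D = 0) \<Longrightarrow> D = (\<lambda>_. 0)"
  shows "joint_forms (T x) J (\<lambda>j. \<theta> j x)"
proof
  show "finite J" using assms(2) finite_subset by blast
qed (use assms tangent_space_subspace one_form_add[OF \<theta>] one_form_scale[OF \<theta>] in \<open>auto simp: subset_iff\<close>)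

text \<open>Near \<open>x\<close> the differentials of the chart coordinates are regular
  combinations of the \<open>\<theta> j\<close> with \<open>j \<in> J\<close>, and every
  differential is a regular combination of those. A tangent vector killed by these
  \<open>\<theta> j\<close> therefore kills all functions.\<close>

lemma coframe_nearby:
  assumes x: "x \<in> points S" and J: "J \<subseteq> {..<n}"
    and inj: "\<forall>D\<in>T x. (\<forall>j\<in>J. \<theta> j x D = 0) \<longrightarrow> D = (\<lambda>_. 0)"
  shows "\<exists>W. zopen W \<and> x \<in> W \<and> (\<forall>y\<in>W. \<forall>D\<in>T y. (\<forall>j\<in>J. \<theta> j y D = 0) \<longrightarrow> D = (\<lambda>_. 0))"
    and "f \<in> reg_at S x \<Longrightarrow> \<exists>W c. zopen W \<and> x \<in> W \<and> (\<forall>j\<in>J. c j \<in> reg S W) \<and>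
      (\<forall>y\<in>W. \<forall>D\<in>T y. D f = (\<Sum>j\<in>J. c j y * \<theta> j y D))"
proof -
  obtain U N z where U: "x \<in> U" "rational_chart S U N z" using x by (rule chart_exists)
  have fJ: "finite J" using J finite_subset by blast
  obtain W B where W: "zopen W" "x \<in> W" "W \<subseteq> U" "\<forall>l<N. \<forall>j\<in>J. B l j \<in> reg S W"
    "\<forall>l<N. \<forall>y\<in>W. \<forall>D\<in>T y. D (\<lambda>y. z y l) = (\<Sum>j\<in>J. B l j y * \<theta> j y D)"
    by (rule local_coframe[where \<theta> = \<theta>, OF U(2,1) fJ \<theta>]) (use J inj in auto)
  have "D f = 0" if y: "y \<in> W" and D: "D \<in> T y" "\<forall>j\<in>J. \<theta> j y D = 0" for y D f
  proof (cases "f \<in> reg_at S y")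
    case True
    have yU: "y \<in> U" using y W by blast
    obtain V c where "zopen V" "y \<in> V" "V \<subseteq> U" "f \<in> reg S V" "\<forall>k<N. c k \<in> reg S V"
      "\<forall>y\<in>V. \<forall>D\<in>T y. D f = (\<Sum>k<N. c k y * D (\<lambda>y. z y k))"
      using U(2) yU True by (rule chart_differential)
    then have "D f = (\<Sum>k<N. c k y * D (\<lambda>y. z y k))" using D(1) by blast
    also have "\<dots> = 0" using W(5)[rule_format, of _ y D] y D by (intro sum.neutral) auto
    finally show ?thesis .
  qed (use tangent_outside[OF D(1)] in auto)
  then show "\<exists>W. zopen W \<and> x \<in> W \<and> (\<forall>y\<in>W. \<forall>D\<in>T y. (\<forall>j\<in>J. \<theta> j y D = 0) \<longrightarrow> D = (\<lambda>_. 0))"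
    using W(1,2) by (intro exI[of _ W]) blast
  assume f: "f \<in> reg_at S x"
  obtain V c where V: "zopen V" "x \<in> V" "V \<subseteq> U" "f \<in> reg S V" "\<forall>k<N. c k \<in> reg S V"
      "\<forall>y\<in>V. \<forall>D\<in>T y. D f = (\<Sum>k<N. c k y * D (\<lambda>y. z y k))"
    using U(2,1) f by (rule chart_differential)
  have o: "zopen (W \<inter> V)" using W V by auto
  have res: "c k \<in> reg S (W \<inter> V)" "j \<in> J \<Longrightarrow> B k j \<in> reg S (W \<inter> V)" if "k < N" for k j
    using reg_restrict[OF _ V(1) o] reg_restrict[OF _ W(1) o] V(5) W(4) that by auto
  have "D f = (\<Sum>j\<in>J. (\<Sum>k<N. c k y * B k j y) * \<theta> j y D)" if "y \<in> W \<inter> V" "D \<in> T y" for y D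
    by (rule sum_matrix_mult[where t = "\<lambda>k. D (\<lambda>y. z y k)"], use V(6) that in blast) (use W(5) that in blast)
  moreover have "\<forall>j\<in>J. (\<lambda>y. \<Sum>k<N. c k y * B k j y) \<in> reg S (W \<inter> V)"
    using res by (intro ballI reg_sum reg_mult o) auto
  ultimately show "\<exists>W c. zopen W \<and> x \<in> W \<and> (\<forall>j\<in>J. c j \<in> reg S W) \<and>
      (\<forall>y\<in>W. \<forall>D\<in>T y. D f = (\<Sum>j\<in>J. c j y * \<theta> j y D))"
    using o W V by (intro exI[of _ "W \<inter> V"] exI[of _ "\<lambda>j y. \<Sum>k<N. c k y * B k j y"]) blast
qed

text \<open>This is where smoothness enters. A basis \<open>J\<close> of the forms at
  \<open>x\<close> stays jointly injective nearby; as the dimension of the tangent spaces does not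
  jump, \<open>card J\<close> is still the right number and injectivity becomes bijectivity. The
  matrix \<open>Q\<close> then describes the image of the tangent bundle under all the forms by
  linear equations.\<close>

lemma local_frame:
  assumes x: "x \<in> points S"
  obtains W J Q where "zopen W" "x \<in> W" "J \<subseteq> {..<n}" "\<forall>i<n. \<forall>j\<in>J. Q i j \<in> reg S W"
    "\<forall>i<n. \<forall>y\<in>W. \<forall>D\<in>T y. \<theta> i y D = (\<Sum>j\<in>J. Q i j y * \<theta> j y D)"
    "\<forall>y\<in>W. \<forall>a. \<exists>D\<in>T y. \<forall>j\<in>J. \<theta> j y D = a j"
proof -
  interpret jf: joint_forms "T x" "{..<n}" "\<lambda>j. \<theta> j x"
    by (rule joint_forms_tangent[OF x order_refl]) (use \<theta>_inj[OF x] in auto)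
  obtain J e where J: "J \<subseteq> {..<n}" "card J = fun_vs.dim (T x)"
    and inj: "\<forall>D\<in>T x. (\<forall>j\<in>J. \<theta> j x D = 0) \<longrightarrow> D = (\<lambda>_. 0)"
    by (rule jf.dual_basis)
  obtain W0 where W0: "zopen W0" "x \<in> W0"
    "\<forall>y\<in>W0. \<forall>D\<in>T y. (\<forall>j\<in>J. \<theta> j y D = 0) \<longrightarrow> D = (\<lambda>_. 0)"
    using coframe_nearby(1)[OF x J(1) inj] by blast
  define R where "R \<alpha> W c \<longleftrightarrow> (\<forall>j\<in>J. c j \<in> reg S W) \<and>
      (\<forall>y\<in>W. \<forall>D\<in>T y. \<alpha> y D = (\<Sum>j\<in>J. c j y * \<theta> j y D))" for \<alpha> W c
  have anti: "R \<alpha> W' c" if R: "R \<alpha> W c" and W: "zopen W" "zopen W'" "W' \<subseteq> W" for \<alpha> W W' c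
    using R W(3) reg_restrict[OF _ W] unfolding R_def by auto
  have ex: "\<exists>W c. zopen W \<and> x \<in> W \<and> R (\<theta> i) W c" if i: "i \<in> {..<n}" for i
  proof -
    have "\<theta> i \<in> sym_forms S 1 (points S)" using \<theta> i by simp
    then obtain V K g f where V: "zopen V" "x \<in> V" "V \<subseteq> points S"
      and gf: "\<forall>k<K::nat. g k \<in> reg S V \<and> f k \<in> reg S V"
      and th: "\<forall>y\<in>V. \<forall>D\<in>T y. \<theta> i y D = (\<Sum>k<K. g k y * D (f k))"
      using x by (rule one_formE)
    have ex: "\<exists>W c. zopen W \<and> x \<in> W \<and> R (\<lambda>_ D. D (f k)) W c" if "k \<in> {..<K}" for k
      unfolding R_def by (rule coframe_nearby(2)[OF x J(1) inj reg_atI[OF V(1,2)]]) (use gf that in auto)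
    obtain W c where W: "zopen W" "x \<in> W" and c: "\<forall>k\<in>{..<K}. R (\<lambda>_ D. D (f k)) W (c k)"
      by (rule common_nbhd[where I = "{..<K}" and x = x and T = "ztop S" and R = "\<lambda>k. R (\<lambda>_ D. D (f k))", OF _ x ex])
         (use anti in blast)+
    have o: "zopen (W \<inter> V)" using W V by auto
    have res: "g k \<in> reg S (W \<inter> V)" "j \<in> J \<Longrightarrow> c k j \<in> reg S (W \<inter> V)" if "k < K" for k j
      using reg_restrict[OF _ V(1) o] reg_restrict[OF _ W(1) o] gf c that by (auto simp: R_def)
    have "\<theta> i y D = (\<Sum>j\<in>J. (\<Sum>k<K. g k y * c k j y) * \<theta> j y D)" if "y \<in> W \<inter> V" "D \<in> T y" for y D
      using th c that by (intro sum_matrix_mult[where t = "\<lambda>k. D (f k)"]) (auto simp: R_def)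
    moreover have "\<forall>j\<in>J. (\<lambda>y. \<Sum>k<K. g k y * c k j y) \<in> reg S (W \<inter> V)"
      using res by (intro ballI reg_sum reg_mult o) auto
    ultimately have "R (\<theta> i) (W \<inter> V) (\<lambda>j y. \<Sum>k<K. g k y * c k j y)" unfolding R_def by blast
    then show ?thesis using o W V by blast
  qed
  obtain W Q where W: "zopen W" "x \<in> W" and WQ: "\<forall>i\<in>{..<n}. R (\<theta> i) W (Q i)"
    by (rule common_nbhd[where I = "{..<n}" and x = x and T = "ztop S" and R = "\<lambda>i. R (\<theta> i)", OF _ x ex])
       (use anti in blast)+
  have o: "zopen (W \<inter> W0)" using W W0 by auto
  have Q: "(\<forall>j\<in>J. Q k j \<in> reg S (W \<inter> W0)) \<and>
      (\<forall>y\<in>W \<inter> W0. \<forall>D\<in>T y. \<theta> k y D = (\<Sum>j\<in>J. Q k j y * \<theta> j y D))" if "k < n" for k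
    unfolding R_def[symmetric] by (rule anti[OF _ W(1) o]) (use WQ that in auto)
  have surj: "\<exists>D\<in>T y. \<forall>j\<in>J. \<theta> j y D = a j" if y: "y \<in> W \<inter> W0" for y a
  proof -
    have yp: "y \<in> points S" using y openin_subset[OF W0(1)] by blast
    interpret jy: joint_forms "T y" J "\<lambda>j. \<theta> j y"
      by (rule joint_forms_tangent[OF yp J(1)]) (use W0(3) y in auto)
    show ?thesis by (rule jy.surjective) (use J(2) dim_tangent[OF x] dim_tangent[OF yp] in simp)
  qed
  show thesis using that[OF o _ J(1), of Q] Q surj W W0 by blast
qed

end

section \<open>The algebra of functions on the tangent bundle\<close>

context framed_variety
begin

text \<open>Regularity, along the fibre over \<open>x\<close>, of a function on the tangent bundle.
  The embedding \<open>w\<close> of the bundle in a trivial one replaces the choice of a local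
  frame; the price is that \<open>b\<close> is determined only on the image of
  \<open>w\<close>.\<close>

definition tangent_function :: "('a \<Rightarrow> 'a tvec \<Rightarrow> complex) \<Rightarrow> 'a \<Rightarrow> bool" where
  "tangent_function g x \<longleftrightarrow> (\<exists>W b. zopen W \<and> x \<in> W \<and> b \<in> bipoly n (reg S W) \<and>
     (\<forall>y\<in>W. \<forall>D\<in>T y. g y D = b y (w y D)))"

lemma tangent_functionE:
  assumes "tangent_function g x"
  obtains W b where "zopen W" "x \<in> W" "b \<in> bipoly n (reg S W)"
    "\<forall>y\<in>W. \<forall>D\<in>T y. g y D = b y (w y D)"
  using assms unfolding tangent_function_def by blast

lemma tangent_function_cong:
  assumes "tangent_function g x" "zopen V" "x \<in> V" "\<And>y D. y \<in> V \<Longrightarrow> D \<in> T y \<Longrightarrow> h y D = g y D"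
  shows "tangent_function h x"
proof -
  obtain W b where W: "zopen W" "x \<in> W" "b \<in> bipoly n (reg S W)" "\<forall>y\<in>W. \<forall>D\<in>T y. g y D = b y (w y D)"
    using assms(1) by (rule tangent_functionE)
  have o: "zopen (W \<inter> V)" using W assms by auto
  have "b \<in> bipoly n (reg S (W \<inter> V))"
    by (rule bipoly_mono[OF W(3) order_refl]) (use reg_restrict[OF _ W(1) o] in auto)
  then show ?thesis unfolding tangent_function_def using o W assms
    by - (rule exI[of _ "W \<inter> V"], rule exI[of _ b], auto)
qed

lemma tangent_function_common:
  assumes "tangent_function g x" "tangent_function h x"
  obtains W b c where "zopen W" "x \<in> W" "b \<in> bipoly n (reg S W)" "c \<in> bipoly n (reg S W)"
    "\<forall>y\<in>W. \<forall>D\<in>T y. g y D = b y (w y D)" "\<forall>y\<in>W. \<forall>D\<in>T y. h y D = c y (w y D)"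
proof -
  obtain W b where W: "zopen W" "x \<in> W" "b \<in> bipoly n (reg S W)" "\<forall>y\<in>W. \<forall>D\<in>T y. g y D = b y (w y D)"
    using assms(1) by (rule tangent_functionE)
  obtain V c where V: "zopen V" "x \<in> V" "c \<in> bipoly n (reg S V)" "\<forall>y\<in>V. \<forall>D\<in>T y. h y D = c y (w y D)"
    using assms(2) by (rule tangent_functionE)
  have o: "zopen (W \<inter> V)" "x \<in> W \<inter> V" using W V by auto
  have "b \<in> bipoly n (reg S (W \<inter> V))" "c \<in> bipoly n (reg S (W \<inter> V))"
    by (rule bipoly_mono[OF W(3) order_refl], use reg_restrict[OF _ W(1) o(1)] in auto)
       (rule bipoly_mono[OF V(3) order_refl], use reg_restrict[OF _ V(1) o(1)] in auto)
  then show thesis using that[OF o] W(4) V(4) by blast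
qed

lemma tangent_function_add_mult:
  assumes "tangent_function g x" "tangent_function h x"
  shows tangent_function_add: "tangent_function (\<lambda>y D. g y D + h y D) x"
    and tangent_function_mult: "tangent_function (\<lambda>y D. g y D * h y D) x"
proof -
  obtain W b c where W: "zopen W" "x \<in> W" "b \<in> bipoly n (reg S W)" "c \<in> bipoly n (reg S W)"
    "\<forall>y\<in>W. \<forall>D\<in>T y. g y D = b y (w y D)" "\<forall>y\<in>W. \<forall>D\<in>T y. h y D = c y (w y D)"
    using assms by (rule tangent_function_common)
  show "tangent_function (\<lambda>y D. g y D + h y D) x" unfolding tangent_function_def
    using W bipoly.add[OF W(3,4)] by - (rule exI[of _ W], rule exI[of _ "\<lambda>x u. b x u + c x u"], auto)
  show "tangent_function (\<lambda>y D. g y D * h y D) x" unfolding tangent_function_def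
    using W bipoly.mult[OF W(3,4)] by - (rule exI[of _ W], rule exI[of _ "\<lambda>x u. b x u * c x u"], auto)
qed

lemma tangent_function_reg:
  assumes "f \<in> reg_at S x"
  shows "tangent_function (\<lambda>y _. f y) x"
proof -
  obtain W where "zopen W" "x \<in> W" "f \<in> reg S W" using assms by (rule reg_atE)
  then show ?thesis unfolding tangent_function_def
    by - (rule exI[of _ W], rule exI[of _ "\<lambda>x u. f x"], auto intro: bipoly.base)
qed

lemma tangent_function_const: "x \<in> points S \<Longrightarrow> tangent_function (\<lambda>_ _. c) x"
  by (rule tangent_function_reg[OF reg_at_const])

lemma tangent_function_poly:
  assumes "p \<in> poly_fun n" "x \<in> points S"
  shows "tangent_function (\<lambda>y D. p (w y D)) x"
  unfolding tangent_function_def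
  by (rule exI[of _ "points S"], rule exI[of _ "\<lambda>x. p"])
     (use poly_fun_bipoly[OF assms(1), of "reg S (points S)"] reg_const assms in auto)

lemma tangent_function_sum:
  "x \<in> points S \<Longrightarrow> (\<And>i. i \<in> I \<Longrightarrow> tangent_function (g i) x) \<Longrightarrow> tangent_function (\<lambda>y D. \<Sum>i\<in>I. g i y D) x"
  by (induction I rule: infinite_finite_induct) (auto intro: tangent_function_add tangent_function_const)

lemma tangent_function_prod:
  "x \<in> points S \<Longrightarrow> (\<And>i. i \<in> I \<Longrightarrow> tangent_function (g i) x) \<Longrightarrow> tangent_function (\<lambda>y D. \<Prod>i\<in>I. g i y D) x"
  by (induction I rule: infinite_finite_induct) (auto intro: tangent_function_mult tangent_function_const)

lemma tangent_function_power:
  "x \<in> points S \<Longrightarrow> tangent_function g x \<Longrightarrow> tangent_function (\<lambda>y D. g y D ^ k) x"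
  by (induction k) (auto intro: tangent_function_mult tangent_function_const)

lemma tangent_function_theta:
  assumes "i < n" "x \<in> points S"
  shows "tangent_function (\<theta> i) x"
  by (rule tangent_function_cong[OF tangent_function_poly[OF poly_fun.coord[OF assms(1)] assms(2)] openin_topspace assms(2)])
     (use assms in \<open>auto simp: w_def\<close>)

lemma tangent_function_differential:
  assumes "f \<in> reg_at S x"
  shows "tangent_function (\<lambda>y D. D f) x"
proof -
  have x: "x \<in> points S" using assms by (rule reg_at_points)
  have "\<forall>D\<in>T x. (\<forall>j\<in>{..<n}. \<theta> j x D = 0) \<longrightarrow> D = (\<lambda>_. 0)" using \<theta>_inj[OF x] by blast
  from coframe_nearby(2)[OF x order_refl this assms]
  obtain W c where W: "zopen W" "x \<in> W" "\<forall>j\<in>{..<n}. c j \<in> reg S W"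
    "\<forall>y\<in>W. \<forall>D\<in>T y. D f = (\<Sum>j\<in>{..<n}. c j y * \<theta> j y D)" by (elim exE conjE)
  have "tangent_function (\<lambda>y D. \<Sum>j\<in>{..<n}. c j y * \<theta> j y D) x"
    by (intro tangent_function_sum tangent_function_mult tangent_function_reg tangent_function_theta x)
       (use W reg_atI[OF W(1,2)] in auto)
  then show ?thesis by (rule tangent_function_cong[OF _ W(1,2)]) (use W(4) in auto)
qed

lemma tangent_function_sym_form:
  assumes "s \<in> sym_forms S m U" "x \<in> U"
  shows "tangent_function s x"
proof -
  obtain V K g f where V: "zopen V" "x \<in> V" "V \<subseteq> U"
    "\<forall>k<K::nat. g k \<in> reg S V \<and> (\<forall>j<m. f k j \<in> reg S V)"
    "\<forall>y\<in>V. \<forall>D\<in>T y. s y D = (\<Sum>k<K. g k y * (\<Prod>j<m. D (f k j)))"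
    using assms by (rule sym_formsE)
  have x: "x \<in> points S" using V openin_subset by blast
  have "tangent_function (\<lambda>y D. \<Sum>k<K. g k y * (\<Prod>j<m. D (f k j))) x"
    by (intro tangent_function_sum tangent_function_mult tangent_function_prod tangent_function_reg
          tangent_function_differential x) (use V reg_atI[OF V(1,2)] in auto)
  then show ?thesis by (rule tangent_function_cong[OF _ V(1,2)]) (use V(5) in auto)
qed

lemma w_line:
  assumes "x \<in> points S" "D \<in> T x" "E \<in> T x"
  shows "(\<lambda>f. D f + s * (E f + (- 1) * D f)) \<in> T x"
    and "w x (\<lambda>f. D f + s * (E f + (- 1) * D f)) = (\<lambda>i. w x D i + s * (w x E i - w x D i))"
proof -
  have 1: "(\<lambda>f. (- 1) * D f) \<in> T x" by (rule tangent_scaleR[OF assms(2)])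
  have 2: "(\<lambda>f. E f + (- 1) * D f) \<in> T x" by (rule tangent_sum[OF assms(3) 1])
  have 3: "(\<lambda>f. s * (E f + (- 1) * D f)) \<in> T x" by (rule tangent_scaleR[OF 2])
  show "(\<lambda>f. D f + s * (E f + (- 1) * D f)) \<in> T x" by (rule tangent_sum[OF assms(2) 3])
  have "\<theta> i x (\<lambda>f. D f + s * (E f + (- 1) * D f)) = \<theta> i x D + s * (\<theta> i x E - \<theta> i x D)" if i: "i < n" for i
    using one_form_add[OF \<theta>[OF i] assms(1,2) 3] one_form_scale[OF \<theta>[OF i] assms(1) 2, of s]
      one_form_add[OF \<theta>[OF i] assms(1,3) 1] one_form_scale[OF \<theta>[OF i] assms(1,2), of "- 1"] by simp
  then show "w x (\<lambda>f. D f + s * (E f + (- 1) * D f)) = (\<lambda>i. w x D i + s * (w x E i - w x D i))"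
    by (auto simp: w_def fun_eq_iff)
qed

lemma w_scale:
  assumes "x \<in> points S" "D \<in> T x"
  shows "w x (\<lambda>f. c * D f) = (\<lambda>i. c * w x D i)"
  using one_form_scale[OF \<theta> assms] by (auto simp: w_def fun_eq_iff)

lemma w_eq_imp_eq:
  assumes "x \<in> points S" "D \<in> T x" "E \<in> T x" "w x D = w x E"
  shows "D = E"
proof -
  have 1: "(\<lambda>f. (- 1) * D f) \<in> T x" by (rule tangent_scaleR[OF assms(2)])
  have 2: "(\<lambda>f. E f + (- 1) * D f) \<in> T x" by (rule tangent_sum[OF assms(3) 1])
  have eq: "\<theta> i x D = \<theta> i x E" if "i < n" for i using fun_cong[OF assms(4), of i] that by (simp add: w_def)
  have "\<theta> i x (\<lambda>f. E f + (- 1) * D f) = 0" if i: "i < n" for i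
    using eq[OF i] one_form_add[OF \<theta>[OF i] assms(1,3) 1] one_form_scale[OF \<theta>[OF i] assms(1,2), of "- 1"] by simp
  then have "(\<lambda>f. E f + (- 1) * D f) = (\<lambda>_. 0)" by (rule \<theta>_inj[OF assms(1) 2])
  then show ?thesis by (auto simp: fun_eq_iff dest: fun_cong)
qed

text \<open>Extend \<open>D\<close> to a local vector field on which the \<open>\<theta> j\<close>
  with \<open>j \<in> J\<close> are constant. Along it \<open>g\<close> becomes a regular function
  on the base, non-zero at \<open>x\<close>.\<close>

lemma nonvanishing_open:
  assumes g: "tangent_function g x" and D: "D \<in> T x" "g x D \<noteq> 0"
  obtains V where "zopen V" "x \<in> V" "\<forall>y\<in>V. \<exists>E\<in>T y. g y E \<noteq> 0"
proof -
  obtain W b where W: "zopen W" "x \<in> W" "b \<in> bipoly n (reg S W)" "\<forall>y\<in>W. \<forall>D\<in>T y. g y D = b y (w y D)"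
    using g by (rule tangent_functionE)
  have x: "x \<in> points S" using W openin_subset by blast
  obtain W' J Q where W': "zopen W'" "x \<in> W'" "J \<subseteq> {..<n}" "\<forall>i<n. \<forall>j\<in>J. Q i j \<in> reg S W'"
    "\<forall>i<n. \<forall>y\<in>W'. \<forall>D\<in>T y. \<theta> i y D = (\<Sum>j\<in>J. Q i j y * \<theta> j y D)"
    "\<forall>y\<in>W'. \<forall>a. \<exists>D\<in>T y. \<forall>j\<in>J. \<theta> j y D = a j"
    using x by (rule local_frame)
  have o: "zopen (W \<inter> W')" using W W' by auto
  have b: "b \<in> bipoly n (reg S (W \<inter> W'))"
    by (rule bipoly_mono[OF W(3) order_refl]) (use reg_restrict[OF _ W(1) o] in auto)
  \<comment> \<open>The coordinates under \<open>w\<close> of that vector field; the number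
    \<open>\<theta> j x D\<close> stays fixed while \<open>Q i j\<close> varies with the
    point.\<close>
  define v where "v i y = (if i < n then (\<Sum>j\<in>J. Q i j y * \<theta> j x D) else 0)" for i y
  have v: "v i \<in> reg S (W \<inter> W')" if "i < n" for i
  proof -
    have "(\<lambda>y. \<Sum>j\<in>J. Q i j y * \<theta> j x D) \<in> reg S (W \<inter> W')"
      by (intro reg_sum reg_mult reg_const o) (use W'(4) that reg_restrict[OF _ W'(1) o] in auto)
    then show ?thesis using that by (simp add: v_def[abs_def])
  qed
  let ?V = "{y \<in> W \<inter> W'. b y (\<lambda>i. v i y) \<noteq> 0}"
  have wv: "w y E = (\<lambda>i. v i y)" if "y \<in> W'" "E \<in> T y" "\<forall>j\<in>J. \<theta> j y E = \<theta> j x D" for y E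
    using that W'(5) by (auto simp: w_def v_def fun_eq_iff)
  have "zopen ?V" by (rule openin_nonzero[OF o bipoly_subst[OF b o v]])
  moreover have "x \<in> ?V" using wv[OF W'(2) D(1)] W D W'(2) by auto
  moreover have "\<exists>E\<in>T y. g y E \<noteq> 0" if y: "y \<in> ?V" for y
  proof -
    have yW: "y \<in> W" "y \<in> W'" "b y (\<lambda>i. v i y) \<noteq> 0" using y by auto
    have "\<exists>E\<in>T y. \<forall>j\<in>J. \<theta> j y E = \<theta> j x D"
      using W'(6)[rule_format, OF yW(2), of "\<lambda>j. \<theta> j x D"] .
    then obtain E where E: "E \<in> T y" "\<forall>j\<in>J. \<theta> j y E = \<theta> j x D" by blast
    have "g y E = b y (w y E)" using W(4) yW E by blast
    then show ?thesis using wv[OF yW(2) E] yW(3) E(1) by (intro bexI[of _ E]) auto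
  qed
  ultimately show thesis using that by blast
qed

text \<open>This is the irreducibility of the tangent bundle, deduced from that of \<open>S\<close> by means of local vector
  fields.\<close>

lemma common_nonzero:
  assumes g: "\<And>x. x \<in> points S \<Longrightarrow> tangent_function g x" and h: "\<And>x. x \<in> points S \<Longrightarrow> tangent_function h x"
    and "x0 \<in> points S" "D0 \<in> T x0" "g x0 D0 \<noteq> 0" "x1 \<in> points S" "D1 \<in> T x1" "h x1 D1 \<noteq> 0"
  obtains x D where "x \<in> points S" "D \<in> T x" "g x D \<noteq> 0" "h x D \<noteq> 0"
proof -
  obtain V0 where V0: "zopen V0" "x0 \<in> V0" "\<forall>y\<in>V0. \<exists>E\<in>T y. g y E \<noteq> 0"
    by (rule nonvanishing_open[where g = g and x = x0 and D = D0, OF g[OF assms(3)] assms(4,5)])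
  obtain V1 where V1: "zopen V1" "x1 \<in> V1" "\<forall>y\<in>V1. \<exists>E\<in>T y. h y E \<noteq> 0"
    by (rule nonvanishing_open[where g = h and x = x1 and D = D1, OF h[OF assms(6)] assms(7,8)])
  \<comment> \<open>Irreducibility of the base gives a common point \<open>x\<close>; within the
    vector space \<open>T x\<close> the line through \<open>E\<close> and \<open>F\<close> then
    gives a common vector.\<close>
  have "V0 \<inter> V1 \<noteq> {}" using opens_meet[OF V0(1) V1(1)] V0(2) V1(2) by blast
  then obtain x where xV: "x \<in> V0" "x \<in> V1" by blast
  then have x: "x \<in> points S" using openin_subset[OF V0(1)] by blast
  obtain E F where E: "E \<in> T x" "g x E \<noteq> 0" and F: "F \<in> T x" "h x F \<noteq> 0" using V0(3) V1(3) xV by blast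
  obtain W b c where W: "zopen W" "x \<in> W" "b \<in> bipoly n (reg S W)" "c \<in> bipoly n (reg S W)"
    "\<forall>y\<in>W. \<forall>D\<in>T y. g y D = b y (w y D)" "\<forall>y\<in>W. \<forall>D\<in>T y. h y D = c y (w y D)"
    using g[OF x] h[OF x] by (rule tangent_function_common)
  have "b x (w x E) \<noteq> 0" "c x (w x F) \<noteq> 0" using W E F by auto
  then obtain s where s: "b x (\<lambda>i. w x E i + s * (w x F i - w x E i)) \<noteq> 0"
      "c x (\<lambda>i. w x E i + s * (w x F i - w x E i)) \<noteq> 0"
    by (rule poly_fun_common_nonzero_on_line[OF bipoly_slice[OF W(3)] bipoly_slice[OF W(4)]])
  let ?D = "\<lambda>f. E f + s * (F f + (- 1) * E f)"
  have D: "?D \<in> T x" by (rule w_line(1)[OF x E(1) F(1)])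
  have "g x ?D = b x (w x ?D)" "h x ?D = c x (w x ?D)" using W(2,5,6) D by blast+
  then show thesis using that[OF x D] s unfolding w_line(2)[OF x E(1) F(1)] by auto
qed

text \<open>Up to the embedding \<open>w\<close> this is the graph of \<open>1 / g\<close> over the
  part of the tangent bundle where \<open>g\<close> does not vanish. It is closed because it has
  local equations: the linear ones of the tangent bundle, and the one that makes the last coordinate
  an inverse of \<open>g\<close>.\<close>

lemma closed_incidence:
  assumes g: "\<And>x. x \<in> points S \<Longrightarrow> tangent_function g x"
  shows "closedin (ztop (product S (affine_space (Suc n))))
    {(x, u). x \<in> points S \<and> u \<in> cvec (Suc n) \<and> (\<exists>D\<in>T x. (\<forall>i<n. u i = \<theta> i x D) \<and> g x D * u n = 1)}"
    (is "closedin (ztop ?P) ?G")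
proof -
  let ?A = "affine_space (Suc n)"
  have A: "openin (ztop ?A) (cvec (Suc n))"
    using openin_topspace[of "ztop ?A"] unfolding points_affine_space .
  have pts: "points ?P = points S \<times> cvec (Suc n)" by (simp add: points_product fs function_space_affine)
  have "openin (ztop ?P) (points ?P - ?G)"
  proof (subst openin_subopen, intro ballI)
    fix z assume z: "z \<in> points ?P - ?G"
    obtain x0 u0 where z0: "z = (x0, u0)" by (cases z)
    then have x0: "x0 \<in> points S" and u0: "u0 \<in> cvec (Suc n)" using z pts by auto
    obtain W' J Q where W': "zopen W'" "x0 \<in> W'" "J \<subseteq> {..<n}" "\<forall>i<n. \<forall>j\<in>J. Q i j \<in> reg S W'"
      "\<forall>i<n. \<forall>y\<in>W'. \<forall>D\<in>T y. \<theta> i y D = (\<Sum>j\<in>J. Q i j y * \<theta> j y D)"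
      "\<forall>y\<in>W'. \<forall>a. \<exists>D\<in>T y. \<forall>j\<in>J. \<theta> j y D = a j"
      using x0 by (rule local_frame)
    obtain W b where W: "zopen W" "x0 \<in> W" "b \<in> bipoly n (reg S W)" "\<forall>y\<in>W. \<forall>D\<in>T y. g y D = b y (w y D)"
      using g[OF x0] by (rule tangent_functionE)
    have o: "zopen (W \<inter> W')" using W W' by auto
    have b: "b \<in> bipoly (Suc n) (reg S (W \<inter> W'))"
      by (rule bipoly_mono[OF W(3)]) (use reg_restrict[OF _ W(1) o] in auto)
    \<comment> \<open>For \<open>i < n\<close> the equation says that the coordinate
      \<open>u i\<close> depends on those in \<open>J\<close> as for a tangent vector; the index
      \<open>n\<close> stands for the remaining equation \<open>b x u * u n = 1\<close>.\<close>
    define e where "e i x u = (if i < n then u i + (\<Sum>j\<in>J. (- Q i j x) * u j) else b x u * u n + (- 1))" for i x u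
    have e: "e i \<in> bipoly (Suc n) (reg S (W \<inter> W'))" for i
    proof (cases "i < n")
      case True
      have neg: "(\<lambda>x. - Q i j x) \<in> reg S (W \<inter> W')" if "j \<in> J" for j
        using reg_diff[OF o reg_const[OF o, of 0]] reg_restrict[OF _ W'(1) o] W'(4) True that by fastforce
      have "(\<lambda>x u. u i + (\<Sum>j\<in>J. (- Q i j x) * u j)) \<in> bipoly (Suc n) (reg S (W \<inter> W'))"
        by (intro bipoly.add bipoly.coord bipoly_sum bipoly.mult bipoly.base neg reg_const o)
           (use True W'(3) in auto)
      then show ?thesis using True by (simp add: e_def[abs_def])
    next
      case False
      have "(\<lambda>x u. b x u * u n + (- 1)) \<in> bipoly (Suc n) (reg S (W \<inter> W'))"
        by (intro bipoly.add bipoly.coord bipoly.mult bipoly.base b reg_const o) auto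
      then show ?thesis using False by (simp add: e_def[abs_def])
    qed
    have bw: "b x u = g x D" if "x \<in> W" "D \<in> T x" "\<forall>i<n. u i = \<theta> i x D" for x u D
    proof -
      have "b x u = b x (w x D)"
        by (rule poly_fun_local[OF bipoly_slice[OF W(3)]]) (use that in \<open>auto simp: w_def\<close>)
      then show ?thesis using W(4) that by auto
    qed
    have vanish: "e i x u = 0" if G: "(x, u) \<in> ?G" and x: "x \<in> W \<inter> W'" and i: "i \<le> n" for i x u
    proof -
      obtain D where D: "D \<in> T x" "\<forall>i<n. u i = \<theta> i x D" "g x D * u n = 1" using G by auto
      show ?thesis
      proof (cases "i < n")
        case True
        have "(\<Sum>j\<in>J. (- Q i j x) * u j) = - (\<Sum>j\<in>J. Q i j x * \<theta> j x D)"
          unfolding sum_negf[symmetric] by (rule sum.cong) (use D(2) W'(3) in auto)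
        moreover have "\<theta> i x D = (\<Sum>j\<in>J. Q i j x * \<theta> j x D)" using W'(5) True x D(1) by blast
        ultimately show ?thesis using True D(2) by (simp add: e_def)
      next
        case False
        then show ?thesis using bw[OF _ D(1,2)] x D(3) by (simp add: e_def)
      qed
    qed
    have "\<exists>i\<le>n. e i x0 u0 \<noteq> 0"
    proof (rule ccontr)
      assume "\<not> ?thesis"
      then have e0: "e i x0 u0 = 0" if "i \<le> n" for i using that by auto
      \<comment> \<open>If all equations hold at \<open>(x0, u0)\<close>, the tangent vector with
        the prescribed coordinates in \<open>J\<close> shows that the point belongs to the set after
        all.\<close>
      have "\<exists>D\<in>T x0. \<forall>j\<in>J. \<theta> j x0 D = u0 j" using W'(6)[rule_format, OF W'(2), of u0] .
      then obtain D where D: "D \<in> T x0" "\<forall>j\<in>J. \<theta> j x0 D = u0 j" by blast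
      have eq: "u0 i = \<theta> i x0 D" if i: "i < n" for i
      proof -
        have "\<theta> i x0 D = (\<Sum>j\<in>J. Q i j x0 * \<theta> j x0 D)" using W'(5) i W'(2) D(1) by blast
        also have "\<dots> = (\<Sum>j\<in>J. Q i j x0 * u0 j)" using D(2) by simp
        finally show ?thesis using e0[of i] i by (simp add: e_def sum_negf)
      qed
      have "g x0 D * u0 n = 1" using e0[of n] bw[OF W(2) D(1)] eq by (simp add: e_def)
      then show False using z z0 x0 u0 D(1) eq by auto
    qed
    then obtain i where i: "i \<le> n" "e i x0 u0 \<noteq> 0" by blast
    let ?O = "{z \<in> (W \<inter> W') \<times> cvec (Suc n). (\<lambda>(x, u). e i x u) z \<noteq> 0}"
    have "openin (ztop ?P) ?O" by (rule openin_product_nonzero[OF o A bipoly_bireg[OF e o]])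
    moreover have "z \<in> ?O" using z0 W W' u0 i by auto
    moreover have "?O \<subseteq> points ?P - ?G"
      using vanish[OF _ _ i(1)] openin_subset[OF o] unfolding pts by auto
    ultimately show "\<exists>T. openin (ztop ?P) T \<and> z \<in> T \<and> T \<subseteq> points ?P - ?G" by blast
  qed
  then show ?thesis unfolding closedin_def pts by auto
qed

end

text \<open>Completeness enters through a single test space: \<open>n\<close> coordinates for
  \<open>w\<close> and one more for the inverse of a function \<open>g\<close>.\<close>

locale complete_framed_variety = framed_variety +
  assumes closed_snd: "closed_map (ztop (product S (affine_space (Suc n)))) (ztop (affine_space (Suc n))) snd"
begin

text \<open>A closed set in \<open>\<complex>\<^sup>n \<times> \<complex>\<close> made up of the points \<open>(w D, 1 / g D)\<close> avoids the origin, and a polynomial that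
  vanishes on it but not at the origin is an equation of integral dependence for \<open>g\<close>.\<close>

lemma integral_relation:
  assumes g: "\<And>x. x \<in> points S \<Longrightarrow> tangent_function g x"
    and hom: "\<And>x D s. x \<in> points S \<Longrightarrow> D \<in> T x \<Longrightarrow> g x (\<lambda>f. s * D f) = s ^ e * g x D"
  obtains J c where "\<forall>j. c j \<in> homogeneous n (e * j)" "\<forall>v. c 0 v \<noteq> 0"
    "\<forall>x\<in>points S. \<forall>D\<in>T x. g x D \<noteq> 0 \<longrightarrow> (\<Sum>j\<le>J. c j (w x D) * (1 / g x D) ^ j) = 0"
proof -
  let ?A = "affine_space (Suc n)"
  let ?G = "{(x, u). x \<in> points S \<and> u \<in> cvec (Suc n) \<and> (\<exists>D\<in>T x. (\<forall>i<n. u i = \<theta> i x D) \<and> g x D * u n = 1)}"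
  have cl: "closedin (ztop ?A) (snd ` ?G)"
    using closed_snd closed_incidence[OF g] unfolding closed_map_def by blast
  have o: "openin (ztop ?A) (cvec (Suc n) - snd ` ?G)" using openin_diff[OF openin_topspace cl] by simp
  \<comment> \<open>The last coordinate of a point of the projection is an inverse of a value of
    \<open>g\<close>, so it is not 0.\<close>
  have "(\<lambda>_. 0) \<in> cvec (Suc n) - snd ` ?G" using zero_in_cvec by auto
  then obtain h where h: "h \<in> poly_fun (Suc n)" "h (\<lambda>_. 0) \<noteq> 0" "{v \<in> cvec (Suc n). h v \<noteq> 0} \<subseteq> cvec (Suc n) - snd ` ?G"
    by (rule affine_open_basis[OF o])
  have hG: "h u = 0" if "u \<in> snd ` ?G" for u using h(3) that by force
  show thesis
  proof (rule invariant_part[OF h(1,2), of e])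
    fix c J
    assume c: "\<And>j. c j \<in> homogeneous n (e * j)" "\<And>v. c 0 v \<noteq> 0"
      "\<And>u t. (\<And>s. s \<noteq> 0 \<Longrightarrow> h (\<lambda>i. if i < n then s * u i else if i = n then t / s ^ e else 0) = 0) \<Longrightarrow>
         (\<Sum>j\<le>J. c j u * t ^ j) = 0"
    have "(\<Sum>j\<le>J. c j (w x D) * (1 / g x D) ^ j) = 0" if x: "x \<in> points S" and D: "D \<in> T x" and nz: "g x D \<noteq> 0" for x D
    proof (rule c(3))
      fix s :: complex assume s: "s \<noteq> 0"
      \<comment> \<open>This point comes from the tangent vector \<open>s * D\<close>: the degree
        \<open>e\<close> of \<open>g\<close> is matched by the weight \<open>e\<close> of the last
        coordinate.\<close>
      let ?u = "\<lambda>i. if i < n then s * w x D i else if i = n then 1 / g x D / s ^ e else 0"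
      have "(x, ?u) \<in> ?G"
        using x s nz tangent_scaleR[OF D, of s] hom[OF x D, of s] one_form_scale[OF \<theta> x D, of _ s]
        by (auto simp: cvec_def w_def intro!: bexI[of _ "\<lambda>f. s * D f"])
      then have "?u \<in> snd ` ?G" by (metis (no_types, lifting) image_eqI snd_conv)
      then show "h ?u = 0" by (rule hG)
    qed
    then show thesis using that[of c J] c(1,2) by blast
    qed
qed

text \<open>\<open>c\<close> plays the part of the norm of \<open>g\<close>: it is the last
  coefficient of the integral equation that is not identically zero on the tangent bundle. The
  equation truncated there still holds, and where \<open>g\<close> vanishes it reduces to its
  constant term, so \<open>c\<close> vanishes there too.\<close>

lemma norm_polynomial:
  assumes g: "\<And>x. x \<in> points S \<Longrightarrow> tangent_function g x"
    and hom: "\<And>x D s. x \<in> points S \<Longrightarrow> D \<in> T x \<Longrightarrow> g x (\<lambda>f. s * D f) = s ^ e * g x D"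
    and nz: "x0 \<in> points S" "D0 \<in> T x0" "g x0 D0 \<noteq> 0"
  obtains j c x D where "j > 0" "c \<in> homogeneous n (e * j)" "x \<in> points S" "D \<in> T x" "c (w x D) \<noteq> 0"
    "\<And>x D. x \<in> points S \<Longrightarrow> D \<in> T x \<Longrightarrow> c (w x D) \<noteq> 0 \<Longrightarrow> g x D \<noteq> 0"
proof -
  obtain J c where "\<forall>j. c j \<in> homogeneous n (e * j)" "\<forall>v. c 0 v \<noteq> 0"
    "\<forall>x\<in>points S. \<forall>D\<in>T x. g x D \<noteq> 0 \<longrightarrow> (\<Sum>j\<le>J. c j (w x D) * (1 / g x D) ^ j) = 0"
    by (rule integral_relation[OF g hom])
  then have c: "\<And>j. c j \<in> homogeneous n (e * j)" "\<And>v. c 0 v \<noteq> 0"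
    and rel: "\<And>x D. x \<in> points S \<Longrightarrow> D \<in> T x \<Longrightarrow> g x D \<noteq> 0 \<Longrightarrow> (\<Sum>j\<le>J. c j (w x D) * (1 / g x D) ^ j) = 0"
    by blast+
  define nv where "nv j \<longleftrightarrow> j \<le> J \<and> (\<exists>x\<in>points S. \<exists>D\<in>T x. c j (w x D) \<noteq> 0)" for j
  have "nv 0" using c(2) nz by (auto simp: nv_def)
  define k where "k = Max {j. nv j}"
  have fin: "finite {j. nv j}" by (rule finite_subset[of _ "{..J}"]) (auto simp: nv_def)
  have k: "nv k" using Max_in[OF fin] \<open>nv 0\<close> by (auto simp: k_def)
  have above: "c j (w x D) = 0" if "j > k" "j \<le> J" "x \<in> points S" "D \<in> T x" for j x D
  proof (rule ccontr)
    assume "c j (w x D) \<noteq> 0"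
    then have "nv j" using that by (auto simp: nv_def)
    then show False using Max_ge[OF fin, of j] that(1) by (simp add: k_def)
  qed
  \<comment> \<open>The relation multiplied by \<open>g ^ k\<close>, hence meaningful also where
    \<open>g\<close> vanishes. It holds where \<open>g\<close> does not vanish, so \<open>g\<close>
    and \<open>H\<close> have no common non-zero, and \<open>common_nonzero\<close> forces
    \<open>H = 0\<close>.\<close>
  define H where "H x D = (\<Sum>j\<le>k. c j (w x D) * g x D ^ (k - j))" for x D
  have H: "tangent_function H x" if "x \<in> points S" for x
    unfolding H_def[abs_def]
    by (intro tangent_function_sum tangent_function_mult tangent_function_power tangent_function_poly
          homogeneous_poly_fun[OF c(1)] g that)
  have gH: "H x D = 0" if x: "x \<in> points S" and D: "D \<in> T x" and gn: "g x D \<noteq> 0" for x D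
  proof -
    have "H x D = (\<Sum>j\<le>k. g x D ^ k * (c j (w x D) * (1 / g x D) ^ j))"
      unfolding H_def using gn by (intro sum.cong) (auto simp: power_diff field_simps)
    also have "\<dots> = g x D ^ k * (\<Sum>j\<le>k. c j (w x D) * (1 / g x D) ^ j)" by (simp add: sum_distrib_left)
    also have "(\<Sum>j\<le>k. c j (w x D) * (1 / g x D) ^ j) = (\<Sum>j\<le>J. c j (w x D) * (1 / g x D) ^ j)"
      by (rule sum.mono_neutral_left) (use k above x D in \<open>auto simp: nv_def\<close>)
    finally show ?thesis using rel[OF x D gn] by simp
  qed
  have H0: "H x D = 0" if x: "x \<in> points S" and D: "D \<in> T x" for x D
  proof (rule ccontr)
    assume Hn: "H x D \<noteq> 0"
    obtain y E where "y \<in> points S" "E \<in> T y" "g y E \<noteq> 0" "H y E \<noteq> 0"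
      by (rule common_nonzero[where g = g and h = H and ?x0.0 = x0 and ?D0.0 = D0 and ?x1.0 = x and ?D1.0 = D,
            OF g H nz x D Hn])
    then show False using gH by blast
  qed
  \<comment> \<open>For \<open>k = 0\<close> the function \<open>H\<close> would be
    \<open>c 0\<close>, which has no zeros.\<close>
  have "k > 0"
  proof (rule ccontr)
    assume "\<not> k > 0"
    then show False using H0[OF nz(1,2)] c(2) by (simp add: H_def)
  qed
  moreover obtain x D where "x \<in> points S" "D \<in> T x" "c k (w x D) \<noteq> 0" using k by (auto simp: nv_def)
  moreover have "g x D \<noteq> 0" if x: "x \<in> points S" and D: "D \<in> T x" and ck: "c k (w x D) \<noteq> 0" for x D
  proof
    assume g0: "g x D = 0"
    \<comment> \<open>At a zero of \<open>g\<close> only the term with exponent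
      \<open>k - j = 0\<close> survives.\<close>
    have "H x D = (\<Sum>j\<le>k. if j = k then c k (w x D) else 0)"
      unfolding H_def by (rule sum.cong) (auto simp: g0 power_0_left)
    then show False using H0[OF x D] ck by simp
  qed
  ultimately show thesis using that[of k "c k"] c(1) by blast
qed

text \<open>Once \<open>v\<close> is fixed, the coefficients of the integral relation are numbers,
  and the inverses of the non-zero values of \<open>g\<close> are roots of one polynomial. It is not
  the zero polynomial because \<open>c 0\<close> has no zeros.\<close>

lemma finitely_many_values:
  assumes g: "\<And>x. x \<in> points S \<Longrightarrow> tangent_function g x"
    and hom: "\<And>x D s. x \<in> points S \<Longrightarrow> D \<in> T x \<Longrightarrow> g x (\<lambda>f. s * D f) = s ^ e * g x D"
  shows "finite {g x D | x D. x \<in> points S \<and> D \<in> T x \<and> w x D = v}"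
proof -
  obtain J c where "\<forall>j. c j \<in> homogeneous n (e * j)" "\<forall>v. c 0 v \<noteq> 0"
    "\<forall>x\<in>points S. \<forall>D\<in>T x. g x D \<noteq> 0 \<longrightarrow> (\<Sum>j\<le>J. c j (w x D) * (1 / g x D) ^ j) = 0"
    by (rule integral_relation[OF g hom])
  then have c: "\<And>j. c j \<in> homogeneous n (e * j)" "\<And>v. c 0 v \<noteq> 0"
    and rel: "\<And>x D. x \<in> points S \<Longrightarrow> D \<in> T x \<Longrightarrow> g x D \<noteq> 0 \<Longrightarrow> (\<Sum>j\<le>J. c j (w x D) * (1 / g x D) ^ j) = 0"
    by blast+
  define P where "P = (\<Sum>j\<le>J. monom (c j v) j)"
  have "coeff P 0 = c 0 v" by (simp add: P_def coeff_sum)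
  then have "P \<noteq> 0" using c(2) by auto
  then have "finite {t. poly P t = 0}" by (rule poly_roots_finite)
  then have "finite (insert 0 ((\<lambda>t. 1 / t) ` {t. poly P t = 0}))" by simp
  moreover have "{g x D | x D. x \<in> points S \<and> D \<in> T x \<and> w x D = v} \<subseteq> insert 0 ((\<lambda>t. 1 / t) ` {t. poly P t = 0})"
  proof (clarsimp)
    fix x D assume x: "x \<in> points S" and D: "D \<in> T x" and v: "v = w x D"
      and no: "g x D \<notin> (\<lambda>t. 1 / t) ` {t. poly P t = 0}"
    show "g x D = 0"
    proof (rule ccontr)
      assume gn: "g x D \<noteq> 0"
      have "poly P (1 / g x D) = 0" using rel[OF x D gn] by (simp add: P_def poly_sum poly_monom v)
      then show False using no gn by (auto simp: image_iff)
    qed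
  qed
  ultimately show ?thesis by (rule rev_finite_subset)
qed

end

section \<open>Subvarieties of complete varieties\<close>

text \<open>A basic open set of the product involves finitely many regular functions on the
  subspace, and near \<open>x\<close> each of them is the restriction of a regular function on
  \<open>A\<close>. So the open sets of the product with the subspace are traces of open sets of
  \<open>product A Y\<close>.\<close>

lemma product_open_extends:
  assumes A: "function_space A" and Y: "function_space Y"
    and B: "openin (ztop (product (induced A X) Y)) B" "(x, u) \<in> B"
  obtains O' where "openin (ztop (product A Y)) O'" "(x, u) \<in> O'" "O' \<inter> (X \<times> UNIV) \<subseteq> B"
proof -
  let ?S = "induced A X"
  have "generate_topology_on {{z \<in> U \<times> V. h z \<noteq> 0} | U V h.
        openin (ztop ?S) U \<and> openin (ztop Y) V \<and> h \<in> bireg ?S Y U V} B"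
    using B(1) unfolding ztop_product product_top_def openin_topology_generated_by_iff .
  then have "\<forall>z\<in>B. \<exists>O'. openin (ztop (product A Y)) O' \<and> z \<in> O' \<and> O' \<inter> (X \<times> UNIV) \<subseteq> B"
  proof (induction rule: generate_topology_on.induct)
    case Empty
    show ?case by simp
  next
    case (Int a b)
    show ?case
    proof
      fix z assume "z \<in> a \<inter> b"
      then have z: "z \<in> a" "z \<in> b" by auto
      obtain P where "openin (ztop (product A Y)) P" "z \<in> P" "P \<inter> (X \<times> UNIV) \<subseteq> a"
        using bspec[OF Int.IH(1) z(1)] by auto
      moreover obtain Q where "openin (ztop (product A Y)) Q" "z \<in> Q" "Q \<inter> (X \<times> UNIV) \<subseteq> b"
        using bspec[OF Int.IH(2) z(2)] by auto
      ultimately show "\<exists>O'. openin (ztop (product A Y)) O' \<and> z \<in> O' \<and> O' \<inter> (X \<times> UNIV) \<subseteq> a \<inter> b"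
        by (intro exI[of _ "P \<inter> Q"]) auto
    qed
  next
    case (UN K)
    show ?case
    proof
      fix z assume "z \<in> \<Union>K"
      then obtain k where k: "k \<in> K" "z \<in> k" by blast
      from bspec[OF UN.IH[OF k(1)] k(2)]
      obtain O' where "openin (ztop (product A Y)) O'" "z \<in> O'" "O' \<inter> (X \<times> UNIV) \<subseteq> k" by auto
      then show "\<exists>O'. openin (ztop (product A Y)) O' \<and> z \<in> O' \<and> O' \<inter> (X \<times> UNIV) \<subseteq> \<Union>K"
        using k(1) by (intro exI[of _ O']) auto
    qed
  next
    case (Basis s)
    then obtain U V h where s: "s = {z \<in> U \<times> V. h z \<noteq> 0}" and U: "openin (ztop ?S) U"
      and V: "openin (ztop Y) V" and h: "h \<in> bireg ?S Y U V" by blast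
    obtain K f g where fg: "\<forall>k<K::nat. f k \<in> reg ?S U \<and> g k \<in> reg Y V" "h = (\<lambda>(x, y). \<Sum>k<K. f k x * g k y)"
      using h unfolding bireg_def by blast
    obtain UA where UA: "openin (ztop A) UA" "U = UA \<inter> X" using U by (auto simp: openin_subtopology)
    show ?case
    proof
      fix z assume "z \<in> s"
      then obtain x u where z: "z = (x, u)" "x \<in> U" "u \<in> V" "h (x, u) \<noteq> 0" using s by auto
      have xA: "x \<in> points A" using z UA openin_subset[OF UA(1)] by blast
      define R where "R k W F \<longleftrightarrow> F \<in> reg A W \<and> (\<forall>y\<in>U \<inter> W. f k y = F y)" for k W F
      have ex: "\<exists>W F. openin (ztop A) W \<and> x \<in> W \<and> R k W F" if "k \<in> {..<K}" for k
      proof -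
        have "f k \<in> reg ?S U" using fg that by auto
        from bspec[OF this[unfolded reg_induced] z(2)] show ?thesis unfolding R_def by auto
      qed
      have anti: "R k W' F" if R: "R k W F" and W: "openin (ztop A) W" "openin (ztop A) W'" "W' \<subseteq> W" for k W W' F
        using R function_space_restrict[OF A W] W(3) unfolding R_def by blast
      obtain W F where W: "openin (ztop A) W" "x \<in> W" and WF: "\<forall>k\<in>{..<K}. R k W (F k)"
        by (rule common_nbhd[where I = "{..<K}" and x = x and T = "ztop A" and R = R, OF _ xA ex])
           (use anti in blast)+
      have o: "openin (ztop A) (W \<inter> UA)" using W UA by auto
      have F: "F k \<in> reg A (W \<inter> UA) \<and> (\<forall>y\<in>U \<inter> W. f k y = F k y)" if "k < K" for k
        using WF that function_space_restrict[OF A W(1) o] unfolding R_def by blast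
      define H where "H = (\<lambda>(x, y). \<Sum>k<K. F k x * g k y)"
      have H: "H \<in> bireg A Y (W \<inter> UA) V" unfolding H_def
        by (rule bireg_finite_sum) (use F fg in auto)
      have eq: "H (y, t) = h (y, t)" if "y \<in> U" "y \<in> W" for y t
        unfolding H_def fg(2) prod.case by (rule sum.cong) (use F that in auto)
      show "\<exists>O'. openin (ztop (product A Y)) O' \<and> z \<in> O' \<and> O' \<inter> (X \<times> UNIV) \<subseteq> s"
        using openin_product_nonzero[OF o V H] z W eq UA(2) unfolding s
        by (intro exI[of _ "{z \<in> (W \<inter> UA) \<times> V. H z \<noteq> 0}"]) auto
    qed
  qed
  from bspec[OF this B(2)] show thesis using that by auto
qed

text \<open>A closed subset of \<open>X \<times> Y\<close> remains closed in
  \<open>A \<times> Y\<close>: off \<open>X\<close> because \<open>X\<close> is closed, over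
  \<open>X\<close> by \<open>product_open_extends\<close>. Its projection is then closed by
  completeness of \<open>A\<close>.\<close>

lemma closed_map_snd_induced:
  fixes Y :: "(nat \<Rightarrow> complex) fspace"
  assumes A: "complete_variety A" and X: "closedin (ztop A) X" and S: "function_space (induced A X)"
    and Y: "variety Y"
  shows "closed_map (ztop (product (induced A X) Y)) (ztop Y) snd"
  unfolding closed_map_def
proof (intro allI impI)
  fix C assume C: "closedin (ztop (product (induced A X) Y)) C"
  have fA: "function_space A" and fY: "function_space Y"
    using A Y by (auto simp: complete_variety_def variety_def)
  have XA: "X \<subseteq> points A" using closedin_subset[OF X] .
  have ptsS: "points (product (induced A X) Y) = X \<times> points Y"
    using XA by (auto simp: points_product[OF S fY])
  have ptsA: "points (product A Y) = points A \<times> points Y" by (rule points_product[OF fA fY])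
  have CX: "C \<subseteq> X \<times> points Y" using closedin_subset[OF C] unfolding ptsS .
  have "openin (ztop (product A Y)) (points (product A Y) - C)"
  proof (subst openin_subopen, intro ballI)
    fix z assume z: "z \<in> points (product A Y) - C"
    obtain x u where xu: "z = (x, u)" "x \<in> points A" "u \<in> points Y" using z unfolding ptsA by (cases z) auto
    show "\<exists>T. openin (ztop (product A Y)) T \<and> z \<in> T \<and> T \<subseteq> points (product A Y) - C"
    proof (cases "x \<in> X")
      case False
      have "openin (ztop (product A Y)) ((points A - X) \<times> points Y)"
        by (rule openin_product_Times[OF fA fY]) (use X in auto)
      then show ?thesis using CX xu False unfolding ptsA by (intro exI[of _ "(points A - X) \<times> points Y"]) auto
    next
      case True
      have "openin (ztop (product (induced A X) Y)) (points (product (induced A X) Y) - C)"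
        using C by (rule openin_diff[OF openin_topspace])
      moreover have "(x, u) \<in> points (product (induced A X) Y) - C" using z xu True unfolding ptsS by auto
      ultimately obtain O' where O': "openin (ztop (product A Y)) O'" "(x, u) \<in> O'"
          "O' \<inter> (X \<times> UNIV) \<subseteq> points (product (induced A X) Y) - C"
        by (rule product_open_extends[OF fA fY])
      have "O' \<inter> C = {}" using O'(3) CX by blast
      then show ?thesis using O'(1,2) xu(1) openin_subset[OF O'(1)] by (intro exI[of _ O']) blast
    qed
  qed
  then have "closedin (ztop (product A Y)) C" using CX XA unfolding closedin_def ptsA by auto
  then show "closedin (ztop Y) (snd ` C)" using A Y unfolding complete_variety_def closed_map_def by blast
qed

lemma reg_at_induced:
  assumes "f \<in> reg_at A x" "x \<in> X"
  shows "f \<in> reg_at (induced A X) x"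
proof -
  obtain U where U: "openin (ztop A) U" "x \<in> U" "f \<in> reg A U" using assms(1) by (rule reg_atE)
  have "openin (ztop (induced A X)) (U \<inter> X)" using openin_subtopology_Int[OF U(1)] by simp
  moreover have "f \<in> reg (induced A X) (U \<inter> X)" by (rule reg_imp_reg_induced[OF U(3,1)]) auto
  ultimately show ?thesis using U assms by (auto intro: reg_atI)
qed

text \<open>Functions live on the whole type, so restriction to \<open>X\<close> does not change
  \<open>f\<close>; the case distinction keeps the convention that tangent vectors are 0 outside
  \<open>reg_at\<close>.\<close>

lemma differential_inclusion:
  "differential (induced A X) A id x D = (\<lambda>f. if f \<in> reg_at A x then D f else 0)"
  by (auto simp: differential_def fun_eq_iff)

lemma differential_inclusion_tangent:
  assumes D: "D \<in> tangent_space (induced A X) x" and x: "x \<in> X" and A: "variety A"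
  shows "differential (induced A X) A id x D \<in> tangent_space A x"
proof -
  interpret complex_variety A by unfold_locales (rule A)
  note at = reg_at_induced[OF _ x, of _ A]
  let ?E = "\<lambda>f. if f \<in> reg_at A x then D f else 0"
  have germ: "D f = D g" if f: "f \<in> reg_at A x" and g: "g \<in> reg_at A x"
    and U: "openin (ztop A) U" "x \<in> U" "\<forall>y\<in>U. f y = g y" for f g U
  proof -
    have "openin (ztop (induced A X)) (U \<inter> X)" using openin_subtopology_Int[OF U(1)] by simp
    then show ?thesis by (rule tangent_germ[OF D at[OF f] at[OF g]]) (use U x in auto)
  qed
  have "?E \<in> tangent_space A x"
    unfolding tangent_space_def mem_Collect_eq
    by (intro conjI allI ballI impI)
       (use germ in \<open>auto simp: reg_at_add reg_at_mult reg_at_scale tangent_add[OF D at at] tangent_mult[OF D at at]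
         tangent_scale[OF D at]\<close>)
  then show ?thesis by (simp only: differential_inclusion)
qed

text \<open>Every germ on \<open>X\<close> extends to a germ on \<open>A\<close>, so a tangent
  vector of \<open>X\<close> is determined by its values on germs of \<open>A\<close>.\<close>

lemma differential_inclusion_inj:
  assumes D: "D \<in> tangent_space (induced A X) x" and x: "x \<in> X" and S: "variety (induced A X)"
    and zero: "differential (induced A X) A id x D = (\<lambda>_. 0)"
  shows "D = (\<lambda>_. 0)"
proof
  fix f
  interpret complex_variety "induced A X" by unfold_locales (rule S)
  show "D f = 0"
  proof (cases "f \<in> reg_at (induced A X) x")
    case True
    then obtain U where U: "openin (ztop (induced A X)) U" "x \<in> U" "f \<in> reg (induced A X) U" by (rule reg_atE)
    from bspec[OF U(3)[unfolded reg_induced] U(2)]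
    obtain V g where V: "openin (ztop A) V" "x \<in> V" "g \<in> reg A V" "\<forall>y\<in>U \<inter> V. f y = g y" by auto
    have g: "g \<in> reg_at A x" using V by (auto intro: reg_atI)
    have "openin (ztop (induced A X)) (V \<inter> X)" using openin_subtopology_Int[OF V(1)] by simp
    then have o: "openin (ztop (induced A X)) (U \<inter> (V \<inter> X))" using U(1) by blast
    have "D f = D g" by (rule tangent_germ[OF D True reg_at_induced[OF g x] o]) (use V U x in auto)
    also have "\<dots> = 0" using fun_cong[OF zero, of g] g by (simp add: differential_inclusion)
    finally show ?thesis .
  qed (rule tangent_outside[OF D])
qed

lemma restrict_one_form:
  assumes "s \<in> sym_forms A 1 (points A)" and A: "variety A"
  shows "(\<lambda>x D. s x (differential (induced A X) A id x D)) \<in> sym_forms (induced A X) 1 (points (induced A X))"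
  unfolding sym_forms_def mem_Collect_eq
proof
  fix x assume "x \<in> points (induced A X)"
  then have x: "x \<in> points A" "x \<in> X" by auto
  obtain V K g f where V: "openin (ztop A) V" "x \<in> V" "V \<subseteq> points A"
    "\<forall>k<K::nat. g k \<in> reg A V \<and> f k \<in> reg A V"
    "\<forall>y\<in>V. \<forall>D\<in>tangent_space A y. s y D = (\<Sum>k<K. g k y * D (f k))"
    using assms(1) x(1) by (rule one_formE)
  have o: "openin (ztop (induced A X)) (V \<inter> X)" using openin_subtopology_Int[OF V(1)] by simp
  have r: "\<forall>k<K. g k \<in> reg (induced A X) (V \<inter> X) \<and> (\<forall>j<1::nat. f k \<in> reg (induced A X) (V \<inter> X))"
    using reg_imp_reg_induced[OF _ V(1), of _ "V \<inter> X" X] V(4) by auto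
  have eq: "s y (differential (induced A X) A id y D) = (\<Sum>k<K. g k y * (\<Prod>j<1::nat. D (f k)))"
    if "y \<in> V \<inter> X" "D \<in> tangent_space (induced A X) y" for y D
  proof -
    have y: "y \<in> V" "y \<in> X" using that by auto
    have "s y (differential (induced A X) A id y D) = (\<Sum>k<K. g k y * differential (induced A X) A id y D (f k))"
      using V(5) y(1) differential_inclusion_tangent[OF that(2) y(2) A] by blast
    also have "\<dots> = (\<Sum>k<K. g k y * (\<Prod>j<1::nat. D (f k)))"
      by (rule sum.cong) (use V(4) reg_atI[OF V(1) y(1)] in \<open>auto simp: differential_inclusion\<close>)
    finally show ?thesis .
  qed
  show "\<exists>V K g f. openin (ztop (induced A X)) V \<and> x \<in> V \<and> V \<subseteq> points (induced A X) \<and>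
      (\<forall>k<K::nat. g k \<in> reg (induced A X) V \<and> (\<forall>j<1::nat. f k j \<in> reg (induced A X) V)) \<and>
      (\<forall>y\<in>V. \<forall>D\<in>tangent_space (induced A X) y.
         s y (differential (induced A X) A id y D) = (\<Sum>k<K. g k y * (\<Prod>j<1. D (f k j))))"
    by (rule exI[of _ "V \<inter> X"], rule exI[of _ K], rule exI[of _ g], rule exI[of _ "\<lambda>k j. f k"])
       (intro conjI o openin_subset[OF o] r ballI eq; use V x in auto)
qed

section \<open>Finite fibres\<close>

text \<open>In a finite T1 space every set is closed, so an irreducible closed set is a single point
  and no chain has a proper inclusion. The empty space is covered too, the supremum of the empty set
  in \<open>enat\<close> being 0.\<close>

lemma krull_dim_finite_t1:
  assumes "finite (topspace T)" "t1_space T"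
  shows "krull_dim T = 0"
proof (rule ccontr)
  assume "krull_dim T \<noteq> 0"
  then have "0 < Sup {enat k | k. \<exists>Z. (\<forall>i\<le>k. closedin T (Z i) \<and> irreducible_space (subtopology T (Z i))) \<and>
         (\<forall>i<k. Z i \<subset> Z (Suc i))}" unfolding krull_dim_def by (simp add: zero_less_iff_neq_zero)
  then obtain k Z where k: "0 < enat k" and Z: "\<forall>i\<le>k. closedin T (Z i) \<and> irreducible_space (subtopology T (Z i))"
      "\<forall>i<k. Z i \<subset> Z (Suc i)"
    unfolding less_Sup_iff by blast
  have "k > 0" using k by (simp add: zero_enat_def)
  then have Z0: "closedin T (Z 0)" "irreducible_space (subtopology T (Z 0))"
    and Z1: "closedin T (Z 1)" "irreducible_space (subtopology T (Z 1))" and lt: "Z 0 \<subset> Z 1"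
    using Z(1)[rule_format, of 0] Z(1)[rule_format, of 1] Z(2)[rule_format, of 0] by auto
  have t0: "topspace (subtopology T (Z 0)) = Z 0" and t1: "topspace (subtopology T (Z 1)) = Z 1"
    using closedin_subset[OF Z0(1)] closedin_subset[OF Z1(1)] by auto
  obtain z where z: "z \<in> Z 0" using Z0(2) unfolding irreducible_space_def t0 by blast
  have cl: "closedin T B" if "B \<subseteq> Z 1" for B
  proof -
    have "B \<subseteq> topspace T" using that closedin_subset[OF Z1(1)] by blast
    then show ?thesis using assms finite_subset by (auto simp: t1_space_closedin_finite)
  qed
  have cl1: "closedin (subtopology T (Z 1)) B" if "B \<subseteq> Z 1" for B
    using closedin_closed_subtopology[OF Z1(1)] cl[OF that] that by blast
  have "Z 1 \<subseteq> {z} \<union> (Z 1 - {z})" by blast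
  moreover have "z \<in> Z 1" using z lt by blast
  ultimately have "{z} = Z 1 \<or> Z 1 - {z} = Z 1"
    using Z1(2) cl1[of "{z}"] cl1[of "Z 1 - {z}"] unfolding irreducible_space_def t1 by blast
  then show False using z lt \<open>z \<in> Z 1\<close> by auto
qed

lemma cline_iff: "u \<in> cline v \<longleftrightarrow> (\<exists>c. u = (\<lambda>i. c * v i))"
  by (auto simp: cline_def)

lemma cline_scale:
  assumes "c \<noteq> 0"
  shows "cline (\<lambda>i. c * v i) = cline v"
proof
  show "cline (\<lambda>i. c * v i) \<subseteq> cline v"
  proof
    fix u assume "u \<in> cline (\<lambda>i. c * v i)"
    then obtain s where "u = (\<lambda>i. s * (c * v i))" unfolding cline_iff by blast
    then have "u = (\<lambda>i. (s * c) * v i)" by (simp only: mult.assoc)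
    then show "u \<in> cline v" unfolding cline_iff by (rule exI)
  qed
  show "cline v \<subseteq> cline (\<lambda>i. c * v i)"
  proof
    fix u assume "u \<in> cline v"
    then obtain s where "u = (\<lambda>i. s * v i)" unfolding cline_iff by blast
    then have "u = (\<lambda>i. (s / c) * (c * v i))" using assms by simp
    then show "u \<in> cline (\<lambda>i. c * v i)" unfolding cline_iff by (rule exI)
  qed
qed

lemma cline_self: "v \<in> cline v"
  unfolding cline_def by (rule CollectI, rule exI[of _ 1]) simp

context framed_variety
begin

lemma w_image_cline: "x \<in> points S \<Longrightarrow> D \<in> T x \<Longrightarrow> w x ` cline D = cline (w x D)"
proof -
  assume x: "x \<in> points S" "D \<in> T x"
  have "cline D = range (\<lambda>c f. c * D f)" "cline (w x D) = range (\<lambda>c i. c * w x D i)"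
    by (auto simp: cline_def)
  then show "w x ` cline D = cline (w x D)" using w_scale[OF x] by (simp add: image_image)
qed

text \<open>Two points of one fibre lie over different points of \<open>S\<close>, because the
  injective map \<open>w x\<close> sends only one line of \<open>T x\<close> to \<open>p\<close>. So
  it is enough to separate points of \<open>S\<close>.\<close>

lemma t1_fibre: "t1_space (subtopology (PT_top S) {q \<in> PT_points S. (\<lambda>(x, l). w x ` l) q = p})"
  unfolding t1_space_def
proof (intro ballI impI)
  let ?F = "{q \<in> PT_points S. (\<lambda>(x, l). w x ` l) q = p}"
  fix q r assume "q \<in> topspace (subtopology (PT_top S) ?F)" "r \<in> topspace (subtopology (PT_top S) ?F)" and ne: "q \<noteq> r"
  then have q: "q \<in> ?F" and r: "r \<in> ?F" by auto
  obtain x D where xD: "q = (x, cline D)" "x \<in> points S" "D \<in> T x" "D \<noteq> (\<lambda>_. 0)" "p = cline (w x D)"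
    using q w_image_cline by (auto simp: PT_points_def)
  obtain y E where yE: "r = (y, cline E)" "y \<in> points S" "E \<in> T y" "E \<noteq> (\<lambda>_. 0)" "p = cline (w y E)"
    using r w_image_cline by (auto simp: PT_points_def)
  have "x \<noteq> y"
  proof
    assume xy: "x = y"
    have "w x D \<in> cline (w y E)" using xD(5) yE(5) cline_self by metis
    then obtain c where "w x D = (\<lambda>i. c * w x E i)" unfolding cline_def xy by auto
    then have "D = (\<lambda>f. c * E f)"
      using w_eq_imp_eq[OF xD(2,3) tangent_scaleR] w_scale[OF xD(2)] yE(3) xy by simp
    then show False using ne xD yE xy cline_scale[of c E] by (cases "c = 0") auto
  qed
  then obtain U where U: "zopen U" "x \<in> U" "y \<notin> U" using separate_points xD(2) yE(2) by metis
  \<comment> \<open>The constant form 1 of degree 0 makes the preimage of \<open>U\<close> a basic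
    open set of \<open>PT_top\<close>.\<close>
  have "(\<lambda>_ _. 1) \<in> sym_forms S 0 U" unfolding sym_forms_def mem_Collect_eq
  proof
    fix x assume "x \<in> U"
    then show "\<exists>V K g f. zopen V \<and> x \<in> V \<and> V \<subseteq> U \<and>
      (\<forall>k<K::nat. g k \<in> reg S V \<and> (\<forall>j<0::nat. f k j \<in> reg S V)) \<and>
      (\<forall>y\<in>V. \<forall>D\<in>T y. 1 = (\<Sum>k<K. g k y * (\<Prod>j<0. D (f k j))))"
      using U(1) reg_const[OF U(1)]
      by - (rule exI[of _ U], rule exI[of _ 1], rule exI[of _ "\<lambda>_ _. 1"], auto)
  qed
  then have "openin (PT_top S) {(x, l) \<in> PT_points S. x \<in> U \<and> (\<exists>D\<in>l. (1::complex) \<noteq> 0)}"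
    unfolding PT_top_def using U(1)
    by - (rule topology_generated_by_Basis, rule CollectI, rule exI[of _ U], rule exI[of _ 0],
        rule exI[of _ "\<lambda>_ _. 1"], simp)
  then have o: "openin (subtopology (PT_top S) ?F) ({(x, l) \<in> PT_points S. x \<in> U \<and> (\<exists>D\<in>l. (1::complex) \<noteq> 0)} \<inter> ?F)"
    (is "openin _ ?O") by (rule openin_subtopology_Int)
  have "q \<in> ?O" using q xD(1) U(2) cline_self by auto
  moreover have "r \<notin> ?O" using yE(1) U(3) by auto
  ultimately show "\<exists>U. openin (subtopology (PT_top S) ?F) U \<and> q \<in> U \<and> r \<notin> U"
    by (intro exI[of _ ?O] conjI o)
qed

text \<open>Fix a vector \<open>v\<close> on the line \<open>p\<close>. Each point of the fibre has
  a representative tangent vector with image exactly \<open>v\<close>, and by injectivity of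
  \<open>w x\<close> there is at most one of these over each \<open>x\<close>.\<close>

lemma finite_fibre:
  assumes "finite {x \<in> points S. \<exists>D\<in>T x. w x D = v}" "v \<in> p" "v \<noteq> (\<lambda>_. 0)"
  shows "finite {q \<in> PT_points S. (\<lambda>(x, l). w x ` l) q = p}"
proof (rule finite_imageD)
  let ?F = "{q \<in> PT_points S. (\<lambda>(x, l). w x ` l) q = p}"
  have *: "\<exists>D. x \<in> points S \<and> D \<in> T x \<and> w x D = v \<and> l = cline D" if q: "(x, l) \<in> ?F" for x l
  proof -
    obtain D where D: "l = cline D" "x \<in> points S" "D \<in> T x" "p = cline (w x D)"
      using q w_image_cline by (auto simp: PT_points_def)
    then obtain c where c: "v = (\<lambda>i. c * w x D i)" using assms(2) by (auto simp: cline_def)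
    then have "c \<noteq> 0" using assms(3) by auto
    then show ?thesis
      using D(1,2) c w_scale[OF D(2,3), of c] tangent_scaleR[OF D(3), of c] cline_scale[of c D]
      by (intro exI[of _ "\<lambda>f. c * D f"]) simp
  qed
  have "fst ` ?F \<subseteq> {x \<in> points S. \<exists>D\<in>T x. w x D = v}"
  proof
    fix x assume "x \<in> fst ` ?F"
    then obtain l where "(x, l) \<in> ?F" by force
    from *[OF this] show "x \<in> {x \<in> points S. \<exists>D\<in>T x. w x D = v}" by blast
  qed
  then show "finite (fst ` ?F)" using assms(1) finite_subset by blast
  show "inj_on fst ?F"
  proof (rule inj_onI)
    fix q r assume q: "q \<in> ?F" and r: "r \<in> ?F" and eq: "fst q = fst r"
    obtain x l l' where ql: "q = (x, l)" "r = (x, l')" using eq by (cases q, cases r) auto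
    obtain D where D: "x \<in> points S" "D \<in> T x" "w x D = v" "l = cline D" using *[of x l] q ql by blast
    obtain E where E: "E \<in> T x" "w x E = v" "l' = cline E" using *[of x l'] r ql by blast
    have "D = E" using w_eq_imp_eq[OF D(1,2) E(1)] D(3) E(2) by simp
    then show "q = r" using ql D E by simp
  qed
qed

end

section \<open>Projective coordinates from sections, and the vanishing argument\<close>

lemma zero_sym_form: "openin (ztop X) U \<Longrightarrow> (\<lambda>_ _. 0) \<in> sym_forms X m U"
  unfolding sym_forms_def mem_Collect_eq
  by (intro ballI, rule exI[of _ U], rule exI[of _ 0], rule exI[of _ "\<lambda>_ _. 0"], rule exI[of _ "\<lambda>_ _ _. 0"]) auto

lemma points_proj_space: "points (proj_space N) \<subseteq> {cline v | v. v \<in> cvec N \<and> v \<noteq> (\<lambda>_. 0)}"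
  unfolding proj_space_def Let_def by auto

lemma openin_proj_space:
  assumes "p \<in> homogeneous N d"
  shows "openin (ztop (proj_space N)) {l \<in> {cline v | v. v \<in> cvec N \<and> v \<noteq> (\<lambda>_. 0)}. \<exists>v\<in>l. p v \<noteq> 0}"
  unfolding proj_space_def Let_def fspace.simps
  by (rule topology_generated_by_Basis, rule CollectI, rule exI[of _ p], rule exI[of _ d], rule conjI[OF refl assms])

text \<open>The sections have no common zero: otherwise \<open>cline u\<close> would consist of the
  zero vector alone, which is not a point of projective space.\<close>

lemma sections_nonzero:
  assumes "isomorphism S (induced (proj_space N) Z) \<phi>" "x \<in> points S" "\<phi> x = cline u"
  shows "u \<noteq> (\<lambda>_. 0)"
proof
  assume u: "u = (\<lambda>_. 0)"
  have "continuous_map (ztop S) (ztop (induced (proj_space N) Z)) \<phi>"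
    using assms(1) by (simp add: isomorphism_def morphism_def)
  then have "\<phi> x \<in> points (proj_space N)"
    using continuous_map_image_subset_topspace assms(2) by fastforce
  then obtain v where v: "\<phi> x = cline v" "v \<noteq> (\<lambda>_. 0)" using points_proj_space by blast
  then have "v \<in> cline u" using assms(3) cline_self[of v] by simp
  then show False using v(2) u by (auto simp: cline_iff)
qed

lemma isomorphism_inj_on: "isomorphism X Y \<phi> \<Longrightarrow> inj_on \<phi> (points X)"
  unfolding isomorphism_def inj_on_def by metis

context complete_framed_variety
begin

lemma H0_vanishes:
  assumes L: "is_line_bundle S L" and neg: "negative S L" and \<sigma>: "\<sigma> \<in> H0_sym_forms S m L"
    and fib: "for_general_point (subtopology (ztop (proj_space n)) ((\<lambda>(x, l). w x ` l) ` PT_points S))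
         (\<lambda>p. krull_dim (subtopology (PT_top S) {q \<in> PT_points S. (\<lambda>(x, l). w x ` l) q = p}) > 0)"
  shows "\<sigma> = (\<lambda>_ _ _. 0)"
proof (rule ccontr)
  assume "\<sigma> \<noteq> (\<lambda>_ _ _. 0)"
  then obtain i0 x0 D0 where nz0: "\<sigma> i0 x0 D0 \<noteq> 0" by (auto simp: fun_eq_iff)
  have \<sigma>1: "\<And>i. i < charts L \<Longrightarrow> \<sigma> i \<in> sym_forms S m (chart_dom L i)"
    and \<sigma>2: "\<And>i j x D. i < charts L \<Longrightarrow> j < charts L \<Longrightarrow> x \<in> chart_dom L i \<Longrightarrow> x \<in> chart_dom L j \<Longrightarrow> D \<in> T x \<Longrightarrow>
        \<sigma> i x D = transition L i j x * \<sigma> j x D"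
    and \<sigma>3: "\<And>i x D. \<not> (i < charts L \<and> x \<in> chart_dom L i \<and> D \<in> T x) \<Longrightarrow> \<sigma> i x D = 0"
    using \<sigma> unfolding H0_sym_forms_def by blast+
  have i0: "i0 < charts L" "x0 \<in> chart_dom L i0" "D0 \<in> T x0" using \<sigma>3[of i0 x0 D0] nz0 by auto
  have Lo: "\<And>i. i < charts L \<Longrightarrow> zopen (chart_dom L i)"
    and Lc: "(\<Union>i<charts L. chart_dom L i) = points S"
    and L1: "\<And>i x. i < charts L \<Longrightarrow> x \<in> chart_dom L i \<Longrightarrow> transition L i i x = 1"
    and L2: "\<And>i j k x. i < charts L \<Longrightarrow> j < charts L \<Longrightarrow> k < charts L \<Longrightarrow> x \<in> chart_dom L i \<Longrightarrow>
       x \<in> chart_dom L j \<Longrightarrow> x \<in> chart_dom L k \<Longrightarrow> transition L i j x * transition L j k x = transition L i k x"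
    using L unfolding is_line_bundle_def by blast+
  have L3: "transition L i j x \<noteq> 0" if "i < charts L" "j < charts L" "x \<in> chart_dom L i" "x \<in> chart_dom L j" for i j x
    using L2[of i j i x] L1[of i x] that by auto
  have x0: "x0 \<in> points S" using i0 Lc by blast
  obtain k where k: "k > 0" "very_ample S (lb_power (lb_dual L) k)"
    using neg unfolding negative_def ample_def by blast
  have lbp: "charts (lb_power (lb_dual L) k) = charts L" "chart_dom (lb_power (lb_dual L) k) = chart_dom L"
    "transition (lb_power (lb_dual L) k) = (\<lambda>i j x. inverse (transition L i j x) ^ k)"
    by (simp_all add: lb_power_def lb_dual_def)
  obtain N t \<phi> where t: "\<forall>a<N. t a \<in> lb_sections S (lb_power (lb_dual L) k)"
    and \<phi>: "\<forall>i<charts L. \<forall>x\<in>chart_dom L i. \<phi> x = cline (\<lambda>a. if a < N then t a i x else 0)"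
    and iso: "isomorphism S (induced (proj_space N) (\<phi> ` points S)) \<phi>"
    using k(2) unfolding very_ample_def lbp by (elim exE conjE)
  have t1: "t a i \<in> reg S (chart_dom L i)" if "a < N" "i < charts L" for a i
    using t that unfolding lb_sections_def lbp by blast
  have t2: "t a i x = inverse (transition L i j x) ^ k * t a j x"
    if "a < N" "i < charts L" "j < charts L" "x \<in> chart_dom L i" "x \<in> chart_dom L j" for a i j x
    using t that unfolding lb_sections_def lbp by blast
  \<comment> \<open>A chart is chosen at each point so that local data become one function on the
    whole tangent bundle.\<close>
  define ch where "ch x = (SOME i. i < charts L \<and> x \<in> chart_dom L i)" for x
  have ch: "ch x < charts L" "x \<in> chart_dom L (ch x)" if "x \<in> points S" for x
  proof -
    have "\<exists>i. i < charts L \<and> x \<in> chart_dom L i" using that Lc by blast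
    from someI_ex[OF this] show "ch x < charts L" "x \<in> chart_dom L (ch x)" by (auto simp: ch_def)
  qed
  \<comment> \<open>The \<open>k\<close>-th powers of the transition functions in
    \<open>\<sigma> ^ k\<close> and their inverses in \<open>t a\<close> cancel, so the value does
    not depend on the chart.\<close>
  define ga where "ga a x D = \<sigma> (ch x) x D ^ k * t a (ch x) x" for a x D
  have ga: "ga a x D = \<sigma> i x D ^ k * t a i x"
    if "a < N" "i < charts L" "x \<in> chart_dom L i" "D \<in> T x" for a i x D
  proof -
    have x: "x \<in> points S" using that(2,3) Lc by blast
    note c = ch[OF x]
    have "ga a x D = (transition L (ch x) i x * \<sigma> i x D) ^ k * (inverse (transition L (ch x) i x) ^ k * t a i x)"
      unfolding ga_def using \<sigma>2[OF c(1) that(2) c(2) that(3,4)] t2[OF that(1) c(1) that(2) c(2) that(3)] by simp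
    also have "\<dots> = (transition L (ch x) i x * inverse (transition L (ch x) i x)) ^ k * (\<sigma> i x D ^ k * t a i x)"
      by (simp only: power_mult_distrib mult_ac)
    also have "\<dots> = \<sigma> i x D ^ k * t a i x" using L3[OF c(1) that(2) c(2) that(3)] by simp
    finally show ?thesis .
  qed
  have ga_tf: "tangent_function (ga a) x" if a: "a < N" and x: "x \<in> points S" for a x
  proof -
    note c = ch[OF x]
    have "tangent_function (\<lambda>y D. \<sigma> (ch x) y D ^ k * t a (ch x) y) x"
      by (intro tangent_function_mult tangent_function_power tangent_function_reg x
            tangent_function_sym_form[OF \<sigma>1[OF c(1)] c(2)] reg_atI[OF Lo[OF c(1)] c(2)] t1 a c)
    then show ?thesis by (rule tangent_function_cong[OF _ Lo[OF c(1)] c(2)]) (rule ga[OF a c(1)])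
  qed
  define g where "g a i x D = ga a x D * \<theta> i x D" for a i x D
  have g_tf: "tangent_function (g a i) x" if "a < N" "i < n" "x \<in> points S" for a i x
    unfolding g_def[abs_def] using that by (intro tangent_function_mult ga_tf tangent_function_theta)
  \<comment> \<open>Degree \<open>m * k\<close> comes from \<open>\<sigma> ^ k\<close>, and 1 from
    \<open>\<theta> i\<close>.\<close>
  define e where "e = m * k + 1"
  have g_hom: "g a i x (\<lambda>f. s * D f) = s ^ e * g a i x D"
    if "a < N" "i < n" "x \<in> points S" "D \<in> T x" for a i x D s
  proof -
    note c = ch[OF that(3)]
    have "\<sigma> (ch x) x (\<lambda>f. s * D f) = s ^ m * \<sigma> (ch x) x D"
      by (rule sym_form_scale[OF \<sigma>1[OF c(1)] c(2) that(4)])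
    then show ?thesis
      using one_form_scale[OF \<theta>[OF that(2)] that(3,4), of s]
      by (simp add: g_def ga_def e_def power_mult_distrib power_mult[symmetric] algebra_simps)
  qed
  let ?f = "\<lambda>(x, l). w x ` l"
  let ?I = "subtopology (ztop (proj_space n)) (?f ` PT_points S)"
  obtain V where V: "openin ?I V" "V \<noteq> {}" "?I closure_of V = topspace ?I"
    and pos: "\<And>p. p \<in> V \<Longrightarrow> krull_dim (subtopology (PT_top S) {q \<in> PT_points S. ?f q = p}) > 0"
    using fib unfolding for_general_point_def by blast
  \<comment> \<open>A non-empty \<open>V\<close> guarantees a non-zero tangent vector, and with it a
    form \<open>\<theta> i1\<close> that does not vanish identically.\<close>
  have "\<exists>x1 D1. x1 \<in> points S \<and> D1 \<in> T x1 \<and> D1 \<noteq> (\<lambda>_. 0)"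
    using V(2) openin_subset[OF V(1)] by (auto simp: PT_points_def)
  then obtain x1 D1 where x1: "x1 \<in> points S" "D1 \<in> T x1" "D1 \<noteq> (\<lambda>_. 0)" by blast
  obtain i1 where i1: "i1 < n" "\<theta> i1 x1 D1 \<noteq> 0" using \<theta>_inj[OF x1(1,2)] x1(3) by blast
  have "\<phi> x0 = cline (\<lambda>a. if a < N then t a i0 x0 else 0)" using \<phi> i0 by blast
  from sections_nonzero[OF iso x0 this] obtain a0 where a0: "a0 < N" "t a0 i0 x0 \<noteq> 0"
    by (auto simp: fun_eq_iff split: if_splits)
  have ga0: "ga a0 x0 D0 \<noteq> 0" unfolding ga[OF a0(1) i0] using nz0 a0(2) by simp
  \<comment> \<open>Neither factor of \<open>g a0 i1\<close> vanishes identically, hence by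
    irreducibility neither does the product.\<close>
  obtain x2 D2 where x2: "x2 \<in> points S" "D2 \<in> T x2" "ga a0 x2 D2 \<noteq> 0" "\<theta> i1 x2 D2 \<noteq> 0"
    by (rule common_nonzero[where g = "ga a0" and h = "\<theta> i1" and ?x0.0 = x0 and ?D0.0 = D0 and ?x1.0 = x1 and ?D1.0 = D1,
          OF ga_tf[OF a0(1)] tangent_function_theta[OF i1(1)] x0 i0(3) ga0 x1(1,2) i1(2)])
  have g2: "g a0 i1 x2 D2 \<noteq> 0" using x2 by (simp add: g_def)
  obtain j c x3 D3 where c: "j > 0" "c \<in> homogeneous n (e * j)" and x3: "x3 \<in> points S" "D3 \<in> T x3" "c (w x3 D3) \<noteq> 0"
    and cg: "\<And>x D. x \<in> points S \<Longrightarrow> D \<in> T x \<Longrightarrow> c (w x D) \<noteq> 0 \<Longrightarrow> g a0 i1 x D \<noteq> 0"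
    using norm_polynomial[where g = "g a0 i1" and e = e and ?x0.0 = x2 and ?D0.0 = D2,
        OF g_tf[OF a0(1) i1(1)] g_hom[OF a0(1) i1(1)] x2(1,2) g2] by metis
  \<comment> \<open>The degree \<open>e * j\<close> is positive thanks to the summand 1 in
    \<open>e\<close>.\<close>
  have c0: "c (\<lambda>_. 0) = 0" by (rule homogeneous_at_zero[OF c(2)]) (use c(1) in \<open>simp add: e_def\<close>)
  let ?O = "{l \<in> {cline v | v. v \<in> cvec n \<and> v \<noteq> (\<lambda>_. 0)}. \<exists>v\<in>l. c v \<noteq> 0}"
  have O: "openin (ztop (proj_space n)) ?O" by (rule openin_proj_space[OF c(2)])
  have w3: "w x3 D3 \<noteq> (\<lambda>_. 0)" using x3(3) c0 by auto
  have "D3 \<noteq> (\<lambda>_. 0)"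
  proof
    assume "D3 = (\<lambda>_. 0)"
    moreover have "w x3 (\<lambda>_. 0) = (\<lambda>_. 0)" using one_form_zero[OF \<theta> x3(1)] by (auto simp: w_def fun_eq_iff)
    ultimately show False using w3 by simp
  qed
  then have "(x3, cline D3) \<in> PT_points S" using x3 by (auto simp: PT_points_def)
  moreover have "?f (x3, cline D3) = cline (w x3 D3)" using w_image_cline[OF x3(1,2)] by simp
  ultimately have im: "cline (w x3 D3) \<in> ?f ` PT_points S" by (metis imageI)
  have inO: "cline (w x3 D3) \<in> ?O" using w_cvec w3 x3(3) cline_self by blast
  have top: "cline (w x3 D3) \<in> topspace ?I" using im inO openin_subset[OF O] by auto
  have oI: "openin ?I (?O \<inter> ?f ` PT_points S)" (is "openin _ ?O'") by (rule openin_subtopology_Int[OF O])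
  have inO': "cline (w x3 D3) \<in> ?O'" using inO im by blast
  \<comment> \<open>The lines on which \<open>c\<close> does not vanish identically form an open set
    that meets the image of the tangent map; density of \<open>V\<close> provides a common
    \<open>p\<close>, whose fibre will turn out to be finite.\<close>
  have "cline (w x3 D3) \<in> ?I closure_of V" unfolding V(3) by (rule top)
  then have "\<forall>U. cline (w x3 D3) \<in> U \<and> openin ?I U \<longrightarrow> (\<exists>y. y \<in> V \<and> y \<in> U)"
    unfolding in_closure_of by (rule conjunct2)
  from this[rule_format, OF conjI[OF inO' oI]] obtain p where p: "p \<in> V" "p \<in> ?O" by (elim exE conjE IntE)
  obtain v where v: "v \<in> p" "c v \<noteq> 0" using p(2) by blast
  then have v0: "v \<noteq> (\<lambda>_. 0)" using c0 by auto
  let ?X = "{x \<in> points S. \<exists>D\<in>T x. w x D = v}"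
  have "finite ?X"
  proof (cases "?X = {}")
    case False
    \<comment> \<open>The form \<open>\<theta> i\<close> has the constant value \<open>v i\<close>
      on all vectors with image \<open>v\<close>, so this non-zero number factors out of the values
      of \<open>g b i\<close>.\<close>
    obtain i where i: "v i \<noteq> 0" using v0 by auto
    have iN: "i < n" using False i by (auto simp: w_def split: if_splits)
    define DD where "DD x = (SOME D. D \<in> T x \<and> w x D = v)" for x
    have DD: "DD x \<in> T x" "w x (DD x) = v" if "x \<in> ?X" for x
    proof -
      have "\<exists>D. D \<in> T x \<and> w x D = v" using that by blast
      from someI_ex[OF this] show "DD x \<in> T x" "w x (DD x) = v" by (auto simp: DD_def)
    qed
    \<comment> \<open>The values of the functions \<open>g b i\<close> at \<open>DD x\<close>: up to
      a common factor they are the homogeneous coordinates of \<open>\<phi> x\<close>, yet each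
      ranges over a finite set. The default 0 beyond \<open>N\<close> is the one used by
      \<open>\<phi>\<close> and by \<open>finite_set_of_finite_funs\<close>.\<close>
    define \<gamma> where "\<gamma> x b = (if b < N then g b i x (DD x) else 0)" for x b
    define F where "F = (\<Union>b<N. {g b i x D | x D. x \<in> points S \<and> D \<in> T x \<and> w x D = v})"
    have finF: "finite F" unfolding F_def
      by (intro finite_UN_I finite_lessThan finitely_many_values[where e = e]) (auto intro: g_tf g_hom iN)
    have "\<gamma> ` ?X \<subseteq> {h. \<forall>b. (b \<in> {..<N} \<longrightarrow> h b \<in> F) \<and> (b \<notin> {..<N} \<longrightarrow> h b = 0)}"
    proof clarify
      fix x D assume x: "x \<in> points S" and D: "D \<in> T x" "v = w x D"
      then have xX: "x \<in> ?X" by blast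
      have "g b i x (DD x) \<in> F" if "b < N" for b unfolding F_def using that x DD[OF xX] by blast
      then show "(b \<in> {..<N} \<longrightarrow> \<gamma> x b \<in> F) \<and> (b \<notin> {..<N} \<longrightarrow> \<gamma> x b = 0)" for b by (simp add: \<gamma>_def)
    qed
    then have "finite (\<gamma> ` ?X)"
      by (rule finite_subset) (rule finite_set_of_finite_funs[OF finite_lessThan finF])
    moreover have "\<phi> x = cline (\<gamma> x)" if x: "x \<in> ?X" for x
    proof -
      have xp: "x \<in> points S" using x by blast
      note cx = ch[OF xp] and D = DD[OF x]
      let ?s = "\<sigma> (ch x) x (DD x) ^ k * v i"
      \<comment> \<open>The common factor \<open>?s\<close> must not be 0. Here
        \<open>c v \<noteq> 0\<close> pays off: it makes \<open>g a0 i1\<close> non-zero, and as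
        \<open>k > 0\<close> this excludes a zero of \<open>\<sigma>\<close>.\<close>
      have "g a0 i1 x (DD x) \<noteq> 0" by (rule cg[OF xp D(1)]) (simp add: D(2) v(2))
      then have "\<sigma> (ch x) x (DD x) \<noteq> 0" using k(1) by (auto simp: g_def ga_def)
      then have s: "?s \<noteq> 0" using i by simp
      have "\<theta> i x (DD x) = v i" using fun_cong[OF D(2), of i] iN by (simp add: w_def)
      then have "\<gamma> x = (\<lambda>b. ?s * (if b < N then t b (ch x) x else 0))"
        by (auto simp: \<gamma>_def g_def ga_def fun_eq_iff)
      then have "cline (\<gamma> x) = cline (\<lambda>b. if b < N then t b (ch x) x else 0)" using cline_scale[OF s] by simp
      then show ?thesis using \<phi> cx by simp
    qed
    then have "\<phi> ` ?X = cline ` (\<gamma> ` ?X)" unfolding image_image by (intro image_cong) auto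
    \<comment> \<open>Finitely many coordinate vectors give finitely many points of projective
      space, and the embedding \<open>\<phi>\<close> carries finiteness back to
      \<open>S\<close>.\<close>
    ultimately have "finite (\<phi> ` ?X)" by simp
    then show ?thesis
      by (rule finite_imageD) (rule inj_on_subset[OF isomorphism_inj_on[OF iso]], blast)
  qed (simp only: finite.emptyI)
  then have "finite {q \<in> PT_points S. ?f q = p}" using v(1) v0 by (rule finite_fibre)
  then have "finite (topspace (subtopology (PT_top S) {q \<in> PT_points S. ?f q = p}))" by simp
  then have "krull_dim (subtopology (PT_top S) {q \<in> PT_points S. ?f q = p}) = 0"
    using t1_fibre by (rule krull_dim_finite_t1)
  then show False using pos[OF p(1)] by simp
qed

end

theorem theoremG:
  fixes A :: "'a fspace" and G :: "'a monoid" and n :: nat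
    and X :: "'a set"
    and \<omega> :: "nat \<Rightarrow> 'a \<Rightarrow> 'a tvec \<Rightarrow> complex"
    and m :: nat and L :: "'a line_bundle"
  assumes "abelian_variety A G" and "krull_dim (ztop A) = enat n"
    and "closedin (ztop A) X" and "smooth_variety (induced A X)"
    and "cotangent_trivialization A n \<omega>"
    and general_fiber:
      "for_general_point
         (subtopology (ztop (proj_space n)) (tangent_map A X n \<omega> ` PT_points (induced A X)))
         (\<lambda>p. krull_dim (subtopology (PT_top (induced A X))
                 {q \<in> PT_points (induced A X). tangent_map A X n \<omega> q = p}) > 0)"
    and "is_line_bundle (induced A X) L" and "negative (induced A X) L"
  shows "H0_sym_forms (induced A X) m L = {\<lambda>_ _ _. 0}"
proof -
  let ?S = "induced A X"
  \<comment> \<open>The invariant forms of \<open>A\<close>, restricted to \<open>X\<close> by means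
    of the differential of the inclusion.\<close>
  define \<theta> where "\<theta> i x D = \<omega> i x (differential ?S A id x D)" for i x D
  have A: "complete_variety A" and varA: "variety A"
    using assms(1) by (auto simp: abelian_variety_def complete_variety_def)
  have S: "variety ?S" using assms(4) by (simp add: smooth_variety_def)
  have XA: "X \<subseteq> points A" using closedin_subset[OF assms(3)] .
  have ptsS: "points ?S = X" using XA by auto
  have \<omega>: "\<And>i. i < n \<Longrightarrow> \<omega> i \<in> sym_forms A 1 (points A)"
    and bij: "\<And>x. x \<in> points A \<Longrightarrow> bij_betw (\<lambda>D i. if i < n then \<omega> i x D else 0) (tangent_space A x) (cvec n)"
    using assms(5) unfolding cotangent_trivialization_def by blast+
  interpret cv: complex_variety ?S by unfold_locales (rule S)
  obtain x where x: "x \<in> points ?S" using cv.irreducible unfolding irreducible_space_def by blast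
  define d where "d = fun_vs.dim (tangent_space ?S x)"
  \<comment> \<open>Smoothness identifies all these dimensions with \<open>krull_dim\<close>, so
    they agree from point to point and \<open>d\<close> may be read off at \<open>x\<close>.\<close>
  have dim: "enat (fun_vs.dim (tangent_space ?S y)) = krull_dim (ztop ?S)" if "y \<in> points ?S" for y
    using assms(4) that unfolding smooth_variety_def by blast
  interpret complete_framed_variety ?S n \<theta> d
  proof unfold_locales
    fix i assume "i < n"
    show "\<theta> i \<in> sym_forms ?S 1 (points ?S)"
      unfolding \<theta>_def[abs_def] by (rule restrict_one_form[OF \<omega>[OF \<open>i < n\<close>] varA])
  next
    fix y D assume y: "y \<in> points ?S" and D: "D \<in> tangent_space ?S y" and z: "\<And>i. i < n \<Longrightarrow> \<theta> i y D = 0"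
    have yX: "y \<in> X" "y \<in> points A" using y ptsS XA by auto
    let ?E = "differential ?S A id y D"
    have E: "?E \<in> tangent_space A y" by (rule differential_inclusion_tangent[OF D yX(1) varA])
    \<comment> \<open>The trivialisation is given as a bijection; comparing the values at
      \<open>?E\<close> and at the zero vector shows that its kernel is trivial.\<close>
    have "(\<lambda>i. if i < n then \<omega> i y ?E else 0) = (\<lambda>i. if i < n then \<omega> i y (\<lambda>_. 0) else 0)"
      using z one_form_zero[OF \<omega> yX(2)] by (auto simp: \<theta>_def fun_eq_iff)
    then have "?E = (\<lambda>_. 0)"
      using bij[OF yX(2)] E tangent_zero[of A y] unfolding bij_betw_def inj_on_def by blast
    then show "D = (\<lambda>_. 0)" by (rule differential_inclusion_inj[OF D yX(1) S])
  next
    fix y assume "y \<in> points ?S"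
    then have "enat (fun_vs.dim (tangent_space ?S y)) = enat d" unfolding d_def using dim dim[OF x] by metis
    then show "fun_vs.dim (tangent_space ?S y) = d" by simp
  next
    show "closed_map (ztop (product ?S (affine_space (Suc n)))) (ztop (affine_space (Suc n))) snd"
      by (rule closed_map_snd_induced[OF A assms(3) cv.fs variety_affine_space])
  qed
  \<comment> \<open>With the forms restricted as in \<open>\<theta>\<close>, the inclusion followed
    by the trivialisation acts on each line of tangent vectors as \<open>w\<close>.\<close>
  have tm: "tangent_map A X n \<omega> = (\<lambda>(x, l). w x ` l)"
    by (auto simp: tangent_map_def PT_trivialization_def PT_inclusion_def w_def \<theta>_def fun_eq_iff image_image)
  have "\<sigma> = (\<lambda>_ _ _. 0)" if "\<sigma> \<in> H0_sym_forms ?S m L" for \<sigma>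
    by (rule H0_vanishes[OF assms(7,8) that]) (use general_fiber in \<open>simp only: tm\<close>)
  moreover have "(\<lambda>_ _ _. 0) \<in> H0_sym_forms ?S m L"
  proof -
    have "openin (ztop ?S) (chart_dom L i)" if "i < charts L" for i
      using assms(7) that unfolding is_line_bundle_def by blast
    then show ?thesis unfolding H0_sym_forms_def by (auto intro: zero_sym_form simp del: ztop_induced)
  qed
  ultimately show ?thesis by blast
qed

end
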